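(* There exists an absolute constant $C_0 > 0$ such that the following holds. Let $u_0 \in H^1(\mathbb{T})$ have zero mean, $\int_{\mathbb{T}} u_0 \, dx = 0$, and satisfy $\| \partial_x u_0 \|_{L^2(\mathbb{T})} \leq 1$. Let $\nu > 0$ and let $u^\nu$ be the solution of the viscous Burgers equation $$ \begin{cases} \partial_t u^\nu + u^\nu \partial_x u^\nu = \nu \partial_x^2 u^\nu, & t > 0, \ x \in \mathbb{T}, \\ u^\nu(0,x) = u_0(x), & x \in \mathbb{T}. \end{cases} $$ Then $$ \| \partial_x u^\nu(t,\cdot) \|_{L^2(\mathbb{T})}^2 \leq C_0 (1 + \nu^{-1}) \qquad \text{for all } t \geq 0 . $$
   Context: $\mathbb{T} = \mathbb{R}/\mathbb{Z}$ is the unit circle (periodic boundary conditions) and functions are real-valued. The solution $u^\nu$ is the unique global solution, bounded on $(0,T)\times\mathbb{T}$ for every $T>0$, understood in the sense of Duhamel's formula $u^\nu(t) = e^{\nu t \partial_x^2} u_0 - \int_0^t \partial_x e^{\nu (t-s)\partial_x^2} \tfrac12 (u^\nu(s))^2 \, ds$, where $e^{\nu t\partial_x^2}$ is the heat semigroup on $\mathbb{T}$; it is smooth for $t>0$. *)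

theory Defs
  imports "HOL-Analysis.Analysis"
begin

text \<open>Functions on \<open>\<T> = \<real>/\<int>\<close> are represented by 1-periodic functions on the line; integrals over
  \<open>\<T>\<close> are Lebesgue integrals over the fundamental domain \<open>[0,1]\<close>.\<close>

definition circle_fun :: "(real \<Rightarrow> real) \<Rightarrow> bool" where
  "circle_fun f \<longleftrightarrow> (\<forall>x. f (x + 1) = f x)"

definition circle_integral :: "(real \<Rightarrow> real) \<Rightarrow> real" where
  "circle_integral f = (LINT x:{0..1}|lborel. f x)"

definition circle_L2 :: "(real \<Rightarrow> real) set" where
  "circle_L2 = {f. circle_fun f \<and> f \<in> borel_measurable borel \<and>
                   set_integrable lborel {0..1} (\<lambda>x. (f x)\<^sup>2)}"

definition circle_L2_norm :: "(real \<Rightarrow> real) \<Rightarrow> real" where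
  "circle_L2_norm f = sqrt (circle_integral (\<lambda>x. (f x)\<^sup>2))"

definition circle_test_fun :: "(real \<Rightarrow> real) \<Rightarrow> bool" where
  "circle_test_fun \<phi> \<longleftrightarrow> circle_fun \<phi> \<and> (\<forall>n. (deriv ^^ n) \<phi> differentiable_on UNIV)"

definition has_weak_dx :: "(real \<Rightarrow> real) \<Rightarrow> (real \<Rightarrow> real) \<Rightarrow> bool" where
  "has_weak_dx f g \<longleftrightarrow> f \<in> circle_L2 \<and> g \<in> circle_L2 \<and>
     (\<forall>\<phi>. circle_test_fun \<phi> \<longrightarrow>
        circle_integral (\<lambda>x. f x * deriv \<phi> x) = - circle_integral (\<lambda>x. g x * \<phi> x))"

definition circle_H1 :: "(real \<Rightarrow> real) set" where
  "circle_H1 = {f. \<exists>g. has_weak_dx f g}"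

text \<open>The weak derivative is unique up to a null set, so the choice does not affect its norm.
  Outside \<open>circle_H1\<close> the value is arbitrary.\<close>

definition weak_dx :: "(real \<Rightarrow> real) \<Rightarrow> real \<Rightarrow> real" where
  "weak_dx f = (SOME g. has_weak_dx f g)"

text \<open>Periodic heat kernel \<open>\<Sum>\<^sub>k exp(-4\<pi>\<^sup>2k\<^sup>2t) exp(2\<pi>ikx)\<close> (sum over all integers \<open>k\<close>) for \<open>t > 0\<close>,
  with the modes \<open>k\<close> and \<open>-k\<close> combined into a cosine.\<close>

definition heat_kernel :: "real \<Rightarrow> real \<Rightarrow> real" where
  "heat_kernel t x =
     1 + 2 * (\<Sum>k. exp (- 4 * pi\<^sup>2 * (real (Suc k))\<^sup>2 * t) * cos (2 * pi * real (Suc k) * x))"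

text \<open>\<open>heat_semigroup t\<close> is \<open>exp(t \<partial>\<^sub>x\<^sup>2)\<close> on \<open>\<T>\<close>, the Fourier multiplier \<open>exp(-4\<pi>\<^sup>2k\<^sup>2t)\<close>;
  only \<open>t \<ge> 0\<close> is meaningful.\<close>

definition heat_semigroup :: "real \<Rightarrow> (real \<Rightarrow> real) \<Rightarrow> real \<Rightarrow> real" where
  "heat_semigroup t f x =
     (if t > 0 then circle_integral (\<lambda>y. heat_kernel t (x - y) * f y) else f x)"

text \<open>\<open>u t x\<close> matters only for \<open>t \<ge> 0\<close>. At \<open>t = 0\<close> Duhamel's formula is the initial condition
  \<open>u 0 = u0\<close>. For \<open>s < t\<close> the function being differentiated is smooth, so \<open>deriv\<close> is its
  classical derivative, of size \<open>O((t - s)\<^bsup>-1/2\<^esup>)\<close> uniformly in \<open>x\<close>; hence the time integral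
  converges absolutely.\<close>

definition burgers_solution :: "real \<Rightarrow> (real \<Rightarrow> real) \<Rightarrow> (real \<Rightarrow> real \<Rightarrow> real) \<Rightarrow> bool" where
  "burgers_solution \<nu> u0 u \<longleftrightarrow>
     (\<forall>t\<ge>0. circle_fun (u t)) \<and>
     set_borel_measurable borel ({0<..} \<times> UNIV) (\<lambda>(t, x). u t x) \<and>
     (\<forall>T>0. \<exists>M. \<forall>t\<in>{0<..<T}. \<forall>x. \<bar>u t x\<bar> \<le> M) \<and>
     (\<forall>t\<ge>0. \<forall>x. u t x =
        heat_semigroup (\<nu> * t) u0 x
        - (LINT s:{0<..<t}|lborel.
             deriv (heat_semigroup (\<nu> * (t - s)) (\<lambda>y. (1/2) * (u s y)\<^sup>2)) x))"

end

theory Submission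
  imports Defs "HOL-Real_Asymp.Real_Asymp"
begin

text \<open>Along a smooth solution \<open>u\<close> put \<open>v = u\<^sub>x\<close>, \<open>E = \<integral> v\<^sup>2\<close> and \<open>D = \<integral> v\<^sub>x\<^sup>2\<close>. The equation
  \<open>v\<^sub>t + (u v)\<^sub>x = \<nu> v\<^sub>x\<^sub>x\<close> does not increase \<open>\<integral> |v|\<close>, which is initially at most \<open>\<parallel>v\<parallel>\<^sub>2 \<le> 1\<close>.
  Moreover \<open>E' = - 2 \<nu> D - \<integral> v\<^sup>3\<close>. As \<open>v\<close> has a zero, \<open>v\<^sup>2 \<le> B := 2 \<integral> |v v\<^sub>x| \<le> 2 (E D)\<^sup>1\<^sup>/\<^sup>2\<close>, so with the
  bound on \<open>\<integral> |v|\<close> both \<open>E\<^sup>2\<close> and \<open>\<integral> |v|\<^sup>3\<close> are at most a constant times \<open>B\<close>. Hence \<open>E' \<le> 0\<close> as soon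
  as \<open>\<nu> E\<close> exceeds an absolute constant, and \<open>E\<close> stays below a constant times \<open>1 + 1/\<nu>\<close>.

  Regularity is obtained from the Cole--Hopf formula \<open>w = - 2 \<nu> \<phi>\<^sub>x / \<phi>\<close> with \<open>\<phi>\<close> the heat flow of
  \<open>exp (- (1/2\<nu>) \<integral> u\<^sub>0)\<close>: the function \<open>w\<close> is smooth for positive times and satisfies Duhamel's formula, whose bounded
  solution is unique because \<open>\<integral> |K\<^sub>x|\<close> is integrable in time. The heat kernel \<open>K\<close> is given by its Fourier series;
  its positivity and its action on continuous functions follow by density from the case of trigonometric polynomials.\<close>

section \<open>The circle as a measure space\<close>

text \<open>The delicate point is where the energy estimate starts. The datum is only in H^1, so the
  energy can be followed only from times s > 0, and it must be bounded as s tends to 0. Strong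
  convergence in H^1 is avoided: by Cole--Hopf, w_x is the average of the weak derivative g of the
  datum with respect to the probability weight K(x - y) phi_0(y) / P_0(x), where P_0 is the heat
  flow of phi_0, up to a remainder that becomes small uniformly in x. Cauchy--Schwarz for this
  weight and the self-adjointness of the heat flow bound the L^2 norm of the average. The price is a
  loss of constants: near time 0 the energy is only known to be at most 5 instead of 1. Hence the
  L^1 norm of w_x is at most (1 + 5) / 2 = 3, and with this value the threshold for nu E comes out
  as 54. The supremum of |w| depends on nu and on the datum without control. It enters only
  qualitatively: in an error term that is sent to 0, in the integrability behind Duhamel's formula,
  and in the uniqueness argument.\<close>

abbreviation circ :: "real measure" where
  "circ \<equiv> restrict_space lborel {0..1}"

lemma circle_integral_eq: "circle_integral f = integral\<^sup>L circ f"
  unfolding circle_integral_def set_lebesgue_integral_def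
  by (subst integral_restrict_space) auto

lemma set_integrable_circ: "set_integrable lborel {0..1::real} f \<longleftrightarrow> integrable circ (f :: real \<Rightarrow> real)"
  unfolding set_integrable_def by (subst integrable_restrict_space) auto

lemma space_circ [simp]: "space circ = {0..1}"
  by (simp add: space_restrict_space)

lemma finite_measure_circ: "finite_measure circ"
  by (rule finite_measureI) (simp add: emeasure_restrict_space)

lemma measure_circ [simp]: "measure circ {0..1} = 1"
  by (simp add: measure_restrict_space)

interpretation circ: finite_measure circ by (rule finite_measure_circ)
interpretation circ2: pair_sigma_finite circ circ ..

lemma measurable_circ [measurable (raw)]: "f \<in> borel_measurable borel \<Longrightarrow> f \<in> borel_measurable circ"
  for f :: "real \<Rightarrow> real"
  by (rule measurable_restrict_space1) simp

lemma borel_measurable_cont_circ: "continuous_on {0..1} f \<Longrightarrow> f \<in> borel_measurable circ"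
  for f :: "real \<Rightarrow> real"
  using borel_measurable_continuous_on_restrict[of "{0..1}" f]
  by (simp add: measurable_def sets_restrict_space space_restrict_space)

lemma continuous_on_bounded_01:
  fixes f :: "real \<Rightarrow> real"
  assumes "continuous_on {0..1} f"
  obtains B where "B \<ge> 0" "\<And>x. x \<in> {0..1} \<Longrightarrow> \<bar>f x\<bar> \<le> B"
proof -
  have "bounded (f ` {0..1})"
    by (intro compact_imp_bounded compact_continuous_image assms) simp
  then obtain B where "\<forall>x\<in>{0..1}. \<bar>f x\<bar> \<le> B" by (auto simp: bounded_iff)
  then show ?thesis using that[of "max B 0"] by (auto simp: le_max_iff_disj)
qed

lemma circ_integrable_bounded:
  fixes f :: "real \<Rightarrow> real"
  assumes "f \<in> borel_measurable circ" "\<And>x. x \<in> {0..1} \<Longrightarrow> \<bar>f x\<bar> \<le> B"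
  shows "integrable circ f"
  by (rule circ.integrable_const_bound[of _ B]) (use assms in auto)

lemma circ_integrable_continuous:
  fixes f :: "real \<Rightarrow> real"
  assumes "continuous_on {0..1} f"
  shows "integrable circ f"
proof -
  obtain B where "\<And>x. x \<in> {0..1} \<Longrightarrow> \<bar>f x\<bar> \<le> B"
    using continuous_on_bounded_01[OF assms] by blast
  then show ?thesis
    using circ_integrable_bounded borel_measurable_cont_circ assms by blast
qed

lemma circ_integrable_mult_bounded:
  fixes f g :: "real \<Rightarrow> real"
  assumes f: "integrable circ f" and g: "g \<in> borel_measurable circ" "\<And>x. x \<in> {0..1} \<Longrightarrow> \<bar>g x\<bar> \<le> B"
  shows "integrable circ (\<lambda>x. g x * f x)"
proof (rule Bochner_Integration.integrable_bound)
  show "integrable circ (\<lambda>x. B * f x)" using f by simp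
  show "AE x in circ. norm (g x * f x) \<le> norm (B * f x)"
  proof (rule AE_I2)
    fix x assume "x \<in> space circ"
    then have "\<bar>g x\<bar> \<le> \<bar>B\<bar>" using g(2)[of x] by force
    then show "norm (g x * f x) \<le> norm (B * f x)"
      by (simp add: abs_mult mult_right_mono)
  qed
qed (use f g in measurable)

lemma circ_integrable_mult_cont:
  fixes f g :: "real \<Rightarrow> real"
  assumes f: "integrable circ f" and g: "continuous_on {0..1} g"
  shows "integrable circ (\<lambda>x. g x * f x)"
  using continuous_on_bounded_01[OF g] circ_integrable_mult_bounded[OF f borel_measurable_cont_circ[OF g]]
  by metis

lemma circ_integral_HK:
  fixes f :: "real \<Rightarrow> real"
  assumes "integrable circ f"
  shows "integral\<^sup>L circ f = integral {0..1} f"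
  using set_borel_integral_eq_integral(2)[of "{0..1}" f] assms
  by (simp add: set_integrable_circ flip: circle_integral_eq circle_integral_def)

lemma circ_integral_FTC:
  fixes f F :: "real \<Rightarrow> real"
  assumes "continuous_on {0..1} f" "\<And>x. x \<in> {0..1} \<Longrightarrow> (F has_real_derivative f x) (at x)"
  shows "integral\<^sup>L circ f = F 1 - F 0"
proof -
  have "(f has_integral (F 1 - F 0)) {0..1}"
    by (rule fundamental_theorem_of_calculus)
       (auto intro!: has_real_derivative_iff_has_vector_derivative[THEN iffD1] DERIV_subset[OF assms(2)])
  then show ?thesis
    using circ_integral_HK[OF circ_integrable_continuous[OF assms(1)]] by (simp add: integral_unique)
qed

lemma circ_integral_abs_le:
  fixes f :: "real \<Rightarrow> real"
  assumes "\<And>x. x \<in> {0..1} \<Longrightarrow> \<bar>f x\<bar> \<le> B" "0 \<le> B"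
  shows "\<bar>integral\<^sup>L circ f\<bar> \<le> B"
proof (cases "integrable circ f")
  case True
  have "\<bar>integral\<^sup>L circ f\<bar> \<le> (LINT x|circ. \<bar>f x\<bar>)"
    using integral_norm_bound[of circ f] by simp
  also have "\<dots> \<le> (LINT x|circ. B)"
    using True assms by (intro integral_mono) auto
  finally show ?thesis by simp
qed (use assms in \<open>simp add: not_integrable_integral_eq\<close>)

lemma circ_integral_nonneg:
  fixes f :: "real \<Rightarrow> real"
  assumes "\<And>x. x \<in> {0..1} \<Longrightarrow> 0 \<le> f x"
  shows "0 \<le> integral\<^sup>L circ f"
  by (rule Bochner_Integration.integral_nonneg_AE) (use assms in auto)

lemma circ_integral_mono:
  fixes f g :: "real \<Rightarrow> real"
  assumes "integrable circ f" "integrable circ g" "\<And>x. x \<in> {0..1} \<Longrightarrow> f x \<le> g x"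
  shows "integral\<^sup>L circ f \<le> integral\<^sup>L circ g"
  by (rule integral_mono) (use assms in auto)

lemma circ_integral_cong:
  fixes f g :: "real \<Rightarrow> real"
  assumes "\<And>x. x \<in> {0..1} \<Longrightarrow> f x = g x"
  shows "integral\<^sup>L circ f = integral\<^sup>L circ g"
  by (rule Bochner_Integration.integral_cong) (use assms in auto)

lemma circ_continuous_eq_zero:
  fixes f :: "real \<Rightarrow> real"
  assumes "continuous_on {0..1} f" "\<And>x. x \<in> {0..1} \<Longrightarrow> 0 \<le> f x" "integral\<^sup>L circ f = 0" "x \<in> {0..1}"
  shows "f x = 0"
proof -
  have i: "integrable circ f" by (rule circ_integrable_continuous[OF assms(1)])
  have "integral {0..1} f = 0" using circ_integral_HK[OF i] assms(3) by simp
  moreover have "f integrable_on {0..1}" using assms(1) by (rule integrable_continuous_real)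
  ultimately have "(f has_integral 0) (cbox 0 1)" by (metis has_integral_integral cbox_interval)
  then show ?thesis
    using has_integral_0_cbox_imp_0[of 0 1 f x] assms by auto
qed

text \<open>Dominated convergence along sequences, with majorant \<open>B * \<bar>f y\<bar>\<close>.
  The parameter lives in a metric space so that the same lemma covers joint continuity in time and
  space and, with a step size as parameter, difference quotients.\<close>

lemma circ_integral_continuous_param:
  fixes k :: "'a::metric_space \<Rightarrow> real \<Rightarrow> real"
  assumes f: "integrable circ f" and r: "0 < r"
    and k: "\<And>y. y \<in> {0..1} \<Longrightarrow> isCont (\<lambda>p. k p y) p0"
    and m: "\<And>p. p \<in> ball p0 r \<Longrightarrow> k p \<in> borel_measurable circ"
    and b: "\<And>p y. p \<in> ball p0 r \<Longrightarrow> y \<in> {0..1} \<Longrightarrow> \<bar>k p y\<bar> \<le> B"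
  shows "isCont (\<lambda>p. (LINT y|circ. k p y * f y)) p0"
  unfolding continuous_at_sequentially
proof (intro allI impI)
  fix X :: "nat \<Rightarrow> 'a" assume X: "X \<longlonglongrightarrow> p0"
  then have "eventually (\<lambda>n. X n \<in> ball p0 r) sequentially"
    using r by (intro topological_tendstoD) auto
  then obtain N where N: "\<And>n. n \<ge> N \<Longrightarrow> X n \<in> ball p0 r" by (auto simp: eventually_sequentially)
  have "(\<lambda>n. (LINT y|circ. k (X (n + N)) y * f y)) \<longlonglongrightarrow> (LINT y|circ. k p0 y * f y)"
  proof (rule integral_dominated_convergence[where w = "\<lambda>y. B * \<bar>f y\<bar>"])
    show "(\<lambda>y. k p0 y * f y) \<in> borel_measurable circ"
      using borel_measurable_integrable[OF f] m[of p0] r by (intro borel_measurable_times) simp_all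
    show "(\<lambda>y. k (X (n + N)) y * f y) \<in> borel_measurable circ" for n
      using borel_measurable_integrable[OF f] m[OF N[of "n + N"]] by (intro borel_measurable_times) simp_all
    show "integrable circ (\<lambda>y. B * \<bar>f y\<bar>)" using f by simp
    show "AE y in circ. (\<lambda>n. k (X (n + N)) y * f y) \<longlonglongrightarrow> k p0 y * f y"
    proof (rule AE_I2, rule tendsto_mult_right)
      fix y assume "y \<in> space circ"
      then have "isCont (\<lambda>p. k p y) p0" using k by simp
      then show "(\<lambda>n. k (X (n + N)) y) \<longlonglongrightarrow> k p0 y"
        using isCont_tendsto_compose LIMSEQ_ignore_initial_segment[OF X, of N] by fastforce
    qed
    show "AE y in circ. norm (k (X (n + N)) y * f y) \<le> B * \<bar>f y\<bar>" for n
      by (rule AE_I2) (use b[OF N[of "n + N"]] in \<open>auto simp: abs_mult intro!: mult_right_mono\<close>)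
  qed
  then show "((\<lambda>p. (LINT y|circ. k p y * f y)) \<circ> X) \<longlonglongrightarrow> (LINT y|circ. k p0 y * f y)"
    by (simp add: o_def LIMSEQ_offset)
qed

text \<open>The difference quotient of \<open>k\<close>, completed by \<open>k'\<close> at step 0,
  is a kernel that is continuous at 0 and bounded by \<open>B\<close> through the mean value
  inequality. Differentiation under the integral thus becomes continuity of a parameter
  integral.\<close>

lemma circ_integral_has_derivative_param:
  fixes k k' :: "real \<Rightarrow> real \<Rightarrow> real"
  assumes f: "integrable circ f" and r: "0 < r"
    and k: "\<And>a y. a \<in> ball a0 r \<Longrightarrow> y \<in> {0..1} \<Longrightarrow> ((\<lambda>a. k a y) has_real_derivative k' a y) (at a)"
    and m: "\<And>a. a \<in> ball a0 r \<Longrightarrow> k a \<in> borel_measurable circ"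
    and m': "k' a0 \<in> borel_measurable circ"
    and i: "\<And>a. a \<in> ball a0 r \<Longrightarrow> integrable circ (\<lambda>y. k a y * f y)"
    and b: "\<And>a y. a \<in> ball a0 r \<Longrightarrow> y \<in> {0..1} \<Longrightarrow> \<bar>k' a y\<bar> \<le> B"
  shows "((\<lambda>a. (LINT y|circ. k a y * f y)) has_real_derivative
          (LINT y|circ. k' a0 y * f y)) (at a0)"
proof -
  define q where "q h y = (if h = 0 then k' a0 y else (k (a0 + h) y - k a0 y) / h)" for h y
  have a0: "a0 \<in> ball a0 r" using r by simp
  have in_ball: "a0 + h \<in> ball a0 r" if "h \<in> ball 0 r" for h using that by (simp add: dist_norm)
  have "isCont (\<lambda>h. (LINT y|circ. q h y * f y)) 0"
  proof (rule circ_integral_continuous_param[OF f r])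
    fix y :: real assume y: "y \<in> {0..1}"
    have "((\<lambda>h. (k (a0 + h) y - k a0 y) / h) \<longlongrightarrow> k' a0 y) (at 0)"
      using k[OF a0 y] by (simp add: DERIV_def)
    then have "((\<lambda>h. q h y) \<longlongrightarrow> k' a0 y) (at 0)"
      by (rule tendsto_cong[THEN iffD1, rotated])
         (auto simp: q_def eventually_at intro!: exI[of _ 1])
    then show "isCont (\<lambda>h. q h y) 0" by (simp add: isCont_def q_def)
  next
    fix h :: real assume "h \<in> ball 0 r"
    then show "q h \<in> borel_measurable circ"
      using m[OF in_ball[of h]] m[OF a0] m' unfolding q_def[abs_def] by (cases "h = 0") simp_all
  next
    fix h y :: real assume h: "h \<in> ball 0 r" and y: "y \<in> {0..1}"
    show "\<bar>q h y\<bar> \<le> B"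
    proof (cases "h = 0")
      case False
      have "convex (ball a0 r)" by simp
      then have "norm (k (a0 + h) y - k a0 y) \<le> B * norm (a0 + h - a0)"
        by (rule field_differentiable_bound[of _ "\<lambda>a. k a y" "\<lambda>a. k' a y"])
           (use b[OF _ y] k[OF _ y] in_ball[OF h] a0 in \<open>auto intro: has_field_derivative_at_within\<close>)
      then show ?thesis using False by (simp add: q_def field_simps)
    qed (use b[OF a0 y] in \<open>simp add: q_def\<close>)
  qed
  then have "((\<lambda>h. (LINT y|circ. q h y * f y)) \<longlongrightarrow> (LINT y|circ. k' a0 y * f y)) (at 0)"
    by (simp add: isCont_def q_def)
  moreover have "eventually (\<lambda>h. (LINT y|circ. q h y * f y) =
     ((LINT y|circ. k (a0 + h) y * f y) - (LINT y|circ. k a0 y * f y)) / h) (at 0)"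
  proof -
    have "(LINT y|circ. q h y * f y) =
     ((LINT y|circ. k (a0 + h) y * f y) - (LINT y|circ. k a0 y * f y)) / h"
      if "h \<noteq> 0" "dist h 0 < r" for h
    proof -
      have "a0 + h \<in> ball a0 r" using that by (intro in_ball) (simp add: dist_commute)
      note 1 = i[OF this] and 2 = i[OF a0]
      have "(\<lambda>y. q h y * f y) = (\<lambda>y. (k (a0 + h) y * f y - k a0 y * f y) / h)"
        using that by (auto simp: q_def field_simps)
      then show ?thesis using 1 2 by simp
    qed
    then show ?thesis using r by (auto simp: eventually_at)
  qed
  ultimately show ?thesis
    unfolding DERIV_def by (rule Lim_transform_eventually)
qed

section \<open>The heat kernel\<close>

text \<open>A single term of the exponential series is a lower bound for
  \<open>exp y\<close>.\<close>

lemma exp_minus_le: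
  assumes "0 < (y::real)" shows "exp (- y) \<le> fact n / y ^ n"
proof -
  have "summable (\<lambda>n. y ^ n /\<^sub>R fact n)" using exp_converges[of y] sums_summable by blast
  then have "y ^ n /\<^sub>R fact n \<le> exp y"
    unfolding exp_def using assms
    by (intro sum_le_suminf[where I = "{n}", simplified]) auto
  then show ?thesis using assms by (simp add: exp_minus field_simps)
qed

text \<open>Each space derivative shifts the phase of a Fourier mode by \<open>\<pi>/2\<close>, and \<open>heat_kernel_dx j\<close> is the
  \<open>j\<close>-th space derivative of the heat kernel.\<close>

definition kernel_mode :: "nat \<Rightarrow> nat \<Rightarrow> real \<Rightarrow> real \<Rightarrow> real" where
  "kernel_mode j k t x = (2 * pi * real (Suc k)) ^ j * exp (- (2 * pi * real (Suc k))\<^sup>2 * t) *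
     cos (2 * pi * real (Suc k) * x + real j * (pi / 2))"

definition heat_kernel_dx :: "nat \<Rightarrow> real \<Rightarrow> real \<Rightarrow> real" where
  "heat_kernel_dx j t x = (if j = 0 then 1 else 0) + 2 * (\<Sum>k. kernel_mode j k t x)"

lemma heat_kernel_eq: "heat_kernel = heat_kernel_dx 0"
proof (intro ext)
  fix t x
  have "exp (- 4 * pi\<^sup>2 * (real (Suc k))\<^sup>2 * t) * cos (2 * pi * real (Suc k) * x) = kernel_mode 0 k t x" for k
    unfolding kernel_mode_def power_mult_distrib by simp
  then show "heat_kernel t x = heat_kernel_dx 0 t x"
    unfolding heat_kernel_def heat_kernel_dx_def by (simp del: of_nat_Suc)
qed

text \<open>A Weierstrass majorant for mode \<open>k\<close> of the \<open>j\<close>-th derivative,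
  uniform in x and in all times at least \<open>d\<close>. It justifies the termwise operations on
  the kernel series.\<close>

definition mode_bound :: "nat \<Rightarrow> real \<Rightarrow> nat \<Rightarrow> real" where
  "mode_bound j d k = (2 * pi * real (Suc k)) ^ j * exp (- (2 * pi * real (Suc k))\<^sup>2 * d)"

lemma kernel_mode_le: "d \<le> t \<Longrightarrow> \<bar>kernel_mode j k t x\<bar> \<le> mode_bound j d k"
proof -
  assume d: "d \<le> t"
  have "\<bar>kernel_mode j k t x\<bar> = (2 * pi * real (Suc k)) ^ j * exp (- (2 * pi * real (Suc k))\<^sup>2 * t) *
     \<bar>cos (2 * pi * real (Suc k) * x + real j * (pi / 2))\<bar>"
    by (simp add: kernel_mode_def abs_mult)
  also have "\<dots> \<le> (2 * pi * real (Suc k)) ^ j * exp (- (2 * pi * real (Suc k))\<^sup>2 * t) * 1"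
    by (intro mult_left_mono) auto
  also have "\<dots> \<le> mode_bound j d k"
    unfolding mode_bound_def using d by (simp add: mult_left_mono)
  finally show ?thesis .
qed

lemma two_pi_Suc_ge: "real (Suc k) \<le> 2 * pi * real (Suc k)"
  using mult_right_mono[of 1 "2 * pi" "real (Suc k)"] pi_ge_two by simp

text \<open>With m the frequency, the exponential bound of order j + 1 yields m^(-2j-2). Against the
  factor m^j this leaves m^(-j-2), which is at most m^(-2).\<close>

lemma summable_mode_bound:
  assumes "0 < d" shows "summable (mode_bound j d)"
proof (rule summable_comparison_test')
  show "summable (\<lambda>k. fact (Suc j) / d ^ Suc j * inverse (real (Suc k) ^ 2))"
    using inverse_power_summable[of 2, where 'a = real]
    by (intro summable_mult) (subst summable_Suc_iff, simp)
  fix k :: nat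
  define m where "m = 2 * pi * real (Suc k)"
  have m: "real (Suc k) \<le> m" unfolding m_def by (rule two_pi_Suc_ge)
  then have m1: "1 \<le> m" by simp
  have "exp (- (m\<^sup>2 * d)) \<le> fact (Suc j) / (m\<^sup>2 * d) ^ Suc j"
    using m1 assms by (intro exp_minus_le) auto
  then have "m ^ j * exp (- (m\<^sup>2 * d)) \<le> m ^ j * (fact (Suc j) / (m\<^sup>2 * d) ^ Suc j)"
    using m1 by (intro mult_left_mono) auto
  also have "\<dots> = fact (Suc j) / d ^ Suc j * (inverse (m ^ j) * inverse (m ^ 2))"
    using m1 assms by (simp add: power_mult_distrib field_simps power2_eq_square)
  also have "\<dots> \<le> fact (Suc j) / d ^ Suc j * (1 * inverse (real (Suc k) ^ 2))"
    using m1 assms m by (intro mult_left_mono mult_mono le_imp_inverse_le power_mono)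
       (auto simp: inverse_le_1_iff)
  finally show "norm (mode_bound j d k) \<le> fact (Suc j) / d ^ Suc j * inverse (real (Suc k) ^ 2)"
    by (simp add: mode_bound_def m_def)
qed

lemma summable_kernel_mode: "0 < t \<Longrightarrow> summable (\<lambda>k. kernel_mode j k t x)"
  using kernel_mode_le[of t t j _ x] summable_comparison_test'[OF summable_mode_bound[of t j], of 0 "\<lambda>k. kernel_mode j k t x"]
  by simp

lemma heat_kernel_dx_bounded:
  assumes "0 < d"
  obtains B where "0 \<le> B" "\<And>t x. d \<le> t \<Longrightarrow> \<bar>heat_kernel_dx j t x\<bar> \<le> B"
proof
  show "0 \<le> 1 + 2 * suminf (mode_bound j d)"
    using suminf_nonneg[OF summable_mode_bound[OF assms]] by (simp add: mode_bound_def)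
  fix t x :: real assume t: "d \<le> t"
  have "\<bar>\<Sum>k. kernel_mode j k t x\<bar> \<le> suminf (mode_bound j d)"
    using norm_suminf_le[OF _ summable_mode_bound[OF assms, of j], of "\<lambda>k. kernel_mode j k t x"]
      kernel_mode_le[OF t] by simp
  then show "\<bar>heat_kernel_dx j t x\<bar> \<le> 1 + 2 * suminf (mode_bound j d)"
    unfolding heat_kernel_dx_def by auto
qed

lemma kernel_mode_has_dx:
  "(kernel_mode j k t has_real_derivative kernel_mode (Suc j) k t x) (at x)"
proof -
  have *: "cos (z + real (Suc j) * (pi / 2)) = - sin (z + real j * (pi / 2))" for z
  proof -
    have "z + real (Suc j) * (pi / 2) = (z + real j * (pi / 2)) + pi / 2" by (simp add: field_simps)
    then show ?thesis by (simp only: cos_add) simp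
  qed
  have "((\<lambda>x. A * B * cos (c * x + b)) has_real_derivative c * A * B * (- sin (c * x + b))) (at x)"
    for A B b c :: real
    by (auto intro!: derivative_eq_intros)
  then show ?thesis
    unfolding kernel_mode_def[abs_def] * power_Suc .
qed

text \<open>One time derivative raises the index by two: it produces minus the squared frequency,
  and the sign is a phase shift by pi. This is the heat equation for a single mode.\<close>

lemma kernel_mode_has_dt:
  "((\<lambda>t. kernel_mode j k t x) has_real_derivative kernel_mode (Suc (Suc j)) k t x) (at t)"
proof -
  have *: "cos (z + real (Suc (Suc j)) * (pi / 2)) = - cos (z + real j * (pi / 2))" for z
  proof -
    have "z + real (Suc (Suc j)) * (pi / 2) = (z + real j * (pi / 2)) + pi" by (simp add: field_simps)
    then show ?thesis by (simp only: cos_add) simp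
  qed
  have "((\<lambda>t. A * exp (- c\<^sup>2 * t) * b) has_real_derivative c * (c * A) * exp (- c\<^sup>2 * t) * - b) (at t)"
    for A b c :: real
    by (auto intro!: derivative_eq_intros simp: power2_eq_square)
  then show ?thesis
    unfolding kernel_mode_def[abs_def] * power_Suc .
qed

lemma heat_kernel_dx_has_dx:
  assumes "0 < t"
  shows "(heat_kernel_dx j t has_real_derivative heat_kernel_dx (Suc j) t x) (at x)"
proof -
  have "((\<lambda>x. \<Sum>k. kernel_mode j k t x) has_real_derivative (\<Sum>k. kernel_mode (Suc j) k t x)) (at x)"
  proof (rule has_field_derivative_series'(2)[of UNIV])
    show "uniformly_convergent_on UNIV (\<lambda>n x. \<Sum>i<n. kernel_mode (Suc j) i t x)"
      using kernel_mode_le[of t t] summable_mode_bound[OF assms, of "Suc j"]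
      by (intro Weierstrass_m_test'[of _ _ "mode_bound (Suc j) t"]) auto
  qed (use summable_kernel_mode[OF assms] kernel_mode_has_dx in auto)
  then show ?thesis
    unfolding heat_kernel_dx_def[abs_def] by (auto intro!: derivative_eq_intros)
qed

lemma heat_kernel_dx_reflected_deriv:
  assumes "0 < t"
  shows "((\<lambda>y. heat_kernel_dx j t (x - y)) has_real_derivative - heat_kernel_dx (Suc j) t (x - y)) (at y)"
proof -
  have "((\<lambda>y. x - y) has_real_derivative - 1) (at y)" by (auto intro!: derivative_eq_intros)
  from DERIV_chain2[OF heat_kernel_dx_has_dx[OF assms] this] show ?thesis by simp
qed

lemma heat_kernel_dx_has_dt:
  assumes "0 < t"
  shows "((\<lambda>t. heat_kernel_dx j t x) has_real_derivative heat_kernel_dx (Suc (Suc j)) t x) (at t)"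
proof -
  \<comment> \<open>The majorants blow up as the time tends to 0, so uniform convergence is asked
    only on \<open>{t/2..}\<close>, which is a neighbourhood of t.\<close>
  have "((\<lambda>t. \<Sum>k. kernel_mode j k t x) has_real_derivative (\<Sum>k. kernel_mode (Suc (Suc j)) k t x)) (at t)"
  proof (rule has_field_derivative_series'(2)[of "{t/2..}" _ _ t])
    show "uniformly_convergent_on {t/2..} (\<lambda>n t. \<Sum>i<n. kernel_mode (Suc (Suc j)) i t x)"
      using kernel_mode_le[of "t/2"] summable_mode_bound[of "t/2" "Suc (Suc j)"] assms
      by (intro Weierstrass_m_test'[of _ _ "mode_bound (Suc (Suc j)) (t/2)"]) auto
  qed (use summable_kernel_mode[OF assms] kernel_mode_has_dt assms in \<open>auto intro: has_field_derivative_at_within\<close>)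
  then show ?thesis
    unfolding heat_kernel_dx_def[abs_def] by (auto intro!: derivative_eq_intros)
qed

lemma continuous_on_heat_kernel_dx_prod:
  "continuous_on ({0<..} \<times> UNIV) (\<lambda>p. heat_kernel_dx j (fst p) (snd p))"
proof -
  have "isCont (\<lambda>p. heat_kernel_dx j (fst p) (snd p)) (t, x)" if t: "0 < t" for t x
  proof -
    let ?S = "{t/2<..} \<times> (UNIV :: real set)"
    have "continuous_on ?S (\<lambda>p. \<Sum>k. kernel_mode j k (fst p) (snd p))"
    proof (rule uniform_limit_theorem)
      show "uniform_limit ?S (\<lambda>n p. \<Sum>k<n. kernel_mode j k (fst p) (snd p))
             (\<lambda>p. \<Sum>k. kernel_mode j k (fst p) (snd p)) sequentially"
        using kernel_mode_le[of "t/2"] summable_mode_bound[of "t/2" j] t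
        by (intro Weierstrass_m_test[of _ _ "mode_bound j (t/2)"]) auto
      show "\<forall>\<^sub>F n in sequentially. continuous_on ?S (\<lambda>p. \<Sum>k<n. kernel_mode j k (fst p) (snd p))"
        unfolding kernel_mode_def by (intro always_eventually allI continuous_intros)
    qed simp
    then have "continuous_on ?S (\<lambda>p. heat_kernel_dx j (fst p) (snd p))"
      unfolding heat_kernel_dx_def by (intro continuous_intros)
    moreover have "open ?S" by (intro open_Times) auto
    ultimately show ?thesis using t by (auto simp: continuous_on_eq_continuous_at)
  qed
  then have "isCont (\<lambda>p. heat_kernel_dx j (fst p) (snd p)) p" if "0 < fst p" for p :: "real \<times> real"
    using that by (metis prod.collapse)
  then show ?thesis by (intro continuous_at_imp_continuous_on ballI) (simp add: mem_Times_iff)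
qed

lemma continuous_on_heat_kernel_dx [continuous_intros]:
  assumes "continuous_on S f" "continuous_on S g" "\<And>x. x \<in> S \<Longrightarrow> 0 < f x"
  shows "continuous_on S (\<lambda>x. heat_kernel_dx j (f x) (g x))"
proof -
  have "continuous_on S (\<lambda>x. (f x, g x))" by (intro continuous_on_Pair assms)
  moreover have "(\<lambda>x. (f x, g x)) ` S \<subseteq> {0<..} \<times> UNIV" using assms(3) by auto
  ultimately have "continuous_on S ((\<lambda>p. heat_kernel_dx j (fst p) (snd p)) \<circ> (\<lambda>x. (f x, g x)))"
    using continuous_on_compose continuous_on_subset[OF continuous_on_heat_kernel_dx_prod] by blast
  then show ?thesis by (simp add: o_def)
qed

lemma measurable_heat_kernel_dx [measurable (raw)]:
  assumes "f \<in> borel_measurable M" "g \<in> borel_measurable M"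
  shows "(\<lambda>x. heat_kernel_dx j (f x) (g x)) \<in> borel_measurable M"
  using assms unfolding heat_kernel_dx_def kernel_mode_def
  by (intro borel_measurable_add borel_measurable_times borel_measurable_suminf borel_measurable_const
      borel_measurable_exp borel_measurable_cos) simp_all

section \<open>Periodicity, parity and orthogonality of the modes\<close>

lemma cos_periodic_nat: "cos (2 * pi * real n * (x + 1) + a) = cos (2 * pi * real n * x + a)"
proof -
  have *: "2 * pi * real n * (x + 1) + a = (2 * pi * real n * x + a) + 2 * pi * of_int (int n)"
    by (simp add: algebra_simps)
  show ?thesis
    unfolding * cos_add[of _ "2 * pi * of_int (int n)"] cos_int_2pin sin_int_2pin by simp
qed

lemma heat_kernel_dx_periodic [simp]: "heat_kernel_dx j t (x + 1) = heat_kernel_dx j t x"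
  unfolding heat_kernel_dx_def kernel_mode_def by (simp only: cos_periodic_nat)

lemma heat_kernel_dx_0_even: "heat_kernel_dx 0 t (- x) = heat_kernel_dx 0 t x"
  unfolding heat_kernel_dx_def kernel_mode_def by simp

lemma heat_kernel_dx_0_commute: "heat_kernel_dx 0 t (x - y) = heat_kernel_dx 0 t (y - x)"
  using heat_kernel_dx_0_even[of t "y - x"] by (simp only: minus_diff_eq)

lemma circ_integral_cos:
  fixes k :: int
  shows "(LINT y|circ. cos (2 * pi * k * y + b)) = (if k = 0 then cos b else 0)"
proof (cases "k = 0")
  case False
  have "(LINT y|circ. cos (2 * pi * k * y + b)) =
     sin (2 * pi * k * 1 + b) / (2 * pi * k) - sin (2 * pi * k * 0 + b) / (2 * pi * k)"
    using False by (intro circ_integral_FTC) (auto intro!: derivative_eq_intros continuous_intros)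
  also have "sin (2 * pi * k * 1 + b) = sin b"
    unfolding mult_1_right sin_add sin_int_2pin cos_int_2pin by simp
  finally show ?thesis using False by simp
qed simp

text \<open>By the product-to-sum formula the frequencies in y are - m - n and n - m. The first
  never vanishes because m is positive, so only n = m contributes; n = 0 is allowed.\<close>

lemma circ_integral_cos_cos:
  fixes m n :: nat
  assumes "0 < m"
  shows "(LINT y|circ. cos (2 * pi * real m * (x - y) + a) * cos (2 * pi * real n * y + b)) =
     (if m = n then cos (2 * pi * real n * x + a + b) / 2 else 0)"
proof -
  have 1: "cos (2 * pi * real m * (x - y) + a) * cos (2 * pi * real n * y + b) =
     cos (2 * pi * of_int (- int m - int n) * y + (2 * pi * real m * x + a - b)) / 2
     + cos (2 * pi * of_int (int n - int m) * y + (2 * pi * real m * x + a + b)) / 2" for y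
  proof -
    have "2 * pi * real m * (x - y) + a - (2 * pi * real n * y + b) =
       2 * pi * of_int (- int m - int n) * y + (2 * pi * real m * x + a - b)"
      by (simp add: algebra_simps)
    moreover have "2 * pi * real m * (x - y) + a + (2 * pi * real n * y + b) =
       2 * pi * of_int (int n - int m) * y + (2 * pi * real m * x + a + b)"
      by (simp add: algebra_simps)
    ultimately show ?thesis by (simp only: cos_times_cos add_divide_distrib)
  qed
  have c: "integrable circ (\<lambda>y. cos (c * y + d) / 2)" for c d
    by (intro circ_integrable_continuous continuous_intros) auto
  have "(LINT y|circ. cos (2 * pi * real m * (x - y) + a) * cos (2 * pi * real n * y + b)) =
    (if - int m - int n = 0 then cos (2 * pi * real m * x + a - b) else 0) / 2 +
    (if int n - int m = 0 then cos (2 * pi * real m * x + a + b) else 0) / 2"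
    by (simp only: 1 Bochner_Integration.integral_add[OF c c] Bochner_Integration.integral_divide_zero
          circ_integral_cos)
  then show ?thesis using assms by (cases "m = n") simp_all
qed

text \<open>An upper bound suffices, since these integrals are multiplied by products of nonnegative
  Fourier coefficients.\<close>

lemma circ_integral_cos_cos_diff:
  fixes m n :: nat
  assumes "0 < m" "0 < n"
  shows "(LINT y|circ. cos (2 * pi * real m * (x - y) + a) * cos (2 * pi * real n * (x - y) + a)) \<le>
     (if m = n then 1 else 0)"
proof -
  have 2: "cos (2 * pi * real n * (x - y) + a) = cos (2 * pi * real n * y + (- a - 2 * pi * real n * x))" for y
    using cos_minus[of "2 * pi * real n * (x - y) + a"] by (simp add: algebra_simps)
  have "(LINT y|circ. cos (2 * pi * real m * (x - y) + a) * cos (2 * pi * real n * (x - y) + a)) =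
    (LINT y|circ. cos (2 * pi * real m * (x - y) + a) * cos (2 * pi * real n * y + (- a - 2 * pi * real n * x)))"
    by (simp only: 2)
  also have "\<dots> = (if m = n then cos (2 * pi * real n * x + a + (- a - 2 * pi * real n * x)) / 2 else 0)"
    by (rule circ_integral_cos_cos[OF assms(1)])
  also have "\<dots> \<le> (if m = n then 1 else 0)"
    using cos_le_one[of "2 * pi * real n * x + a + (- a - 2 * pi * real n * x)"] by auto
  finally show ?thesis .
qed

section \<open>Integrability in time of the gradient of the heat kernel\<close>

lemma powr_exp_le:
  assumes "0 < (y::real)" shows "exp (- y) \<le> 2 * y powr (- 7/4)"
proof -
  have "y powr (7/4) \<le> 1 + y\<^sup>2"
  proof (cases "y \<le> 1")
    case True
    then have "y powr (7/4) \<le> 1 powr (7/4)" using assms by (intro powr_mono2) auto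
    then show ?thesis by (simp add: add_increasing2)
  next
    case False
    then have "y powr (7/4) \<le> y powr 2" by (intro powr_mono) auto
    then show ?thesis using False by simp
  qed
  also have "\<dots> \<le> 2 * exp y"
    using exp_lower_Taylor_quadratic[of y] assms by (simp add: power2_eq_square)
  finally have *: "y powr (7/4) \<le> 2 * exp y" .
  have "0 < y powr (7/4)" using assms by simp
  then have "1 / exp y \<le> 2 / y powr (7/4)" using * by (simp add: divide_simps)
  then show ?thesis by (simp add: exp_minus powr_minus_divide inverse_eq_divide)
qed

lemma heat_kernel_dx_limit:
  assumes "0 < t"
  shows "(\<lambda>n. (if j = 0 then 1 else 0) + 2 * (\<Sum>k<n. kernel_mode j k t x)) \<longlonglongrightarrow> heat_kernel_dx j t x"
  unfolding heat_kernel_dx_def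
  by (intro tendsto_add tendsto_mult tendsto_const summable_LIMSEQ summable_kernel_mode assms)

lemma heat_kernel_partial_le:
  assumes "0 < t"
  shows "\<bar>(if j = 0 then 1 else 0) + 2 * (\<Sum>k<n. kernel_mode j k t x)\<bar> \<le> 1 + 2 * suminf (mode_bound j t)"
proof -
  have "\<bar>\<Sum>k<n. kernel_mode j k t x\<bar> \<le> (\<Sum>k<n. \<bar>kernel_mode j k t x\<bar>)" by (rule sum_abs)
  also have "\<dots> \<le> (\<Sum>k<n. mode_bound j t k)"
    by (intro sum_mono kernel_mode_le) simp
  also have "\<dots> \<le> suminf (mode_bound j t)"
    by (intro sum_le_suminf summable_mode_bound assms) (auto simp: mode_bound_def)
  finally show ?thesis by auto
qed

text \<open>Any exponent in \<open>(3/2, 2)\<close> would do in place of \<open>7/4\<close>: it makes the series below converge and its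
  half is integrable at the origin.\<close>

lemma heat_kernel_dx_1_L2:
  obtains C where "0 < C" "\<And>t x. 0 < t \<Longrightarrow>
    (LINT y|circ. (heat_kernel_dx 1 t (x - y))\<^sup>2) \<le> C * t powr (- 7/4)"
proof -
  \<comment> \<open>Splitting the time factor \<open>t powr (- 7/4)\<close> off the squared
    coefficient of frequency m leaves m^2 (m^2)^(-7/4) = m^(-3/2), which is summable.\<close>
  define c where "c k = real (Suc k) powr (- 3/2)" for k
  have "summable (\<lambda>n. real n powr (- 3/2))"
    by (subst summable_real_powr_iff) simp
  then have c: "summable c" unfolding c_def by (subst summable_Suc_iff)
  have c0: "0 \<le> suminf c" by (rule suminf_nonneg[OF c]) (simp add: c_def)
  have main: "(LINT y|circ. (heat_kernel_dx 1 t (x - y))\<^sup>2) \<le> (8 * suminf c + 1) * t powr (- 7/4)"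
    if t: "0 < t" for t x :: real
  proof -
    define a where "a k = (2 * pi * real (Suc k)) * exp (- (2 * pi * real (Suc k))\<^sup>2 * t)" for k
    define \<phi> where "\<phi> k y = cos (2 * pi * real (Suc k) * (x - y) + pi / 2)" for k y
    define S where "S n y = (\<Sum>k<n. kernel_mode 1 k t (x - y))" for n y
    have a0: "0 \<le> a k" for k by (simp add: a_def)
    have aa: "a k * a k \<le> 2 * c k * t powr (- 7/4)" for k
    proof -
      define m where "m = 2 * pi * real (Suc k)"
      have m: "real (Suc k) \<le> m" unfolding m_def by (rule two_pi_Suc_ge)
      then have m1: "1 \<le> m" by simp
      have "a k * a k = m\<^sup>2 * exp (- (2 * m\<^sup>2 * t))"
      proof -
        have "a k = m * exp (- m\<^sup>2 * t)" by (simp only: a_def m_def)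
        then have "a k * a k = m\<^sup>2 * (exp (- m\<^sup>2 * t) * exp (- m\<^sup>2 * t))"
          by (simp add: power2_eq_square mult_ac)
        also have "exp (- m\<^sup>2 * t) * exp (- m\<^sup>2 * t) = exp (- (2 * m\<^sup>2 * t))"
          by (simp flip: exp_add)
        finally show ?thesis .
      qed
      also have "\<dots> \<le> m\<^sup>2 * (2 * (2 * m\<^sup>2 * t) powr (- 7/4))"
        using m1 t by (intro mult_left_mono powr_exp_le) auto
      also have "\<dots> \<le> m\<^sup>2 * (2 * (m\<^sup>2 * t) powr (- 7/4))"
        using m1 t by (intro mult_left_mono powr_mono2') auto
      also have "\<dots> = 2 * (m\<^sup>2 * (m\<^sup>2) powr (- 7/4)) * t powr (- 7/4)"
        using m1 t by (simp add: powr_mult)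
      also have "m\<^sup>2 * (m\<^sup>2) powr (- 7/4) = m powr (- 3/2)"
        using m1 by (simp add: powr_powr flip: powr_numeral powr_add)
      also have "\<dots> \<le> c k" unfolding c_def using m by (intro powr_mono2') auto
      finally show ?thesis using t by simp
    qed
    have S: "S n y = (\<Sum>k<n. a k * \<phi> k y)" for n y
      by (simp add: S_def kernel_mode_def a_def \<phi>_def)
    have phi_cont: "continuous_on {0..1} (\<phi> k)" for k
      unfolding \<phi>_def by (intro continuous_intros)
    have ibd: "integrable circ (\<lambda>y. a k * \<phi> k y * (a l * \<phi> l y))" for k l
      by (intro circ_integrable_continuous continuous_intros phi_cont)
    \<comment> \<open>Parseval for the partial sums: expanding the square leaves only the diagonal.
      The bound is independent of n and hence survives the limit taken below.\<close>
    have SS: "(LINT y|circ. (2 * S n y)\<^sup>2) \<le> 8 * suminf c * t powr (- 7/4)" for n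
    proof -
      have "(LINT y|circ. (2 * S n y)\<^sup>2) = 4 * (LINT y|circ. S n y * S n y)"
        by (simp add: power2_eq_square mult_ac flip: integral_mult_right_zero)
      also have "(LINT y|circ. S n y * S n y) =
          (\<Sum>k<n. \<Sum>l<n. (LINT y|circ. a k * \<phi> k y * (a l * \<phi> l y)))"
        unfolding S sum_product by (subst Bochner_Integration.integral_sum | intro sum.cong refl Bochner_Integration.integrable_sum ibd)+
      also have "\<dots> = (\<Sum>k<n. \<Sum>l<n. a k * a l * (LINT y|circ. \<phi> k y * \<phi> l y))"
        by (simp add: mult_ac flip: integral_mult_right_zero)
      also have "\<dots> \<le> (\<Sum>k<n. \<Sum>l<n. a k * a l * (if k = l then 1 else 0))"
        using circ_integral_cos_cos_diff[of "Suc k" "Suc l" x "pi/2" for k l]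
        by (intro sum_mono mult_left_mono) (auto simp: a0 \<phi>_def simp del: of_nat_Suc)
      also have "\<dots> = (\<Sum>k<n. a k * a k)" by (simp add: if_distrib cong: if_cong)
      also have "\<dots> \<le> (\<Sum>k<n. 2 * c k * t powr (- 7/4))" by (intro sum_mono aa)
      also have "\<dots> = 2 * (\<Sum>k<n. c k) * t powr (- 7/4)" by (simp add: sum_distrib_left sum_distrib_right)
      also have "\<dots> \<le> 2 * suminf c * t powr (- 7/4)"
        by (intro mult_right_mono mult_left_mono sum_le_suminf c) (auto simp: c_def)
      finally show ?thesis by simp
    qed
    define B where "B = 1 + 2 * suminf (mode_bound 1 t)"
    have "(\<lambda>n. (LINT y|circ. (2 * S n y)\<^sup>2)) \<longlonglongrightarrow> (LINT y|circ. (heat_kernel_dx 1 t (x - y))\<^sup>2)"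
    proof (rule integral_dominated_convergence[where w = "\<lambda>y. B\<^sup>2"])
      show "(\<lambda>y. (heat_kernel_dx 1 t (x - y))\<^sup>2) \<in> borel_measurable circ" by measurable
      show "(\<lambda>y. (2 * S n y)\<^sup>2) \<in> borel_measurable circ" for n
        unfolding S_def kernel_mode_def by measurable
      show "AE y in circ. (\<lambda>n. (2 * S n y)\<^sup>2) \<longlonglongrightarrow> (heat_kernel_dx 1 t (x - y))\<^sup>2"
        using heat_kernel_dx_limit[OF t, of 1] by (intro AE_I2 tendsto_intros) (simp add: S_def)
      show "AE y in circ. norm ((2 * S n y)\<^sup>2) \<le> B\<^sup>2" for n
      proof (rule AE_I2)
        fix y :: real
        have "\<bar>2 * S n y\<bar> \<le> B"
          using heat_kernel_partial_le[OF t, of 1 "x - y" n] by (simp add: S_def B_def)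
        then have "\<bar>2 * S n y\<bar>\<^sup>2 \<le> B\<^sup>2" by (intro power_mono) auto
        then show "norm ((2 * S n y)\<^sup>2) \<le> B\<^sup>2" by simp
      qed
    qed simp
    then have "(LINT y|circ. (heat_kernel_dx 1 t (x - y))\<^sup>2) \<le> 8 * suminf c * t powr (- 7/4)"
      by (rule LIMSEQ_le_const2) (use SS in auto)
    also have "\<dots> \<le> (8 * suminf c + 1) * t powr (- 7/4)" by (simp add: distrib_right)
    finally show ?thesis .
  qed
  show ?thesis by (rule that[of "8 * suminf c + 1"]) (use c0 main in auto)
qed

text \<open>Instead of Cauchy--Schwarz, the pointwise inequality |z| \<le> \<alpha> z^2 + 1/\<alpha>
  is integrated. The choice \<alpha> = t^(7/8) gives both terms the rate t^(-7/8), which is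
  integrable at time 0.\<close>

lemma heat_kernel_dx_1_L1:
  obtains C where "0 < C" "\<And>t x. 0 < t \<Longrightarrow>
    (LINT y|circ. \<bar>heat_kernel_dx 1 t (x - y)\<bar>) \<le> C * t powr (- 7/8)"
proof -
  obtain C where C: "0 < C" "\<And>t x. 0 < t \<Longrightarrow>
    (LINT y|circ. (heat_kernel_dx 1 t (x - y))\<^sup>2) \<le> C * t powr (- 7/4)"
    using heat_kernel_dx_1_L2 by blast
  have main: "(LINT y|circ. \<bar>heat_kernel_dx 1 t (x - y)\<bar>) \<le> (C + 1) * t powr (- 7/8)"
    if t: "0 < t" for t x :: real
  proof -
    define \<alpha> where "\<alpha> = t powr (7/8)"
    have \<alpha>: "0 < \<alpha>" using t by (simp add: \<alpha>_def)
    have 1: "integrable circ (\<lambda>y. (heat_kernel_dx 1 t (x - y))\<^sup>2)"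
      and 2: "integrable circ (\<lambda>y. \<bar>heat_kernel_dx 1 t (x - y)\<bar>)"
      using t by (auto intro!: circ_integrable_continuous continuous_intros)
    have am: "\<bar>z\<bar> \<le> \<alpha> * z\<^sup>2 + 1 / \<alpha>" for z :: real
    proof -
      have "2 * (\<alpha> * \<bar>z\<bar>) * 1 \<le> (\<alpha> * \<bar>z\<bar>)\<^sup>2 + 1\<^sup>2" by (rule sum_squares_bound)
      moreover have "0 \<le> \<alpha> * \<bar>z\<bar>" using \<alpha> by simp
      moreover have "(\<alpha> * \<bar>z\<bar>)\<^sup>2 = \<alpha> * (\<alpha> * z\<^sup>2)"
        by (simp add: power_mult_distrib power2_eq_square[of \<alpha>])
      ultimately have "\<alpha> * \<bar>z\<bar> \<le> \<alpha> * (\<alpha> * z\<^sup>2) + 1" by simp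
      also have "\<dots> = \<alpha> * (\<alpha> * z\<^sup>2 + 1 / \<alpha>)" using \<alpha> by (simp add: distrib_left)
      finally show ?thesis using \<alpha> by simp
    qed
    have "(LINT y|circ. \<bar>heat_kernel_dx 1 t (x - y)\<bar>) \<le>
      (LINT y|circ. \<alpha> * (heat_kernel_dx 1 t (x - y))\<^sup>2 + 1 / \<alpha>)"
      using 1 2 am by (intro circ_integral_mono) auto
    also have "\<dots> = \<alpha> * (LINT y|circ. (heat_kernel_dx 1 t (x - y))\<^sup>2) + 1 / \<alpha>"
      using 1 by simp
    also have "\<dots> \<le> \<alpha> * (C * t powr (- 7/4)) + 1 / \<alpha>"
      using C(2)[OF t, of x] \<alpha> by simp
    also have "\<alpha> * (C * t powr (- 7/4)) = C * t powr (- 7/8)"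
      unfolding \<alpha>_def using t by (simp flip: powr_add)
    also have "1 / \<alpha> = t powr (- 7/8)" unfolding \<alpha>_def using t by (simp add: powr_minus_divide)
    finally show ?thesis by (simp add: distrib_right)
  qed
  show ?thesis by (rule that[of "C + 1"]) (use C main in auto)
qed

section \<open>Trigonometric polynomials and the heat flow\<close>

text \<open>The free phase lets one kind of generator cover sines as well as cosines and turns
  derivatives into phase shifts. Linear statements then need to be checked on a single cosine
  only.\<close>

inductive trig_poly :: "(real \<Rightarrow> real) \<Rightarrow> bool" where
  cos: "trig_poly (\<lambda>x. cos (2 * pi * real n * x + a))"
| add: "trig_poly f \<Longrightarrow> trig_poly g \<Longrightarrow> trig_poly (\<lambda>x. f x + g x)"
| scale: "trig_poly f \<Longrightarrow> trig_poly (\<lambda>x. c * f x)"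

lemma trig_poly_const: "trig_poly (\<lambda>x. c)"
  using trig_poly.scale[OF trig_poly.cos[of 0 0], of c] by simp

lemma trig_poly_cos_mult_cos:
  "trig_poly (\<lambda>x. cos (2 * pi * real n * x + a) * cos (2 * pi * real m * x + b))"
proof -
  \<comment> \<open>Frequencies are natural numbers, so a negative difference is reversed by the
    evenness of the cosine.\<close>
  have diff: "trig_poly (\<lambda>x. cos (2 * pi * real n * x + a - (2 * pi * real m * x + b)))"
  proof (cases "m \<le> n")
    case True
    then have "2 * pi * real n * x + a - (2 * pi * real m * x + b) = 2 * pi * real (n - m) * x + (a - b)" for x
      by (simp add: of_nat_diff algebra_simps)
    then show ?thesis using trig_poly.cos[of "n - m" "a - b"] by (simp only:)
  next
    case False
    then have "2 * pi * real n * x + a - (2 * pi * real m * x + b) = - (2 * pi * real (m - n) * x + (b - a))" for x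
      by (simp add: of_nat_diff algebra_simps)
    then show ?thesis using trig_poly.cos[of "m - n" "b - a"] by (simp only: cos_minus)
  qed
  have "2 * pi * real n * x + a + (2 * pi * real m * x + b) = 2 * pi * real (n + m) * x + (a + b)" for x
    by (simp add: algebra_simps)
  then have "trig_poly (\<lambda>x. cos (2 * pi * real n * x + a + (2 * pi * real m * x + b)))"
    using trig_poly.cos[of "n + m" "a + b"] by (simp only:)
  from trig_poly.scale[OF trig_poly.add[OF diff this], of "1/2"]
  show ?thesis by (simp add: cos_times_cos)
qed

text \<open>Stone--Weierstrass needs an algebra. The two nested inductions reduce closure under
  products to the product of two cosines.\<close>

lemma trig_poly_mult:
  assumes "trig_poly f" "trig_poly g" shows "trig_poly (\<lambda>x. f x * g x)"
  using assms(1)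
proof induction
  case (cos n a)
  show ?case using assms(2)
  proof induction
    case (cos m b)
    show ?case by (rule trig_poly_cos_mult_cos)
  next
    case (add f g)
    then show ?case using trig_poly.add[OF add.IH] by (simp add: distrib_left)
  next
    case (scale f c)
    then show ?case using trig_poly.scale[OF scale.IH, of c] by (simp add: mult_ac)
  qed
next
  case (add f h)
  then show ?case using trig_poly.add[OF add.IH] by (simp add: distrib_right)
next
  case (scale f c)
  then show ?case using trig_poly.scale[OF scale.IH, of c] by (simp add: mult_ac)
qed

lemma trig_poly_continuous: "trig_poly f \<Longrightarrow> continuous_on S f"
  by (induction rule: trig_poly.induct) (auto intro!: continuous_intros)

lemma trig_poly_periodic: "trig_poly f \<Longrightarrow> circle_fun f"
  by (induction rule: trig_poly.induct) (auto simp: circle_fun_def cos_periodic_nat)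

lemma trig_poly_has_derivative:
  "trig_poly f \<Longrightarrow> \<exists>f'. trig_poly f' \<and> (\<forall>x. (f has_real_derivative f' x) (at x))"
proof (induction rule: trig_poly.induct)
  case (cos n a)
  have "cos (2 * pi * real n * x + (a + pi/2)) = - sin (2 * pi * real n * x + a)" for x
    by (simp only: add.assoc[symmetric] cos_add[of _ "pi/2"]) simp
  then show ?case
    by (intro exI[of _ "\<lambda>x. (2 * pi * real n) * cos (2 * pi * real n * x + (a + pi/2))"] conjI
          trig_poly.scale trig_poly.cos) (auto intro!: derivative_eq_intros)
next
  case (add f g)
  then obtain f' g' where "trig_poly f'" "\<forall>x. (f has_real_derivative f' x) (at x)"
    "trig_poly g'" "\<forall>x. (g has_real_derivative g' x) (at x)" by blast
  then show ?case
    by (intro exI[of _ "\<lambda>x. f' x + g' x"]) (auto intro!: trig_poly.add derivative_intros)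
next
  case (scale f c)
  then obtain f' where f': "trig_poly f'" "\<forall>x. (f has_real_derivative f' x) (at x)" by blast
  have "((\<lambda>x. c * f x) has_real_derivative c * f' x) (at x)" for x
    using f'(2) by (auto intro: DERIV_cmult)
  then show ?case using trig_poly.scale[OF f'(1), of c] by blast
qed

lemma trig_poly_test_fun:
  assumes "trig_poly f" shows "circle_test_fun f"
proof -
  have "trig_poly ((deriv ^^ n) f)" for n
  proof (induction n)
    case (Suc n)
    then obtain f' where f': "trig_poly f'" "\<forall>x. ((deriv ^^ n) f has_real_derivative f' x) (at x)"
      using trig_poly_has_derivative by blast
    then have "deriv ((deriv ^^ n) f) = f'" by (auto intro!: DERIV_imp_deriv)
    then show ?case using f' by simp
  qed (use assms in simp)
  then have "(deriv ^^ n) f differentiable_on UNIV" for n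
    using trig_poly_has_derivative[of "(deriv ^^ n) f"]
    by (auto simp: differentiable_on_def real_differentiable_def)
  then show ?thesis using trig_poly_periodic[OF assms] by (simp add: circle_test_fun_def)
qed

text \<open>All derivatives sit on the kernel, so this is the \<open>j\<close>-th space derivative
  of the heat flow of a merely integrable \<open>f\<close>. The case \<open>j = 1\<close> is the
  operator inside Duhamel's integral.\<close>

definition heat_conv :: "nat \<Rightarrow> real \<Rightarrow> (real \<Rightarrow> real) \<Rightarrow> real \<Rightarrow> real" where
  "heat_conv j t f x = (LINT y|circ. heat_kernel_dx j t (x - y) * f y)"

lemma heat_semigroup_eq: "0 < t \<Longrightarrow> heat_semigroup t f x = heat_conv 0 t f x"
  by (simp add: heat_semigroup_def heat_conv_def circle_integral_eq heat_kernel_eq)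

lemma heat_kernel_integrable_mult:
  assumes "0 < t" "integrable circ f"
  shows "integrable circ (\<lambda>y. heat_kernel_dx j t (x - y) * f y)"
  by (rule circ_integrable_mult_cont[OF assms(2)]) (use assms(1) in \<open>auto intro!: continuous_intros\<close>)

lemma heat_conv_add:
  assumes "0 < t" "integrable circ f" "integrable circ g"
  shows "heat_conv j t (\<lambda>x. f x + g x) x = heat_conv j t f x + heat_conv j t g x"
  unfolding heat_conv_def distrib_left
  by (intro Bochner_Integration.integral_add heat_kernel_integrable_mult assms)

lemma heat_conv_diff:
  assumes "0 < t" "integrable circ f" "integrable circ g"
  shows "heat_conv j t (\<lambda>x. f x - g x) x = heat_conv j t f x - heat_conv j t g x"
  unfolding heat_conv_def right_diff_distrib
  by (intro Bochner_Integration.integral_diff heat_kernel_integrable_mult assms)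

lemma heat_conv_scale: "heat_conv j t (\<lambda>x. c * f x) x = c * heat_conv j t f x"
  unfolding heat_conv_def by (simp add: mult.left_commute)

text \<open>By orthogonality the truncated kernel already acts exactly as soon as it contains
  frequency n. The integrals are therefore eventually constant, and dominated convergence identifies
  that constant with the action of the full kernel.\<close>

lemma heat_conv_cos:
  assumes "0 < t"
  shows "heat_conv 0 t (\<lambda>x. cos (2 * pi * real n * x + a)) x =
    exp (- (2 * pi * real n)\<^sup>2 * t) * cos (2 * pi * real n * x + a)" (is "_ = ?R")
proof -
  define \<phi> where "\<phi> y = cos (2 * pi * real n * y + a)" for y
  define e where "e k = exp (- (2 * pi * real (Suc k))\<^sup>2 * t)" for k
  define S where "S N y = (if (0::nat) = 0 then 1 else 0) + 2 * (\<Sum>k<N. kernel_mode 0 k t (x - y))" for N y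
  have S: "S N y * \<phi> y = \<phi> y + (\<Sum>k<N. 2 * e k * (cos (2 * pi * real (Suc k) * (x - y) + 0) * \<phi> y))" for N y
  proof -
    have "S N y = 1 + (\<Sum>k<N. 2 * e k * cos (2 * pi * real (Suc k) * (x - y) + 0))"
      by (simp add: S_def kernel_mode_def e_def sum_distrib_left mult_ac del: of_nat_Suc)
    then show ?thesis
      by (simp only: distrib_right sum_distrib_right mult_1_left) (simp only: mult.assoc)
  qed
  have i0: "integrable circ \<phi>" unfolding \<phi>_def by (intro circ_integrable_continuous continuous_intros)
  have i1: "integrable circ (\<lambda>y. 2 * e k * (cos (2 * pi * real (Suc k) * (x - y) + 0) * \<phi> y))" for k
    unfolding \<phi>_def by (intro circ_integrable_continuous continuous_intros)
  have 0: "integral\<^sup>L circ \<phi> = (if n = 0 then cos a else 0)"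
    using circ_integral_cos[of "int n" a] by (simp add: \<phi>_def[abs_def])
  have "(LINT y|circ. S N y * \<phi> y) = ?R" if "n \<le> N" for N
  proof -
    have "(LINT y|circ. S N y * \<phi> y) = integral\<^sup>L circ \<phi> +
      (\<Sum>k<N. 2 * e k * (LINT y|circ. cos (2 * pi * real (Suc k) * (x - y) + 0) * \<phi> y))"
      unfolding S by (simp only: Bochner_Integration.integral_add Bochner_Integration.integrable_sum
        Bochner_Integration.integral_sum i0 i1 integral_mult_right_zero)
    also have "\<dots> = (if n = 0 then cos a else 0) +
       (\<Sum>k<N. 2 * e k * (if Suc k = n then cos (2 * pi * real n * x + 0 + a) / 2 else 0))"
      unfolding 0 unfolding \<phi>_def by (subst circ_integral_cos_cos) auto
    also have "\<dots> = ?R"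
    proof (cases n)
      case (Suc n')
      have "(\<Sum>k<N. 2 * e k * (if Suc k = n then cos (2 * pi * real n * x + 0 + a) / 2 else 0)) =
        (\<Sum>k<N. if k = n' then e n' * cos (2 * pi * real n * x + a) else 0)"
        using Suc by (intro sum.cong) auto
      then show ?thesis using Suc that by (simp add: e_def)
    qed simp
    finally show ?thesis .
  qed
  then have "(\<lambda>N. (LINT y|circ. S N y * \<phi> y)) \<longlonglongrightarrow> ?R"
    by (intro tendsto_eventually) (auto simp: eventually_sequentially)
  moreover have "(\<lambda>N. (LINT y|circ. S N y * \<phi> y)) \<longlonglongrightarrow> (LINT y|circ. heat_kernel_dx 0 t (x - y) * \<phi> y)"
  proof (rule integral_dominated_convergence[where w = "\<lambda>y. 1 + 2 * suminf (mode_bound 0 t)"])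
    show "(\<lambda>y. heat_kernel_dx 0 t (x - y) * \<phi> y) \<in> borel_measurable circ"
      unfolding \<phi>_def by measurable
    show "(\<lambda>y. S N y * \<phi> y) \<in> borel_measurable circ" for N
      unfolding S_def kernel_mode_def \<phi>_def by measurable
    show "AE y in circ. (\<lambda>N. S N y * \<phi> y) \<longlonglongrightarrow> heat_kernel_dx 0 t (x - y) * \<phi> y"
      unfolding S_def by (intro AE_I2 tendsto_mult_right heat_kernel_dx_limit assms)
    show "AE y in circ. norm (S N y * \<phi> y) \<le> 1 + 2 * suminf (mode_bound 0 t)" for N
    proof (rule AE_I2)
      fix y
      have "\<bar>S N y\<bar> * \<bar>\<phi> y\<bar> \<le> (1 + 2 * suminf (mode_bound 0 t)) * 1"
        unfolding S_def \<phi>_def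
        by (intro mult_mono heat_kernel_partial_le assms)
           (auto intro!: add_nonneg_nonneg suminf_nonneg summable_mode_bound assms simp: mode_bound_def)
      then show "norm (S N y * \<phi> y) \<le> 1 + 2 * suminf (mode_bound 0 t)" by (simp add: abs_mult)
    qed
  qed simp
  ultimately show ?thesis unfolding heat_conv_def \<phi>_def by (rule LIMSEQ_unique[rotated])
qed

lemma heat_conv_one: "0 < t \<Longrightarrow> heat_conv 0 t (\<lambda>x. c) x = c"
  using heat_conv_cos[of t 0 0 x] heat_conv_scale[of 0 t c "\<lambda>x. 1" x] by simp

text \<open>Positivity of the heat kernel: on trigonometric polynomials the heat flow is the limit of iterated
  averages over steps of length \<open>sqrt (2 t / N)\<close>, which preserve positivity.\<close>

definition step_average :: "real \<Rightarrow> (real \<Rightarrow> real) \<Rightarrow> real \<Rightarrow> real" where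
  "step_average h f x = (f (x + h) + f (x - h)) / 2"

lemma step_average_pow_add:
  "(step_average h ^^ N) (\<lambda>x. f x + g x) = (\<lambda>x. (step_average h ^^ N) f x + (step_average h ^^ N) g x)"
  by (induction N) (auto simp: step_average_def field_simps)

lemma step_average_pow_scale:
  "(step_average h ^^ N) (\<lambda>x. c * f x) = (\<lambda>x. c * (step_average h ^^ N) f x)"
  by (induction N) (auto simp: step_average_def field_simps)

lemma step_average_pow_nonneg:
  assumes "\<And>x. 0 \<le> f x" shows "0 \<le> (step_average h ^^ N) f x"
  by (induction N arbitrary: x) (auto simp: step_average_def assms)

text \<open>Cosines of frequency c are eigenfunctions of the average, with eigenvalue cos(c
  h).\<close>

lemma step_average_pow_cos:
  "(step_average h ^^ N) (\<lambda>x. cos (c * x + a)) = (\<lambda>x. cos (c * h) ^ N * cos (c * x + a))"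
proof (induction N)
  case (Suc N)
  have "step_average h (\<lambda>x. cos (c * x + a)) x = cos (c * h) * cos (c * x + a)" for x
  proof -
    have "c * (x + h) + a = (c * x + a) + c * h" "c * (x - h) + a = (c * x + a) - c * h"
      by (simp_all add: algebra_simps)
    then show ?thesis unfolding step_average_def by (simp only: cos_add cos_diff) (simp add: field_simps)
  qed
  moreover have "step_average h (\<lambda>x. d * f x) = (\<lambda>x. d * step_average h f x)" for d f
    by (auto simp: step_average_def field_simps)
  ultimately show ?case by (simp only: funpow.simps o_def Suc power_Suc) (simp add: mult_ac)
qed simp

text \<open>Since cos z is 1 - z^2/2 to second order, the power behaves like (1 - c^2 t/N)^N. This
  fixes the step length sqrt(2 t / N).\<close>

lemma cos_pow_limit:
  assumes "0 < t" "0 \<le> c"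
  shows "(\<lambda>N. cos (c * sqrt (2 * t / real N)) ^ N) \<longlonglongrightarrow> exp (- c\<^sup>2 * t)"
proof (cases "c = 0")
  case False
  then have "0 < c" using assms by simp
  have "(\<lambda>N. cos (c * sqrt (2 * t / real N)) ^ N)
      \<longlonglongrightarrow> exp (- (c * (2 * t) powr (1 / 2) * (c * (2 * t) powr (1 / 2)) / 2))"
    using \<open>0 < c\<close> assms(1) by real_asymp
  also have "c * (2 * t) powr (1 / 2) * (c * (2 * t) powr (1 / 2)) / 2 = c\<^sup>2 * t"
    using assms(1) by (simp add: powr_half_sqrt power2_eq_square)
  finally show ?thesis by simp
qed simp

lemma step_average_limit:
  assumes "0 < t" "trig_poly f"
  shows "(\<lambda>N. (step_average (sqrt (2 * t / real N)) ^^ N) f x) \<longlonglongrightarrow> heat_conv 0 t f x"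
  using assms(2)
proof induction
  case (cos n a)
  show ?case
    unfolding step_average_pow_cos heat_conv_cos[OF assms(1)]
    by (intro tendsto_mult_right cos_pow_limit assms(1)) simp
next
  case (add f g)
  then show ?case
    unfolding step_average_pow_add
    by (subst heat_conv_add)
       (auto intro!: assms(1) tendsto_add circ_integrable_continuous trig_poly_continuous)
next
  case (scale f c)
  then show ?case
    unfolding step_average_pow_scale heat_conv_scale by (intro tendsto_mult_left)
qed

section \<open>Periodic functions and density of the trigonometric polynomials\<close>

lemma circle_fun_add_int:
  assumes "circle_fun f" shows "f (x + of_int n) = f x"
proof (induction n rule: int_induct[where k = 0])
  case (step1 i)
  have "f (x + of_int (i + 1)) = f ((x + of_int i) + 1)" by (simp add: algebra_simps)
  then show ?case using step1 assms by (simp add: circle_fun_def)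
next
  case (step2 i)
  have "f (x + of_int i) = f ((x + of_int (i - 1)) + 1)" by (simp add: algebra_simps)
  then show ?case using step2 assms by (simp only: circle_fun_def)
qed simp

lemma circle_fun_frac:
  assumes "circle_fun f" shows "f (frac x) = f x"
  using circle_fun_add_int[OF assms, of x "- \<lfloor>x\<rfloor>"] by (simp add: frac_def)

lemma circle_fun_allI:
  assumes "\<And>x. x \<in> {0..1} \<Longrightarrow> P (f x) (g x)" "circle_fun f" "circle_fun g"
  shows "P (f x) (g x)"
proof -
  have "frac x \<in> {0..1}" using frac_lt_1[of x] by simp
  from assms(1)[OF this] show ?thesis by (simp add: circle_fun_frac assms)
qed

text \<open>Stone--Weierstrass is applied on the unit circle of \<open>\<complex>\<close>; a periodic continuous function descends
  to it because \<open>x \<mapsto> exp(2\<pi>ix)\<close> is a closed map on \<open>[0,1]\<close>.\<close>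

lemma trig_poly_dense:
  assumes cont: "continuous_on UNIV f" and per: "circle_fun f" and e: "0 < e"
  obtains p where "trig_poly p" "\<And>x. \<bar>f x - p x\<bar> < e"
proof -
  define E where "E x = cis (2 * pi * x)" for x :: real
  \<comment> \<open>The functions on the unit circle whose pull-back to the line is a trigonometric
    polynomial. They form an algebra containing the two coordinates, which already separate
    points.\<close>
  define R where "R = {F. continuous_on (sphere 0 1) F \<and> trig_poly (\<lambda>x. F (E x))}"
  have E_sphere: "E x \<in> sphere 0 1" for x by (simp add: E_def)
  have E_cont: "continuous_on S E" for S unfolding E_def by (intro continuous_intros)
  have E_eq: "\<exists>n::int. y = x + of_int n" if "E x = E y" for x y
  proof -
    have "sin (2 * pi * y) = sin (2 * pi * x)" "cos (2 * pi * y) = cos (2 * pi * x)"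
      using that by (auto simp: E_def complex_eq_iff)
    then obtain n :: int where "2 * pi * y = 2 * pi * x + 2 * pi * n"
      using sin_cos_eq_iff[of "2 * pi * y" "2 * pi * x"] by blast
    then have "2 * pi * y = 2 * pi * (x + of_int n)" by (simp add: distrib_left)
    then show ?thesis by (intro exI[of _ n]) simp
  qed
  have E_surj: "\<exists>x\<in>{0..1}. z = E x" if "z \<in> sphere 0 1" for z
  proof -
    from that obtain t where t: "0 \<le> t" "t < 2 * pi" "z = cis t"
      using complex_norm_eq_1_exp_eq[of z] Arg2pi[of z]
      by (metis Arg2pi_eq cis_conv_exp mem_sphere_0 mult.commute mult_1 of_real_1 Arg2pi_ge_0 Arg2pi_lt_2pi)
    then show ?thesis
      by (intro bexI[of _ "t / (2 * pi)"]) (auto simp: E_def field_simps)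
  qed
  \<comment> \<open>The choice of the preimage is immaterial: two preimages differ by an integer and
    \<open>f\<close> is periodic.\<close>
  define F where "F z = f (SOME x. z = E x)" for z
  have FE: "F (E x) = f x" for x
  proof -
    have "E x = E (SOME y. E x = E y)" by (rule someI[of _ x]) simp
    then obtain n :: int where "(SOME y. E x = E y) = x + of_int n" using E_eq by blast
    then show ?thesis by (simp add: F_def circle_fun_add_int[OF per])
  qed
  have F_cont: "continuous_on (sphere 0 1) F"
    unfolding continuous_on_closed_vimage[OF closed_sphere]
  proof (intro allI impI)
    fix B :: "real set" assume B: "closed B"
    have "closed (f -` B \<inter> {0..1})"
      using continuous_on_closed_vimage[of "{0..1}" f] cont B continuous_on_subset by blast
    then have "compact (f -` B \<inter> {0..1})" by (auto simp: compact_eq_bounded_closed)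
    then have "compact (E ` (f -` B \<inter> {0..1}))"
      by (rule compact_continuous_image[OF E_cont])
    moreover have "E ` (f -` B \<inter> {0..1}) = F -` B \<inter> sphere 0 1"
    proof (intro equalityI subsetI)
      fix z assume z: "z \<in> F -` B \<inter> sphere 0 1"
      then obtain x where x: "x \<in> {0..1}" "z = E x" using E_surj by blast
      then show "z \<in> E ` (f -` B \<inter> {0..1})" using z FE by auto
    qed (use E_sphere in \<open>auto simp: FE\<close>)
    ultimately show "closed (F -` B \<inter> sphere 0 1)" by (simp add: compact_imp_closed)
  qed
  interpret function_ring_on R "sphere 0 1 :: complex set"
  proof
    show "\<exists>f\<in>R. f z \<noteq> f w" if "z \<noteq> w" for z w
    proof -
      have "Re \<in> R"
        using trig_poly.cos[of 1 0] by (auto simp: R_def E_def intro!: continuous_intros)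
      moreover have "Im \<in> R"
      proof -
        have "cos (2 * pi * real 1 * x + (- (pi / 2))) = sin (2 * pi * x)" for x
          by (simp add: cos_diff)
        then have "trig_poly (\<lambda>x. sin (2 * pi * x))"
          using trig_poly.cos[of 1 "- (pi / 2)"] by (simp only:)
        then show ?thesis by (auto simp: R_def E_def intro!: continuous_intros)
      qed
      ultimately show ?thesis using that complex_eq_iff by blast
    qed
  qed (auto simp: R_def intro!: continuous_intros trig_poly.add trig_poly_mult trig_poly_const)
  obtain g where g: "g \<in> R" "\<forall>x\<in>sphere 0 1. \<bar>F x - g x\<bar> < e"
    using Stone_Weierstrass_basic[OF F_cont e] by blast
  show ?thesis
  proof (rule that)
    show "trig_poly (\<lambda>x. g (E x))" using g(1) by (simp add: R_def)
    show "\<bar>f x - g (E x)\<bar> < e" for x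
      using g(2) E_sphere[of x] FE[of x] by force
  qed
qed

text \<open>A crude bound, with a constant depending on t, which can be had before positivity of the
  kernel is known. Positivity later gives the contraction estimate
  \<open>heat_conv_abs_le\<close>.\<close>

lemma heat_conv_bounded:
  assumes "0 < t"
  obtains B where "0 \<le> B" "\<And>x f e. (\<And>y. y \<in> {0..1} \<Longrightarrow> \<bar>f y\<bar> \<le> e) \<Longrightarrow> \<bar>heat_conv j t f x\<bar> \<le> B * e"
proof -
  obtain B where B: "0 \<le> B" "\<And>s x. t \<le> s \<Longrightarrow> \<bar>heat_kernel_dx j s x\<bar> \<le> B"
    using heat_kernel_dx_bounded[OF assms] by metis
  have "\<bar>heat_conv j t f x\<bar> \<le> B * e" if f: "\<And>y. y \<in> {0..1} \<Longrightarrow> \<bar>f y\<bar> \<le> e" for f :: "real \<Rightarrow> real" and e x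
    unfolding heat_conv_def
  proof (rule circ_integral_abs_le)
    have e: "0 \<le> e" using f[of 0] by force
    then show "0 \<le> B * e" using B by simp
    show "\<bar>heat_kernel_dx j t (x - y) * f y\<bar> \<le> B * e" if "y \<in> {0..1}" for y
      unfolding abs_mult using B f[OF that] by (intro mult_mono) auto
  qed
  with B(1) show ?thesis by (rule that)
qed

text \<open>If p approximates f within e, then p + e is a nonnegative trigonometric polynomial,
  whose heat flow is nonnegative as a limit of iterated averages. The error of the approximation is
  controlled by the crude bound.\<close>

lemma heat_conv_nonneg_continuous:
  assumes t: "0 < t" and f: "continuous_on UNIV f" "circle_fun f" "\<And>x. 0 \<le> f x"
  shows "0 \<le> heat_conv 0 t f x"
proof (rule ccontr)
  assume neg: "\<not> 0 \<le> heat_conv 0 t f x"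
  obtain B where B: "0 \<le> B" "\<And>x f e. (\<And>y. y \<in> {0..1} \<Longrightarrow> \<bar>f y\<bar> \<le> e) \<Longrightarrow> \<bar>heat_conv 0 t f x\<bar> \<le> B * e"
    using heat_conv_bounded[OF t, of 0] by blast
  \<comment> \<open>Chosen such that (B + 1) e is half of the supposed negative value, which
    contradicts the final estimate.\<close>
  define e where "e = - heat_conv 0 t f x / (2 * (B + 1))"
  have e: "0 < e" using neg B(1) by (simp add: e_def field_simps)
  obtain p where p: "trig_poly p" "\<And>y. \<bar>f y - p y\<bar> < e"
    using trig_poly_dense[OF f(1,2) e] by blast
  have q: "trig_poly (\<lambda>y. p y + e)" by (intro trig_poly.add p trig_poly_const)
  have "0 \<le> p y + e" for y using p(2)[of y] f(3)[of y] by linarith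
  then have "0 \<le> heat_conv 0 t (\<lambda>y. p y + e) x"
    by (intro LIMSEQ_le_const[OF step_average_limit[OF t q]]) (auto intro!: exI[of _ 0] step_average_pow_nonneg)
  also have "\<dots> = heat_conv 0 t (\<lambda>y. p y) x + e"
    using heat_conv_one[OF t] by (subst heat_conv_add) (auto intro!: t circ_integrable_continuous trig_poly_continuous p)
  finally have "- heat_conv 0 t p x \<le> e" by simp
  moreover have "\<bar>heat_conv 0 t (\<lambda>y. f y - p y) x\<bar> \<le> B * e" by (rule B(2)) (use p(2) less_imp_le in blast)
  moreover have "heat_conv 0 t (\<lambda>y. f y - p y) x = heat_conv 0 t f x - heat_conv 0 t p x"
    by (intro heat_conv_diff t circ_integrable_continuous trig_poly_continuous p continuous_on_subset[OF f(1)]) auto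
  ultimately have "- heat_conv 0 t f x \<le> (B + 1) * e" by (simp add: distrib_right)
  also have "\<dots> = - heat_conv 0 t f x / 2" using B(1) by (simp add: e_def divide_simps)
  finally show False using neg by simp
qed

text \<open>The flow is tested on the negative part f of the kernel itself. Because the kernel is
  even, the value at 0 is minus the integral of f^2; it is nonnegative by the previous lemma, so f
  vanishes.\<close>

lemma heat_kernel_nonneg:
  assumes t: "0 < t" shows "0 \<le> heat_kernel_dx 0 t x"
proof -
  define f where "f y = max 0 (- heat_kernel_dx 0 t y)" for y
  have cont: "continuous_on S f" for S unfolding f_def using t by (intro continuous_intros) auto
  have "0 \<le> heat_conv 0 t f 0"
    by (rule heat_conv_nonneg_continuous) (auto simp: f_def circle_fun_def t cont[unfolded f_def])
  also have "heat_conv 0 t f 0 = (LINT y|circ. - (f y)\<^sup>2)"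
    unfolding heat_conv_def
    by (intro circ_integral_cong) (auto simp: f_def heat_kernel_dx_0_even power2_eq_square)
  finally have "(LINT y|circ. (f y)\<^sup>2) \<le> 0" by simp
  moreover have "0 \<le> (LINT y|circ. (f y)\<^sup>2)" by (rule circ_integral_nonneg) simp
  ultimately have 0: "(LINT y|circ. (f y)\<^sup>2) = 0" by simp
  have "(f y)\<^sup>2 = 0" if "y \<in> {0..1}" for y
    by (rule circ_continuous_eq_zero[OF _ _ 0 that]) (auto intro!: continuous_intros cont)
  then have "0 \<le> heat_kernel_dx 0 t y" if "y \<in> {0..1}" for y
    using that by (force simp: f_def max_def split: if_splits)
  then show ?thesis
    using circle_fun_allI[where P = "\<lambda>a b. 0 \<le> a" and f = "heat_kernel_dx 0 t" and g = "heat_kernel_dx 0 t"]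
    by (simp add: circle_fun_def)
qed

lemma heat_conv_mono:
  assumes "0 < t" "integrable circ f" "integrable circ g" "\<And>y. y \<in> {0..1} \<Longrightarrow> f y \<le> g y"
  shows "heat_conv 0 t f x \<le> heat_conv 0 t g x"
  unfolding heat_conv_def
  by (intro circ_integral_mono heat_kernel_integrable_mult mult_left_mono heat_kernel_nonneg assms)

lemma heat_conv_ge:
  assumes "0 < t" "integrable circ f" "\<And>y. y \<in> {0..1} \<Longrightarrow> c \<le> f y"
  shows "c \<le> heat_conv 0 t f x"
  using heat_conv_mono[OF assms(1) circ_integrable_continuous[OF continuous_on_const] assms(2), of c x] assms(3)
    heat_conv_one[OF assms(1), of c x] by simp

lemma heat_conv_le:
  assumes "0 < t" "integrable circ f" "\<And>y. y \<in> {0..1} \<Longrightarrow> f y \<le> c"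
  shows "heat_conv 0 t f x \<le> c"
  using heat_conv_mono[OF assms(1) assms(2) circ_integrable_continuous[OF continuous_on_const], of c x] assms(3)
    heat_conv_one[OF assms(1), of c x] by simp

lemma heat_conv_abs_le:
  assumes "0 < t" "integrable circ f" "\<And>y. y \<in> {0..1} \<Longrightarrow> \<bar>f y\<bar> \<le> c"
  shows "\<bar>heat_conv 0 t f x\<bar> \<le> c"
proof -
  have "- c \<le> f y \<and> f y \<le> c" if "y \<in> {0..1}" for y using assms(3)[OF that] by linarith
  then show ?thesis
    using heat_conv_ge[OF assms(1,2), of "- c" x] heat_conv_le[OF assms(1,2), of c x] by force
qed

lemma trig_poly_heat_conv_initial:
  assumes "trig_poly p" "0 < e"
  shows "\<exists>d>0. \<forall>t x. 0 < t \<longrightarrow> t < d \<longrightarrow> \<bar>heat_conv 0 t p x - p x\<bar> < e"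
  using assms
proof (induction arbitrary: e)
  case (cos n a)
  have "((\<lambda>t. 1 - exp (- (2 * pi * real n)\<^sup>2 * t)) \<longlongrightarrow> 1 - exp (- (2 * pi * real n)\<^sup>2 * 0)) (at 0)"
    by (intro tendsto_intros)
  then have "\<forall>\<^sub>F t in at 0. \<bar>1 - exp (- (2 * pi * real n)\<^sup>2 * t)\<bar> < e"
    using tendstoD[of _ _ "at 0" e] cos by (force simp: dist_real_def)
  then obtain d where d: "0 < d" "\<And>t. t \<noteq> 0 \<Longrightarrow> \<bar>t\<bar> < d \<Longrightarrow> \<bar>1 - exp (- (2 * pi * real n)\<^sup>2 * t)\<bar> < e"
    by (auto simp: eventually_at dist_real_def)
  have "\<bar>heat_conv 0 t (\<lambda>x. cos (2 * pi * real n * x + a)) x - cos (2 * pi * real n * x + a)\<bar> < e"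
    if t: "0 < t" "t < d" for t x
  proof -
    have "heat_conv 0 t (\<lambda>x. cos (2 * pi * real n * x + a)) x - cos (2 * pi * real n * x + a) =
      - (1 - exp (- (2 * pi * real n)\<^sup>2 * t)) * cos (2 * pi * real n * x + a)"
      unfolding heat_conv_cos[OF t(1)] by (simp add: algebra_simps)
    also have "\<bar>\<dots>\<bar> \<le> \<bar>1 - exp (- (2 * pi * real n)\<^sup>2 * t)\<bar> * 1"
      unfolding abs_mult by (intro mult_mono) auto
    also have "\<dots> < e" using d(2)[of t] t by simp
    finally show ?thesis .
  qed
  then show ?case using d(1) by blast
next
  case (add f g)
  obtain d1 where d1: "0 < d1" "\<forall>t x. 0 < t \<longrightarrow> t < d1 \<longrightarrow> \<bar>heat_conv 0 t f x - f x\<bar> < e/2"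
    using add.IH(1)[of "e/2"] add.prems by auto
  obtain d2 where d2: "0 < d2" "\<forall>t x. 0 < t \<longrightarrow> t < d2 \<longrightarrow> \<bar>heat_conv 0 t g x - g x\<bar> < e/2"
    using add.IH(2)[of "e/2"] add.prems by auto
  have "\<bar>heat_conv 0 t (\<lambda>x. f x + g x) x - (f x + g x)\<bar> < e" if t: "0 < t" "t < min d1 d2" for t x
  proof -
    have "heat_conv 0 t (\<lambda>x. f x + g x) x = heat_conv 0 t f x + heat_conv 0 t g x"
      using add.hyps by (intro heat_conv_add t circ_integrable_continuous trig_poly_continuous)
    moreover have "\<bar>heat_conv 0 t f x - f x\<bar> < e/2" "\<bar>heat_conv 0 t g x - g x\<bar> < e/2"
      using d1 d2 t by auto
    ultimately show ?thesis by linarith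
  qed
  then show ?case using d1 d2 by (intro exI[of _ "min d1 d2"]) auto
next
  case (scale f c)
  have e': "0 < e / (\<bar>c\<bar> + 1)" using scale.prems by simp
  obtain d where d: "0 < d" "\<forall>t x. 0 < t \<longrightarrow> t < d \<longrightarrow> \<bar>heat_conv 0 t f x - f x\<bar> < e / (\<bar>c\<bar> + 1)"
    using scale.IH[OF e'] by auto
  have "\<bar>heat_conv 0 t (\<lambda>x. c * f x) x - c * f x\<bar> < e" if t: "0 < t" "t < d" for t x
  proof -
    have "\<bar>heat_conv 0 t (\<lambda>x. c * f x) x - c * f x\<bar> = \<bar>c\<bar> * \<bar>heat_conv 0 t f x - f x\<bar>"
      unfolding heat_conv_scale by (simp add: abs_mult flip: right_diff_distrib)
    also have "\<dots> \<le> \<bar>c\<bar> * (e / (\<bar>c\<bar> + 1))"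
    proof (rule mult_left_mono)
      show "\<bar>heat_conv 0 t f x - f x\<bar> \<le> e / (\<bar>c\<bar> + 1)" using d t less_imp_le by blast
    qed simp
    also have "\<dots> < (\<bar>c\<bar> + 1) * (e / (\<bar>c\<bar> + 1))"
      using e' by (intro mult_strict_right_mono) auto
    also have "\<dots> = e" by simp
    finally show ?thesis .
  qed
  then show ?case using d(1) by blast
qed

text \<open>An e/3 argument: the heat flow contracts the sup norm, so the approximation by a
  trigonometric polynomial persists for all positive times and the convergence is uniform in
  x.\<close>

lemma heat_conv_initial:
  assumes f: "continuous_on UNIV f" "circle_fun f" and e: "0 < e"
  shows "\<exists>d>0. \<forall>t x. 0 < t \<longrightarrow> t < d \<longrightarrow> \<bar>heat_conv 0 t f x - f x\<bar> < e"
proof -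
  obtain p where p: "trig_poly p" "\<And>x. \<bar>f x - p x\<bar> < e/3"
    using trig_poly_dense[OF f, of "e/3"] e by auto
  obtain d where d: "0 < d" "\<forall>t x. 0 < t \<longrightarrow> t < d \<longrightarrow> \<bar>heat_conv 0 t p x - p x\<bar> < e/3"
    using trig_poly_heat_conv_initial[OF p(1), of "e/3"] e by auto
  have i: "integrable circ f" "integrable circ p"
    using f(1) p(1) by (auto intro: circ_integrable_continuous trig_poly_continuous continuous_on_subset)
  have "\<bar>heat_conv 0 t f x - f x\<bar> < e" if t: "0 < t" "t < d" for t x
  proof -
    have "\<bar>heat_conv 0 t (\<lambda>y. f y - p y) x\<bar> \<le> e/3"
      using p(2) by (intro heat_conv_abs_le t Bochner_Integration.integrable_diff i) (simp add: less_imp_le)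
    then have "\<bar>heat_conv 0 t f x - heat_conv 0 t p x\<bar> \<le> e/3"
      by (simp add: heat_conv_diff t i)
    moreover have "\<bar>heat_conv 0 t p x - p x\<bar> < e/3" using d t by blast
    ultimately show ?thesis using p(2)[of x] by linarith
  qed
  then show ?thesis using d(1) by blast
qed

section \<open>Primitives and weak derivatives\<close>

lemma circ_measurable_fst [measurable]: "fst \<in> borel_measurable (circ \<Otimes>\<^sub>M circ)"
  and circ_measurable_snd [measurable]: "snd \<in> borel_measurable (circ \<Otimes>\<^sub>M circ)"
proof -
  have id: "(\<lambda>x. x) \<in> borel_measurable circ" by (rule measurable_circ) simp
  show "fst \<in> borel_measurable (circ \<Otimes>\<^sub>M circ)" by (rule measurable_compose[OF measurable_fst id])
  show "snd \<in> borel_measurable (circ \<Otimes>\<^sub>M circ)" by (rule measurable_compose[OF measurable_snd id])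
qed

lemma circ_fubini:
  assumes g: "integrable circ g" and k: "(\<lambda>p. k (fst p) (snd p)) \<in> borel_measurable (circ \<Otimes>\<^sub>M circ)"
    and B: "\<And>x y. x \<in> {0..1} \<Longrightarrow> y \<in> {0..1} \<Longrightarrow> \<bar>k x y\<bar> \<le> (B::real)"
  shows "(LINT x|circ. (LINT y|circ. k x y * g y)) =
    (LINT y|circ. (LINT x|circ. k x y) * (g y :: real))"
proof -
  have g_meas [measurable]: "g \<in> borel_measurable circ" using g by simp
  have 1: "integrable (circ \<Otimes>\<^sub>M circ) (\<lambda>p. g (snd p))"
  proof (rule circ2.Fubini_integrable)
    show "integrable circ (\<lambda>x. LINT y|circ. norm (g (snd (x, y))))" by simp
    show "AE x in circ. integrable circ (\<lambda>y. g (snd (x, y)))" using g by simp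
  qed measurable
  have 2: "integrable (circ \<Otimes>\<^sub>M circ) (\<lambda>(x, y). k x y * g y)"
  proof (rule Bochner_Integration.integrable_bound)
    show "integrable (circ \<Otimes>\<^sub>M circ) (\<lambda>p. B * g (snd p))" using 1 by simp
    show "(\<lambda>(x, y). k x y * g y) \<in> borel_measurable (circ \<Otimes>\<^sub>M circ)"
      using k unfolding split_beta by measurable
    show "AE p in circ \<Otimes>\<^sub>M circ. norm (case p of (x, y) \<Rightarrow> k x y * g y) \<le> norm (B * g (snd p))"
    proof (rule AE_I2, clarsimp simp: space_pair_measure abs_mult)
      fix x y :: real assume "0 \<le> x" "x \<le> 1" "0 \<le> y" "y \<le> 1"
      then have "\<bar>k x y\<bar> \<le> \<bar>B\<bar>" using B[of x y] by simp
      then show "\<bar>k x y\<bar> * \<bar>g y\<bar> \<le> \<bar>B\<bar> * \<bar>g y\<bar>" by (rule mult_right_mono) simp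
    qed
  qed
  show ?thesis
    using circ2.Fubini_integral[OF 2] by simp
qed

lemma heat_kernel_dx_circle_bounded:
  assumes "0 < t" obtains B where "\<And>x. \<bar>heat_kernel_dx j t x\<bar> \<le> B"
  using heat_kernel_dx_bounded[OF assms, of j] by (metis order_refl)

text \<open>Fubini together with the evenness of the kernel. The function \<open>f\<close> is only
  integrable because the lemma is applied to a weight times the square of the weak derivative of the
  datum.\<close>

lemma heat_conv_adjoint:
  assumes t: "0 < t" and f: "integrable circ f" and h: "continuous_on {0..1} h"
  shows "(LINT x|circ. heat_conv 0 t f x * h x) = (LINT y|circ. heat_conv 0 t h y * f y)"
proof -
  obtain B where B: "\<And>x. \<bar>heat_kernel_dx 0 t x\<bar> \<le> B" using heat_kernel_dx_circle_bounded[OF t] by blast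
  obtain D where D: "0 \<le> D" "\<And>x. x \<in> {0..1} \<Longrightarrow> \<bar>h x\<bar> \<le> D" using continuous_on_bounded_01[OF h] by blast
  have [measurable]: "h \<in> borel_measurable circ" by (rule borel_measurable_cont_circ[OF h])
  have "(LINT x|circ. (LINT y|circ. heat_kernel_dx 0 t (x - y) * h x * f y)) =
    (LINT y|circ. (LINT x|circ. heat_kernel_dx 0 t (x - y) * h x) * f y)"
  proof (rule circ_fubini[OF f])
    show "(\<lambda>p. heat_kernel_dx 0 t (fst p - snd p) * h (fst p)) \<in> borel_measurable (circ \<Otimes>\<^sub>M circ)"
      by measurable
    show "\<bar>heat_kernel_dx 0 t (x - y) * h x\<bar> \<le> B * D" if "x \<in> {0..1}" for x y
      unfolding abs_mult using B D(2)[OF that] D(1)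
      by (intro mult_mono) (auto intro: order_trans[OF abs_ge_zero])
  qed
  moreover have "(LINT y|circ. heat_kernel_dx 0 t (x - y) * h x * f y) = heat_conv 0 t f x * h x" for x
    unfolding heat_conv_def by (simp add: mult_ac flip: integral_mult_right_zero)
  moreover have "(LINT x|circ. heat_kernel_dx 0 t (x - y) * h x) = heat_conv 0 t h y" for y
    unfolding heat_conv_def by (simp add: heat_kernel_dx_0_commute)
  ultimately show ?thesis by simp
qed

lemma heat_conv_has_dx:
  assumes t: "0 < t" and f: "integrable circ f"
  shows "(heat_conv j t f has_real_derivative heat_conv (Suc j) t f x) (at x)"
proof -
  obtain B where B: "\<And>x. \<bar>heat_kernel_dx (Suc j) t x\<bar> \<le> B"
    using heat_kernel_dx_circle_bounded[OF t] by blast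
  show ?thesis
    unfolding heat_conv_def[abs_def]
  proof (rule circ_integral_has_derivative_param[OF f zero_less_one])
    show "((\<lambda>a. heat_kernel_dx j t (a - y)) has_real_derivative heat_kernel_dx (Suc j) t (a - y)) (at a)" for a y
      using DERIV_shift[of "heat_kernel_dx j t" "heat_kernel_dx (Suc j) t (a - y)" a "- y"]
        heat_kernel_dx_has_dx[OF t, of j "a - y"] by simp
    show "(\<lambda>y. heat_kernel_dx j t (a - y)) \<in> borel_measurable circ" for a by measurable
    show "(\<lambda>y. heat_kernel_dx (Suc j) t (x - y)) \<in> borel_measurable circ" by measurable
    show "integrable circ (\<lambda>y. heat_kernel_dx j t (a - y) * f y)" for a
      by (rule heat_kernel_integrable_mult[OF t f])
  qed (rule B)
qed

lemma heat_conv_has_dt: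
  assumes t: "0 < t" and f: "integrable circ f"
  shows "((\<lambda>t. heat_conv j t f x) has_real_derivative heat_conv (Suc (Suc j)) t f x) (at t)"
proof -
  obtain B where B: "\<And>s x. t/2 \<le> s \<Longrightarrow> \<bar>heat_kernel_dx (Suc (Suc j)) s x\<bar> \<le> B"
    using heat_kernel_dx_bounded[of "t/2"] t by (metis half_gt_zero)
  have ball: "t/2 \<le> a" if "a \<in> ball t (t/2)" for a
    using that by (auto simp: dist_real_def abs_if split: if_splits)
  show ?thesis
    unfolding heat_conv_def[abs_def]
  proof (rule circ_integral_has_derivative_param[OF f, of "t/2"])
    show "0 < t/2" using t by simp
    show "((\<lambda>a. heat_kernel_dx j a (x - y)) has_real_derivative heat_kernel_dx (Suc (Suc j)) a (x - y)) (at a)"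
      if "a \<in> ball t (t/2)" for a y
      by (rule heat_kernel_dx_has_dt) (use ball[OF that] t in simp)
    show "(\<lambda>y. heat_kernel_dx j a (x - y)) \<in> borel_measurable circ" for a by measurable
    show "(\<lambda>y. heat_kernel_dx (Suc (Suc j)) t (x - y)) \<in> borel_measurable circ" by measurable
    show "integrable circ (\<lambda>y. heat_kernel_dx j a (x - y) * f y)" if "a \<in> ball t (t/2)" for a
      by (rule heat_kernel_integrable_mult[OF _ f]) (use ball[OF that] t in simp)
    show "\<bar>heat_kernel_dx (Suc (Suc j)) a (x - y)\<bar> \<le> B" if "a \<in> ball t (t/2)" for a y
      by (rule B[OF ball[OF that]])
  qed
qed

lemma heat_conv_isCont:
  assumes t: "0 < t" and f: "integrable circ f"
  shows "isCont (\<lambda>p. heat_conv j (fst p) f (snd p)) (t, x)"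
proof -
  obtain B where B: "\<And>s x. t/2 \<le> s \<Longrightarrow> \<bar>heat_kernel_dx j s x\<bar> \<le> B"
    using heat_kernel_dx_bounded[of "t/2"] t by (metis half_gt_zero)
  have ball: "t/2 \<le> fst p" if "p \<in> ball (t, x) (t/2)" for p :: "real \<times> real"
  proof -
    have "dist t (fst p) < t/2" using that dist_fst_le[of "(t, x)" p] by simp
    then show ?thesis by (auto simp: dist_real_def abs_if split: if_splits)
  qed
  have "isCont (\<lambda>p. (LINT y|circ. heat_kernel_dx j (fst p) (snd p - y) * f y)) (t, x)"
  proof (rule circ_integral_continuous_param[OF f, of "t/2"])
    show "0 < t/2" using t by simp
    show "isCont (\<lambda>p. heat_kernel_dx j (fst p) (snd p - y)) (t, x)" for y
    proof -
      have "continuous_on ({0<..} \<times> UNIV) (\<lambda>p. heat_kernel_dx j (fst p) (snd p - y))"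
        by (rule continuous_on_heat_kernel_dx) (auto intro!: continuous_on_fst continuous_on_snd continuous_on_diff continuous_on_id continuous_on_const)
      moreover have "open ({0<..} \<times> UNIV :: (real \<times> real) set)" by (intro open_Times) auto
      ultimately show ?thesis using t by (simp add: continuous_on_eq_continuous_at)
    qed
    show "(\<lambda>y. heat_kernel_dx j (fst p) (snd p - y)) \<in> borel_measurable circ" for p by measurable
    show "\<bar>heat_kernel_dx j (fst p) (snd p - y)\<bar> \<le> B" if "p \<in> ball (t, x) (t/2)" for p y
      by (rule B[OF ball[OF that]])
  qed
  then show ?thesis by (simp add: heat_conv_def)
qed

lemma heat_conv_periodic: "circle_fun (heat_conv j t f)"
proof -
  have "x + 1 - y = (x - y) + 1" for x y :: real by simp
  then show ?thesis unfolding circle_fun_def heat_conv_def by (simp only: heat_kernel_dx_periodic simp_thms)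
qed

section \<open>Periodic extension and primitives of integrable functions\<close>

lemma circle_extension_continuous:
  assumes h: "continuous_on {0..1} h" "h 0 = h (1::real)"
  shows "continuous_on UNIV (\<lambda>x. h (frac x) :: real)"
proof -
  have "isCont (\<lambda>x. h (frac x)) x0" for x0 :: real
  proof -
    define n where "n = \<lfloor>x0\<rfloor>"
    have n: "of_int n \<le> x0" "x0 < of_int n + 1" unfolding n_def by linarith+
    have eq: "h (frac x) = h (x - of_int m)" if "x \<in> {of_int m .. of_int m + 1}" for x m
    proof (cases "x = of_int m + 1")
      case True
      then show ?thesis using h(2) by simp
    next
      case False
      then have "\<lfloor>x\<rfloor> = m" using that by (intro floor_unique) auto
      then show ?thesis by (simp add: frac_def)
    qed
    have c: "continuous_on {of_int m .. of_int m + 1} (\<lambda>x. h (frac x))" for m :: int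
    proof -
      have "continuous_on {of_int m .. of_int m + 1} (\<lambda>x. h (x - of_int m))"
        by (rule continuous_on_compose2[OF h(1)]) (auto intro!: continuous_intros)
      then show ?thesis using eq by (metis (no_types, lifting) continuous_on_cong)
    qed
    have "continuous_on ({of_int (n - 1) .. of_int (n - 1) + 1} \<union> {of_int n .. of_int n + 1}) (\<lambda>x. h (frac x))"
      by (intro continuous_on_closed_Un c) auto
    then have "continuous_on {of_int n - 1<..<of_int n + 1} (\<lambda>x. h (frac x))"
      by (rule continuous_on_subset) auto
    then show ?thesis using n by (auto simp: continuous_on_eq_continuous_at)
  qed
  then show ?thesis by (auto intro: continuous_at_imp_continuous_on)
qed

lemma circle_extension_periodic: "circle_fun (\<lambda>x. h (frac x))"
  by (simp add: circle_fun_def frac_1_eq)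

text \<open>An integral over the whole circle against an indicator, rather than over a variable
  interval, so that exchanging two integrations is an instance of
  \<open>circ_fubini\<close>.\<close>

definition primitive :: "(real \<Rightarrow> real) \<Rightarrow> real \<Rightarrow> real" where
  "primitive g x = (LINT y|circ. indicator {..x} y * g y)"

lemma circ_integrable_indicator:
  "integrable circ g \<Longrightarrow> A \<in> sets borel \<Longrightarrow> integrable circ (\<lambda>y. indicator A y * (g y :: real))"
  by (rule circ_integrable_mult_bounded[where B = 1]) (auto intro: measurable_circ simp: indicator_def)

lemma primitive_eq_integral:
  assumes g: "integrable circ g" and x: "x \<in> {0..1}"
  shows "primitive g x = integral {0..x} g"
proof -
  have "primitive g x = integral {0..1} (\<lambda>y. indicator {..x} y * g y)"
    unfolding primitive_def by (intro circ_integral_HK circ_integrable_indicator g) simp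
  also have "(\<lambda>y. indicator {..x} y * g y) = (\<lambda>y. if y \<in> {..x} then g y else 0)"
    by (auto simp: indicator_def)
  also have "integral {0..1} \<dots> = integral ({..x} \<inter> {0..1}) g" by (rule integral_restrict_Int)
  also have "{..x} \<inter> {0..1} = {0..x}" using x by auto
  finally show ?thesis .
qed

lemma circ_integrable_on: "integrable circ g \<Longrightarrow> (g :: real \<Rightarrow> real) integrable_on {0..1}"
  using set_borel_integral_eq_integral(1)[of "{0..1}" g] by (simp add: set_integrable_circ)

lemma primitive_continuous:
  assumes g: "integrable circ g" shows "continuous_on {0..1} (primitive g)"
  using indefinite_integral_continuous_1[OF circ_integrable_on[OF g]] primitive_eq_integral[OF g]
  by (metis (no_types, lifting) continuous_on_cong)

lemma primitive_0: "integrable circ g \<Longrightarrow> primitive g 0 = 0"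
  by (simp add: primitive_eq_integral)

lemma primitive_1: "integrable circ g \<Longrightarrow> primitive g 1 = integral\<^sup>L circ g"
  by (simp add: primitive_eq_integral circ_integral_HK)

text \<open>The primitive of an integrable function need not be differentiable everywhere. Fubini on
  the triangle y \<le> x replaces the product rule, and the inner integral of \<open>\<psi>'\<close>
  over \<open>{y..1}\<close> is evaluated by the fundamental theorem.\<close>

lemma primitive_by_parts:
  assumes g: "integrable circ g" and c: "continuous_on {0..1} \<psi>'"
    and d: "\<And>x. x \<in> {0..1} \<Longrightarrow> (\<psi> has_real_derivative \<psi>' x) (at x within {0..1})"
  shows "(LINT x|circ. primitive g x * \<psi>' x) =
    \<psi> 1 * integral\<^sup>L circ g - (LINT x|circ. \<psi> x * g x)"
proof -
  obtain B where B: "0 \<le> B" "\<And>x. x \<in> {0..1} \<Longrightarrow> \<bar>\<psi>' x\<bar> \<le> B" using continuous_on_bounded_01[OF c] by blast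
  have [measurable]: "\<psi>' \<in> borel_measurable circ" by (rule borel_measurable_cont_circ[OF c])
  have \<psi>_cont: "continuous_on {0..1} \<psi>" using d by (rule DERIV_continuous_on)
  have 1: "(LINT x|circ. (LINT y|circ. indicator {..x} y * \<psi>' x * g y)) =
    (LINT y|circ. (LINT x|circ. indicator {..x} y * \<psi>' x) * g y)"
  proof (rule circ_fubini[OF g])
    have "(\<lambda>p. indicator {..fst p} (snd p) * \<psi>' (fst p)) = (\<lambda>p. (if snd p \<le> fst p then 1 else 0) * \<psi>' (fst p))"
      by (auto simp: indicator_def)
    also have "\<dots> \<in> borel_measurable (circ \<Otimes>\<^sub>M circ)" by measurable
    finally show "(\<lambda>p. indicator {..fst p} (snd p) * \<psi>' (fst p)) \<in> borel_measurable (circ \<Otimes>\<^sub>M circ)" .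
    show "\<bar>indicator {..x} y * \<psi>' x\<bar> \<le> B" if "x \<in> {0..1}" for x y
      using B(2)[OF that] B(1) by (auto simp: indicator_def)
  qed
  have 2: "(LINT y|circ. indicator {..x} y * \<psi>' x * g y) = primitive g x * \<psi>' x" for x
    unfolding primitive_def by (simp add: mult_ac flip: integral_mult_right_zero)
  have "(LINT x|circ. indicator {..x} y * \<psi>' x) = \<psi> 1 - \<psi> y" if y: "y \<in> {0..1}" for y
  proof -
    have "(\<lambda>x. indicator {..x} y * \<psi>' x) = (\<lambda>x. indicator {y..} x * \<psi>' x)" by (auto simp: indicator_def)
    then have "(LINT x|circ. indicator {..x} y * \<psi>' x) = integral {0..1} (\<lambda>x. indicator {y..} x * \<psi>' x)"
      by (simp add: circ_integral_HK circ_integrable_indicator circ_integrable_continuous c)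
    also have "(\<lambda>x. indicator {y..} x * \<psi>' x) = (\<lambda>x. if x \<in> {y..} then \<psi>' x else 0)"
      by (auto simp: indicator_def)
    also have "integral {0..1} \<dots> = integral ({y..} \<inter> {0..1}) \<psi>'" by (rule integral_restrict_Int)
    also have "{y..} \<inter> {0..1} = {y..1}" using y by auto
    also have "(\<psi>' has_integral (\<psi> 1 - \<psi> y)) {y..1}"
      using y by (intro fundamental_theorem_of_calculus)
        (auto intro!: has_real_derivative_iff_has_vector_derivative[THEN iffD1] DERIV_subset[OF d])
    then have "integral {y..1} \<psi>' = \<psi> 1 - \<psi> y" by (rule integral_unique)
    finally show ?thesis .
  qed
  then have "(LINT y|circ. (LINT x|circ. indicator {..x} y * \<psi>' x) * g y) =
    (LINT y|circ. \<psi> 1 * g y - \<psi> y * g y)"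
    by (intro circ_integral_cong) (simp add: left_diff_distrib)
  also have "\<dots> = \<psi> 1 * integral\<^sup>L circ g - (LINT x|circ. \<psi> x * g x)"
    using g circ_integrable_mult_cont[OF g \<psi>_cont] by simp
  finally show ?thesis using 1 by (simp only: 2)
qed

text \<open>A Dynkin argument: the half-lines generate the Borel sets, are stable under
  intersection, and on them the integral is a value of the primitive, constant outside
  \<open>{0..1}\<close>.\<close>

lemma integral_borel_sets_zero:
  assumes g: "integrable circ g" and z: "\<And>x. x \<in> {0..1} \<Longrightarrow> primitive g x = 0" and A: "A \<in> sets borel"
  shows "(LINT y|circ. indicator A y * g y) = (0::real)"
proof -
  have z': "integral\<^sup>L circ g = 0" using primitive_1[OF g] z[of 1] by simp
  have atMost: "primitive g x = 0" for x
  proof (cases "x < 0")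
    case True
    then have "primitive g x = (LINT y|circ. 0)"
      unfolding primitive_def by (intro circ_integral_cong) (auto simp: indicator_def)
    then show ?thesis by simp
  next
    case False
    have "primitive g x = integral\<^sup>L circ g" if "1 < x"
      unfolding primitive_def using that by (intro circ_integral_cong) (auto simp: indicator_def)
    then show ?thesis using False z z' by (cases "x \<le> 1") auto
  qed
  have "Int_stable (range (atMost :: real \<Rightarrow> _))" by (auto simp: Int_stable_def)
  moreover have "range (atMost :: real \<Rightarrow> _) \<subseteq> Pow UNIV" by auto
  moreover have "A \<in> sigma_sets UNIV (range atMost)"
    using A by (simp add: borel_eq_atMost)
  ultimately show ?thesis
  proof (induction rule: sigma_sets_induct_disjoint)
    case (basic A)
    then show ?case using atMost by (auto simp: primitive_def)
  next
    case empty
    then show ?case by simp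
  next
    case (compl X)
    then have "X \<in> sets borel" by (simp add: borel_eq_atMost)
    then have i: "integrable circ (\<lambda>y. indicator X y * g y)" by (rule circ_integrable_indicator[OF g])
    have "(\<lambda>y. indicator (UNIV - X) y * g y) = (\<lambda>y. g y - indicator X y * g y)"
      by (auto simp: indicator_def)
    then show ?case using compl z' i g by simp
  next
    case (union X)
    have X: "X i \<in> sets borel" for i using union by (auto simp: borel_eq_atMost)
    have "(\<lambda>i. (LINT y|circ. (indicator (\<Union>j<i. X j) y :: real) * g y)) \<longlonglongrightarrow>
       (LINT y|circ. indicator (\<Union>j. X j) y * g y)"
    proof (rule integral_dominated_convergence[where w = "\<lambda>y. \<bar>g y\<bar>"])
      show "AE y in circ. (\<lambda>i. (indicator (\<Union>j<i. X j) y :: real) * g y) \<longlonglongrightarrow> indicator (\<Union>j. X j) y * g y"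
      proof (rule AE_I2, rule tendsto_mult_right, rule tendsto_eventually)
        fix y
        show "\<forall>\<^sub>F i in sequentially. (indicator (\<Union>j<i. X j) y :: real) = indicator (\<Union>j. X j) y"
        proof (cases "y \<in> (\<Union>j. X j)")
          case True
          then obtain j where "y \<in> X j" by blast
          then show ?thesis
            by (intro eventually_sequentiallyI[of "Suc j"]) (auto simp: indicator_def)
        qed (auto simp: indicator_def)
      qed
      show "AE y in circ. norm ((indicator (\<Union>j<i. X j) y :: real) * g y) \<le> \<bar>g y\<bar>" for i
        by (rule AE_I2) (auto simp: indicator_def)
      show "(\<lambda>y. indicator (\<Union>j. X j) y * g y) \<in> borel_measurable circ"
        using X circ_integrable_indicator[OF g, of "\<Union>j. X j"] by auto
      show "(\<lambda>y. (indicator (\<Union>j<i. X j) y :: real) * g y) \<in> borel_measurable circ" for i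
        using X circ_integrable_indicator[OF g, of "\<Union>j<i. X j"] by auto
    qed (use g in simp)
    moreover have "(LINT y|circ. (indicator (\<Union>j<i. X j) y :: real) * g y) = 0" for i
    proof (induction i)
      case (Suc i)
      have "disjoint_family X" using union by simp
      then have "X j \<inter> X i = {}" if "j < i" for j
        using disjoint_family_onD[of X UNIV j i] that by simp
      then have "(\<Union>j<i. X j) \<inter> X i = {}" by auto
      then have "(indicator (\<Union>j<Suc i. X j) y :: real) = indicator (\<Union>j<i. X j) y + indicator (X i) y" for y
        by (auto simp: indicator_def lessThan_Suc)
      then have "(LINT y|circ. (indicator (\<Union>j<Suc i. X j) y :: real) * g y) =
        (LINT y|circ. indicator (\<Union>j<i. X j) y * g y + indicator (X i) y * g y)"
        by (simp only: distrib_right)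
      also have "\<dots> = 0"
        using X Suc union by (subst Bochner_Integration.integral_add) (auto intro!: circ_integrable_indicator g)
      finally show ?case .
    qed simp
    ultimately show ?case by (simp add: LIMSEQ_const_iff)
  qed
qed

text \<open>The vanishing integrals over the sets where g is positive and where g is negative have
  integrands of constant sign, hence each integrand vanishes almost everywhere.\<close>

lemma primitive_zero_imp_AE_zero:
  assumes g: "integrable circ g" "g \<in> borel_measurable borel" and z: "\<And>x. x \<in> {0..1} \<Longrightarrow> primitive g x = 0"
  shows "AE x in circ. g x = 0"
proof -
  note [measurable] = g(2)
  have "AE x in circ. indicator {x. 0 < g x} x * g x = 0"
  proof (rule integral_nonneg_eq_0_iff_AE[THEN iffD1])
    show "integrable circ (\<lambda>x. indicator {x. 0 < g x} x * g x)"
      by (rule circ_integrable_indicator[OF g(1)]) measurable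
    show "(LINT x|circ. indicator {x. 0 < g x} x * g x) = 0"
      by (rule integral_borel_sets_zero[OF g(1) z]) measurable
  qed (auto simp: indicator_def)
  moreover have "AE x in circ. - (indicator {x. g x < 0} x * g x) = 0"
  proof (rule integral_nonneg_eq_0_iff_AE[THEN iffD1])
    have "integrable circ (\<lambda>x. indicator {x. g x < 0} x * g x)"
      by (rule circ_integrable_indicator[OF g(1)]) measurable
    then show "integrable circ (\<lambda>x. - (indicator {x. g x < 0} x * g x))" by simp
    have "(LINT x|circ. indicator {x. g x < 0} x * g x) = 0"
      by (rule integral_borel_sets_zero[OF g(1) z]) measurable
    then show "(LINT x|circ. - (indicator {x. g x < 0} x * g x)) = 0" by simp
  qed (auto simp: indicator_def)
  ultimately show ?thesis
    by eventually_elim (auto simp: indicator_def split: if_splits)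
qed

text \<open>The continuous test functions give \<open>\<integral> G (G - m) = 0\<close> for the primitive \<open>G\<close> of \<open>g\<close> and
  its mean \<open>m\<close>, hence \<open>G\<close> is constant.\<close>

lemma orthogonal_trig_poly_imp_AE_zero:
  assumes g: "integrable circ g" "g \<in> borel_measurable borel"
    and orth: "\<And>p. trig_poly p \<Longrightarrow> (LINT x|circ. p x * g x) = 0"
  shows "AE x in circ. g x = 0"
proof -
  \<comment> \<open>Orthogonality extends from trigonometric polynomials to continuous periodic
    functions, because a uniform error e costs at most e times the L^1 norm of g.\<close>
  have orth_cont: "(LINT x|circ. f x * g x) = 0" if f: "continuous_on UNIV f" "circle_fun f" for f
  proof (rule ccontr)
    define I where "I = (LINT x|circ. f x * g x)"
    define L where "L = (LINT x|circ. \<bar>g x\<bar>)"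
    assume "(LINT x|circ. f x * g x) \<noteq> 0"
    then have I: "0 < \<bar>I\<bar>" by (simp add: I_def)
    have L: "0 \<le> L" unfolding L_def by (rule circ_integral_nonneg) simp
    define e where "e = \<bar>I\<bar> / (L + 1)"
    have e: "0 < e" using I L by (simp add: e_def)
    obtain p where p: "trig_poly p" "\<And>x. \<bar>f x - p x\<bar> < e" using trig_poly_dense[OF f e] by blast
    have i1: "integrable circ (\<lambda>x. f x * g x)"
      by (rule circ_integrable_mult_cont[OF g(1)]) (rule continuous_on_subset[OF f(1)], simp)
    have i2: "integrable circ (\<lambda>x. p x * g x)"
      by (rule circ_integrable_mult_cont[OF g(1)]) (rule trig_poly_continuous[OF p(1)])
    have "I = (LINT x|circ. (f x - p x) * g x)"
      using orth[OF p(1)] i1 i2 by (simp add: I_def left_diff_distrib)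
    also have "\<bar>\<dots>\<bar> \<le> (LINT x|circ. \<bar>(f x - p x) * g x\<bar>)"
      using integral_norm_bound[of circ "\<lambda>x. (f x - p x) * g x"] by simp
    also have "\<dots> \<le> (LINT x|circ. e * \<bar>g x\<bar>)"
    proof (rule circ_integral_mono)
      have "integrable circ (\<lambda>x. (f x - p x) * g x)"
        using i1 i2 by (simp add: left_diff_distrib)
      then show "integrable circ (\<lambda>x. \<bar>(f x - p x) * g x\<bar>)" by (rule integrable_abs)
      show "\<bar>(f x - p x) * g x\<bar> \<le> e * \<bar>g x\<bar>" for x
        unfolding abs_mult using less_imp_le[OF p(2)] by (intro mult_right_mono) auto
    qed (use g(1) in simp)
    also have "\<dots> = e * L" by (simp add: L_def)
    finally have "\<bar>I\<bar> \<le> e * L" .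
    also have "\<dots> < e * (L + 1)" using e by simp
    also have "\<dots> = \<bar>I\<bar>" using L by (simp add: e_def)
    finally show False by simp
  qed
  define G where "G = primitive g"
  define m where "m = integral\<^sup>L circ G"
  \<comment> \<open>An antiderivative of \<open>G - m\<close>. Subtracting the mean gives it equal
    end values, so its periodic extension is continuous and is an admissible test function.\<close>
  define \<psi> where "\<psi> x = integral {0..x} (\<lambda>y. G y - m)" for x
  have G_cont: "continuous_on {0..1} G" unfolding G_def by (rule primitive_continuous[OF g(1)])
  have Gm_cont: "continuous_on {0..1} (\<lambda>x. G x - m)" by (intro continuous_intros G_cont)
  have g0: "integral\<^sup>L circ g = 0" using orth[OF trig_poly_const[of 1]] by simp
  have d: "(\<psi> has_real_derivative G x - m) (at x within {0..1})" if "x \<in> {0..1}" for x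
    using integral_has_real_derivative[OF Gm_cont that] by (simp add: \<psi>_def[abs_def])
  have int_Gm: "(LINT x|circ. G x - m) = 0"
    using circ_integrable_continuous[OF G_cont] by (simp add: m_def)
  have \<psi>1: "\<psi> 1 = 0"
    using int_Gm circ_integral_HK[OF circ_integrable_continuous[OF Gm_cont]] by (simp add: \<psi>_def)
  have \<psi>0: "\<psi> 0 = 0" by (simp add: \<psi>_def)
  have "(LINT x|circ. \<psi> (frac x) * g x) = 0"
    using \<psi>0 \<psi>1 by (intro orth_cont circle_extension_continuous circle_extension_periodic DERIV_continuous_on[OF d]) auto
  moreover have "(LINT x|circ. \<psi> (frac x) * g x) = (LINT x|circ. \<psi> x * g x)"
  proof (rule circ_integral_cong)
    fix x :: real assume "x \<in> {0..1}"
    then have "x = 1 \<or> frac x = x" by (force simp: frac_eq)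
    then show "\<psi> (frac x) * g x = \<psi> x * g x" using \<psi>0 \<psi>1 by auto
  qed
  ultimately have GG: "(LINT x|circ. G x * (G x - m)) = 0"
    using primitive_by_parts[OF g(1) Gm_cont d] g0 by (simp add: G_def)
  have "(LINT x|circ. (G x - m)\<^sup>2) = (LINT x|circ. G x * (G x - m) - m * (G x - m))"
    by (simp add: power2_eq_square algebra_simps)
  also have "\<dots> = (LINT x|circ. G x * (G x - m)) - m * (LINT x|circ. G x - m)"
    by (subst Bochner_Integration.integral_diff) (auto intro!: circ_integrable_continuous continuous_intros G_cont)
  finally have 0: "(LINT x|circ. (G x - m)\<^sup>2) = 0" using GG int_Gm by simp
  have Gm: "G x = m" if "x \<in> {0..1}" for x
    using circ_continuous_eq_zero[OF _ _ 0 that] by (simp add: continuous_intros G_cont)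
  have "m = 0" using Gm[of 0] primitive_0[OF g(1)] by (simp add: G_def)
  then show ?thesis using primitive_zero_imp_AE_zero[OF g] Gm by (simp add: G_def)
qed

section \<open>Square-integrable functions and weak derivatives\<close>

lemma circle_L2_D:
  assumes "f \<in> circle_L2"
  shows "circle_fun f" "f \<in> borel_measurable borel" "integrable circ (\<lambda>x. (f x)\<^sup>2)" "integrable circ f"
proof -
  show 1: "circle_fun f" "f \<in> borel_measurable borel" "integrable circ (\<lambda>x. (f x)\<^sup>2)"
    using assms by (simp_all add: circle_L2_def set_integrable_circ)
  show "integrable circ f"
  proof (rule Bochner_Integration.integrable_bound)
    show "integrable circ (\<lambda>x. 1 + (f x)\<^sup>2)" using 1(3) by simp
    show "f \<in> borel_measurable circ" by (rule measurable_circ[OF 1(2)])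
    have "\<bar>z\<bar> \<le> \<bar>1 + z\<^sup>2\<bar>" for z :: real
    proof -
      have "2 * \<bar>z\<bar> * 1 \<le> \<bar>z\<bar>\<^sup>2 + 1\<^sup>2" by (rule sum_squares_bound)
      then show ?thesis by simp
    qed
    then show "AE x in circ. norm (f x) \<le> norm (1 + (f x)\<^sup>2)" by simp
  qed
qed

lemma circle_L2_continuous:
  assumes "continuous_on UNIV f" "circle_fun f" shows "f \<in> circle_L2"
  using assms circ_integrable_continuous[of "\<lambda>x. (f x)\<^sup>2"]
  by (auto simp: circle_L2_def set_integrable_circ borel_measurable_continuous_onI
      intro!: continuous_intros intro: continuous_on_subset)

lemma has_weak_dx_D:
  assumes "has_weak_dx f g" "circle_test_fun \<phi>"
  shows "(LINT x|circ. f x * deriv \<phi> x) = - (LINT x|circ. g x * \<phi> x)"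
  using assms by (simp add: has_weak_dx_def circle_integral_eq)

lemma has_weak_dx_unique:
  assumes g: "has_weak_dx f g" and h: "has_weak_dx f h"
  shows "AE x in circ. g x = h x"
proof -
  have L2: "g \<in> circle_L2" "h \<in> circle_L2" using g h by (auto simp: has_weak_dx_def)
  note g' = circle_L2_D[OF L2(1)] and h' = circle_L2_D[OF L2(2)]
  have "AE x in circ. g x - h x = 0"
  proof (rule orthogonal_trig_poly_imp_AE_zero)
    show "integrable circ (\<lambda>x. g x - h x)" using g' h' by simp
    show "(\<lambda>x. g x - h x) \<in> borel_measurable borel" using g'(2) h'(2) by measurable
    fix p assume p: "trig_poly p"
    have i: "integrable circ (\<lambda>x. p x * g x)" "integrable circ (\<lambda>x. p x * h x)"
      by (intro circ_integrable_mult_cont trig_poly_continuous p g' h')+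
    have "(LINT x|circ. g x * p x) = (LINT x|circ. h x * p x)"
      using has_weak_dx_D[OF g trig_poly_test_fun[OF p]] has_weak_dx_D[OF h trig_poly_test_fun[OF p]] by simp
    then show "(LINT x|circ. p x * (g x - h x)) = 0"
      using i by (simp add: right_diff_distrib mult.commute)
  qed
  then show ?thesis by simp
qed

text \<open>Replaces the arbitrary choice in \<open>weak_dx\<close> by any weak derivative that is
  explicitly known.\<close>

lemma circle_L2_norm_weak_dx:
  assumes g: "has_weak_dx f g"
  shows "(circle_L2_norm (weak_dx f))\<^sup>2 = (LINT x|circ. (g x)\<^sup>2)"
proof -
  have w: "has_weak_dx f (weak_dx f)" unfolding weak_dx_def by (rule someI[of "has_weak_dx f" g, OF g])
  have "(LINT x|circ. (weak_dx f x)\<^sup>2) = (LINT x|circ. (g x)\<^sup>2)"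
  proof (rule integral_cong_AE)
    show "AE x in circ. (weak_dx f x)\<^sup>2 = (g x)\<^sup>2"
      using has_weak_dx_unique[OF w g] by eventually_elim simp
    have "weak_dx f \<in> circle_L2" "g \<in> circle_L2" using w g by (auto simp: has_weak_dx_def)
    then show "(\<lambda>x. (weak_dx f x)\<^sup>2) \<in> borel_measurable circ" "(\<lambda>x. (g x)\<^sup>2) \<in> borel_measurable circ"
      using circle_L2_D(3) by (auto intro: borel_measurable_integrable)
  qed
  moreover have "0 \<le> (LINT x|circ. (g x)\<^sup>2)" by (rule circ_integral_nonneg) simp
  ultimately show ?thesis by (simp add: circle_L2_norm_def circle_integral_eq)
qed

lemma circle_test_fun_deriv:
  assumes "circle_test_fun \<phi>"
  shows "(\<phi> has_real_derivative deriv \<phi> x) (at x)" "continuous_on S (deriv \<phi>)" "continuous_on S \<phi>"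
proof -
  have d: "(deriv ^^ n) \<phi> differentiable_on UNIV" for n using assms by (simp add: circle_test_fun_def)
  have "\<phi> differentiable (at x)" for x using d[of 0] by (simp add: differentiable_on_def)
  then show "(\<phi> has_real_derivative deriv \<phi> x) (at x)"
    using DERIV_deriv_iff_real_differentiable by blast
  show "continuous_on S (deriv \<phi>)"
    using differentiable_imp_continuous_on[OF d[of 1]] by (auto intro: continuous_on_subset)
  show "continuous_on S \<phi>"
    using differentiable_imp_continuous_on[OF d[of 0]] by (auto intro: continuous_on_subset)
qed

lemma has_weak_dx_classical:
  assumes f: "circle_fun f" "continuous_on UNIV f'" "circle_fun f'"
    and d: "\<And>x. (f has_real_derivative f' x) (at x)"
  shows "has_weak_dx f f'"
proof -
  have fc: "continuous_on S f" for S
    using d DERIV_continuous_on has_field_derivative_at_within by blast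
  have "(LINT x|circ. f x * deriv \<phi> x) = - (LINT x|circ. f' x * \<phi> x)"
    if \<phi>: "circle_test_fun \<phi>" for \<phi>
  proof -
    note \<phi>' = circle_test_fun_deriv[OF \<phi>]
    have f'c: "continuous_on S f'" for S using f(2) by (rule continuous_on_subset) simp
    have "(LINT x|circ. f x * deriv \<phi> x + f' x * \<phi> x) = f 1 * \<phi> 1 - f 0 * \<phi> 0"
      by (rule circ_integral_FTC)
         (auto intro!: continuous_intros fc f'c \<phi>' derivative_eq_intros d)
    also have "\<dots> = 0"
    proof -
      have "circle_fun \<phi>" using \<phi> by (simp add: circle_test_fun_def)
      then show ?thesis using f(1) unfolding circle_fun_def by (metis add_0 diff_self)
    qed
    finally show ?thesis
      by (subst (asm) Bochner_Integration.integral_add)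
         (auto intro!: circ_integrable_continuous continuous_intros fc f'c \<phi>')
  qed
  then show ?thesis
    using f fc circle_L2_continuous by (auto simp: has_weak_dx_def circle_integral_eq)
qed

text \<open>The constant \<open>c\<close> is the mean of \<open>p\<close>, the one part of
  \<open>p\<close> without a periodic antiderivative.\<close>

lemma trig_poly_antiderivative:
  assumes "trig_poly p"
  shows "\<exists>q c. trig_poly q \<and> (\<forall>x. (q has_real_derivative p x - c) (at x))"
  using assms
proof induction
  case (cos n a)
  show ?case
  proof (cases "n = 0")
    case True
    then show ?thesis
      by (intro exI[of _ "\<lambda>x. 0"] exI[of _ "cos a"]) (auto intro: trig_poly_const)
  next
    case False
    have "cos (2 * pi * real n * x + (a - pi/2)) = sin (2 * pi * real n * x + a)" for x
      unfolding add_diff_eq by (simp add: cos_diff)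
    then have "trig_poly (\<lambda>x. 1 / (2 * pi * real n) * sin (2 * pi * real n * x + a))"
      using trig_poly.scale[OF trig_poly.cos[of n "a - pi/2"], of "1 / (2 * pi * real n)"] by (simp only:)
    moreover have "((\<lambda>x. 1 / (2 * pi * real n) * sin (2 * pi * real n * x + a)) has_real_derivative
        cos (2 * pi * real n * x + a) - 0) (at x)" for x
      using False by (auto intro!: derivative_eq_intros)
    ultimately show ?thesis by blast
  qed
next
  case (add f g)
  then obtain q1 c1 q2 c2 where "trig_poly q1" "\<And>x. (q1 has_real_derivative f x - c1) (at x)"
    "trig_poly q2" "\<And>x. (q2 has_real_derivative g x - c2) (at x)" by blast
  then show ?case
    by (intro exI[of _ "\<lambda>x. q1 x + q2 x"] exI[of _ "c1 + c2"])
       (auto intro!: trig_poly.add derivative_eq_intros)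
next
  case (scale f c)
  then obtain q d where q: "trig_poly q" "\<And>x. (q has_real_derivative f x - d) (at x)" by blast
  have "((\<lambda>x. c * q x) has_real_derivative c * f x - c * d) (at x)" for x
    using DERIV_cmult[OF q(2)[of x], of c] by (simp add: right_diff_distrib)
  then show ?case using trig_poly.scale[OF q(1), of c] by blast
qed

text \<open>The representative is the primitive of \<open>g\<close> made mean-free. The last
  conclusion admits periodic C^1 functions and not only smooth test functions: it will be applied to
  the Cole--Hopf datum times the heat kernel, which is just C^1 because an antiderivative of
  \<open>v\<close> enters it.\<close>

lemma H1_continuous_representative:
  assumes u: "has_weak_dx u g" and u0: "integral\<^sup>L circ u = 0"
  obtains v where "continuous_on UNIV v" "circle_fun v" "AE x in circ. u x = v x"
    "integral\<^sup>L circ v = 0"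
    "\<And>\<psi> \<psi>'. continuous_on {0..1} \<psi>' \<Longrightarrow> (\<And>x. x \<in> {0..1} \<Longrightarrow> (\<psi> has_real_derivative \<psi>' x) (at x)) \<Longrightarrow>
       \<psi> 1 = \<psi> 0 \<Longrightarrow> (LINT x|circ. v x * \<psi>' x) = - (LINT x|circ. g x * \<psi> x)"
proof -
  have L2: "u \<in> circle_L2" "g \<in> circle_L2" using u by (auto simp: has_weak_dx_def)
  note u' = circle_L2_D[OF L2(1)] and g' = circle_L2_D[OF L2(2)]
  have "circle_test_fun (\<lambda>x. 1)" by (rule trig_poly_test_fun[OF trig_poly_const])
  from has_weak_dx_D[OF u this] have g0: "integral\<^sup>L circ g = 0" by simp
  define G where "G = primitive g"
  have G_cont: "continuous_on {0..1} G" unfolding G_def by (rule primitive_continuous[OF g'(4)])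
  have G01: "G 0 = 0" "G 1 = 0" using primitive_0[OF g'(4)] primitive_1[OF g'(4)] g0 by (auto simp: G_def)
  define c where "c = integral\<^sup>L circ G"
  define v where "v x = G (frac x) - c" for x
  have v_eq: "v x = G x - c" if "x \<in> {0..1}" for x
  proof -
    have "x = 1 \<or> frac x = x" using that by (force simp: frac_eq)
    then show ?thesis using G01 by (auto simp: v_def)
  qed
  have v_cont: "continuous_on UNIV v"
    unfolding v_def using G01 by (intro continuous_intros circle_extension_continuous G_cont) simp
  have v_per: "circle_fun v" using circle_extension_periodic[of G] by (simp add: v_def circle_fun_def)
  have v_i: "integrable circ v" by (rule circ_integrable_continuous[OF continuous_on_subset[OF v_cont]]) simp
  have v0: "integral\<^sup>L circ v = 0"
  proof -
    have "integral\<^sup>L circ v = (LINT x|circ. G x - c)" by (rule circ_integral_cong) (rule v_eq)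
    also have "\<dots> = 0" using circ_integrable_continuous[OF G_cont] by (simp add: c_def)
    finally show ?thesis .
  qed
  have parts: "(LINT x|circ. v x * \<psi>' x) = - (LINT x|circ. g x * \<psi> x)"
    if \<psi>: "continuous_on {0..1} \<psi>'" "\<And>x. x \<in> {0..1} \<Longrightarrow> (\<psi> has_real_derivative \<psi>' x) (at x)" "\<psi> 1 = \<psi> 0"
    for \<psi> \<psi>'
  proof -
    have "(LINT x|circ. v x * \<psi>' x) = (LINT x|circ. G x * \<psi>' x - c * \<psi>' x)"
      by (rule circ_integral_cong) (simp add: v_eq left_diff_distrib)
    also have "\<dots> = (LINT x|circ. G x * \<psi>' x) - c * integral\<^sup>L circ \<psi>'"
      by (subst Bochner_Integration.integral_diff)
         (auto intro!: circ_integrable_continuous continuous_intros G_cont \<psi>)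
    also have "integral\<^sup>L circ \<psi>' = 0" using circ_integral_FTC[OF \<psi>(1,2)] \<psi>(3) by simp
    also have "(LINT x|circ. G x * \<psi>' x) = - (LINT x|circ. g x * \<psi> x)"
      using primitive_by_parts[OF g'(4) \<psi>(1) has_field_derivative_at_within[OF \<psi>(2)]] g0
      by (simp add: G_def mult.commute)
    finally show ?thesis by simp
  qed
  \<comment> \<open>A trigonometric polynomial is a constant plus the derivative of another one. The
    functions \<open>u\<close> and \<open>v\<close> agree against constants, having mean zero, and
    against derivatives, having the same weak derivative \<open>g\<close>.\<close>
  have "AE x in circ. u x - v x = 0"
  proof (rule orthogonal_trig_poly_imp_AE_zero)
    show "integrable circ (\<lambda>x. u x - v x)" using u' v_i by simp
    show "(\<lambda>x. u x - v x) \<in> borel_measurable borel"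
      using u'(2) borel_measurable_continuous_onI[OF v_cont] by measurable
    fix p assume p: "trig_poly p"
    obtain q c where q: "trig_poly q" "\<And>x. (q has_real_derivative p x - c) (at x)"
      using trig_poly_antiderivative[OF p] by blast
    have dq: "deriv q = (\<lambda>x. p x - c)" using q(2) by (auto intro: DERIV_imp_deriv)
    have pc: "continuous_on {0..1} (\<lambda>x. p x - c)" by (intro continuous_intros trig_poly_continuous p)
    have "q 1 = q 0" using trig_poly_periodic[OF q(1)] by (metis circle_fun_def add_0)
    then have "(LINT x|circ. v x * (p x - c)) = - (LINT x|circ. g x * q x)"
      using parts[OF pc q(2)] by simp
    moreover have "(LINT x|circ. u x * (p x - c)) = - (LINT x|circ. g x * q x)"
      using has_weak_dx_D[OF u trig_poly_test_fun[OF q(1)]] by (simp add: dq)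
    moreover have pu: "integrable circ (\<lambda>x. p x * u x)" "integrable circ (\<lambda>x. p x * v x)"
      by (intro circ_integrable_mult_cont trig_poly_continuous p u' v_i)+
    have "(LINT x|circ. w x * (p x - c)) = (LINT x|circ. p x * w x) - c * integral\<^sup>L circ w"
      if "integrable circ (\<lambda>x. p x * w x)" "integrable circ w" for w
      using that by (simp add: right_diff_distrib mult.commute)
    note this[OF pu(1) u'(4)] this[OF pu(2) v_i]
    ultimately have "(LINT x|circ. p x * u x) = (LINT x|circ. p x * v x)"
      using u0 v0 by simp
    then show "(LINT x|circ. p x * (u x - v x)) = 0"
      using pu by (simp add: right_diff_distrib)
  qed
  then have "AE x in circ. u x = v x" by simp
  from that[OF v_cont v_per this v0 parts] show ?thesis .
qed

section \<open>Energy estimates for classical solutions\<close>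

lemma circ_integral_has_dt:
  fixes F F' :: "real \<Rightarrow> real \<Rightarrow> real"
  assumes r: "0 < r" and d: "\<And>t x. t \<in> cball t0 r \<Longrightarrow> x \<in> {0..1} \<Longrightarrow> ((\<lambda>t. F t x) has_real_derivative F' t x) (at t)"
    and c: "continuous_on (cball t0 r \<times> {0..1}) (\<lambda>p. F' (fst p) (snd p))"
    and F: "\<And>t. t \<in> cball t0 r \<Longrightarrow> continuous_on {0..1} (F t)"
  shows "((\<lambda>t. integral\<^sup>L circ (F t)) has_real_derivative integral\<^sup>L circ (F' t0)) (at t0)"
proof -
  have "bounded ((\<lambda>p. F' (fst p) (snd p)) ` (cball t0 r \<times> {0..1}))"
    by (intro compact_imp_bounded compact_continuous_image c compact_Times) auto
  then obtain B where "\<forall>p\<in>cball t0 r \<times> {0..1}. \<bar>F' (fst p) (snd p)\<bar> \<le> B" by (auto simp: bounded_iff)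
  then have B: "\<bar>F' t x\<bar> \<le> B" if "t \<in> cball t0 r" "x \<in> {0..1}" for t x using that by force
  have F'c: "continuous_on {0..1} (F' t0)"
    using continuous_on_compose2[OF c, of "{0..1}" "\<lambda>x. (t0, x)"] r
    by (auto simp: continuous_on_Pair continuous_on_const continuous_on_id image_subset_iff)
  have sub: "t \<in> cball t0 r" if "t \<in> ball t0 r" for t using that by simp
  have "((\<lambda>t. (LINT x|circ. F t x * 1)) has_real_derivative (LINT x|circ. F' t0 x * 1)) (at t0)"
  proof (rule circ_integral_has_derivative_param[OF _ r])
    show "integrable circ (\<lambda>x. F t x * 1)" if "t \<in> ball t0 r" for t
      using circ_integrable_continuous[OF F[OF sub[OF that]]] by simp
    show "F t \<in> borel_measurable circ" if "t \<in> ball t0 r" for t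
      by (rule borel_measurable_cont_circ[OF F[OF sub[OF that]]])
    show "F' t0 \<in> borel_measurable circ" by (rule borel_measurable_cont_circ[OF F'c])
    show "\<bar>F' t x\<bar> \<le> B" if "t \<in> ball t0 r" "x \<in> {0..1}" for t x using B sub that by blast
    show "((\<lambda>t. F t x) has_real_derivative F' t x) (at t)" if "t \<in> ball t0 r" "x \<in> {0..1}" for t x
      using d sub that by blast
  qed simp
  then show ?thesis by simp
qed

lemma has_real_derivative_sqrt_sum:
  assumes "(f has_real_derivative f') (at x)" "0 < e"
  shows "((\<lambda>x. sqrt (e\<^sup>2 + (f x)\<^sup>2)) has_real_derivative f x / sqrt (e\<^sup>2 + (f x)\<^sup>2) * f') (at x)"
proof -
  have "((\<lambda>x. e\<^sup>2 + (f x)\<^sup>2) has_real_derivative 2 * f x * f') (at x)"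
    by (auto intro!: derivative_eq_intros assms(1))
  moreover have "0 < e\<^sup>2 + (f x)\<^sup>2" using assms(2) by (simp add: add_pos_nonneg)
  ultimately have "((\<lambda>x. sqrt (e\<^sup>2 + (f x)\<^sup>2)) has_real_derivative
      inverse (sqrt (e\<^sup>2 + (f x)\<^sup>2)) / 2 * (2 * f x * f')) (at x)"
    by (intro DERIV_chain2[OF DERIV_real_sqrt, of "\<lambda>x. e\<^sup>2 + (f x)\<^sup>2"])
  moreover have "inverse z / 2 * (2 * a * b) = a / z * b" for z a b :: real
    by (simp add: field_simps)
  ultimately show ?thesis by (simp only:)
qed

text \<open>Here \<open>w1\<close>, \<open>w2\<close>, \<open>w3\<close> are the successive space
  derivatives. The evolution equation of \<open>w1\<close>, formally the x-derivative of the first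
  one, is a separate assumption: exchanging mixed derivatives is thereby avoided, and the explicit
  solution satisfies it by direct computation. Nothing is assumed at time 0.\<close>

locale classical_burgers =
  fixes \<nu> :: real and w w1 w2 w3 :: "real \<Rightarrow> real \<Rightarrow> real"
  assumes nu: "0 < \<nu>"
    and per: "\<And>t. 0 < t \<Longrightarrow> circle_fun (w t)" "\<And>t. 0 < t \<Longrightarrow> circle_fun (w1 t)"
      "\<And>t. 0 < t \<Longrightarrow> circle_fun (w2 t)"
    and dx: "\<And>t x. 0 < t \<Longrightarrow> (w t has_real_derivative w1 t x) (at x)"
      "\<And>t x. 0 < t \<Longrightarrow> (w1 t has_real_derivative w2 t x) (at x)"
      "\<And>t x. 0 < t \<Longrightarrow> (w2 t has_real_derivative w3 t x) (at x)"
    and dt: "\<And>t x. 0 < t \<Longrightarrow> ((\<lambda>t. w t x) has_real_derivative \<nu> * w2 t x - w t x * w1 t x) (at t)"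
      "\<And>t x. 0 < t \<Longrightarrow> ((\<lambda>t. w1 t x) has_real_derivative \<nu> * w3 t x - (w1 t x)\<^sup>2 - w t x * w2 t x) (at t)"
    and cont: "continuous_on ({0<..} \<times> UNIV) (\<lambda>p. w (fst p) (snd p))"
      "continuous_on ({0<..} \<times> UNIV) (\<lambda>p. w1 (fst p) (snd p))"
      "continuous_on ({0<..} \<times> UNIV) (\<lambda>p. w2 (fst p) (snd p))"
      "continuous_on ({0<..} \<times> UNIV) (\<lambda>p. w3 (fst p) (snd p))"
begin

lemma cont_x:
  assumes "0 < t"
  shows "continuous_on S (w t)" "continuous_on S (w1 t)" "continuous_on S (w2 t)" "continuous_on S (w3 t)"
proof -
  have *: "continuous_on S (f t)" if "continuous_on ({0<..} \<times> UNIV) (\<lambda>p. f (fst p) (snd p))" for f :: "real \<Rightarrow> real \<Rightarrow> real"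
    using continuous_on_compose2[OF that, of S "\<lambda>x. (t, x)"] assms
    by (simp add: continuous_on_Pair continuous_on_const continuous_on_id image_subset_iff)
  show "continuous_on S (w t)" "continuous_on S (w1 t)" "continuous_on S (w2 t)" "continuous_on S (w3 t)"
    by (intro * cont)+
qed

lemma end_eq:
  assumes "0 < t" shows "w t 1 = w t 0" "w1 t 1 = w1 t 0" "w2 t 1 = w2 t 0"
  using per[OF assms] unfolding circle_fun_def by (metis add_0)+

lemma cball_pos: "0 < t \<Longrightarrow> \<tau> \<in> cball t (t/2) \<Longrightarrow> 0 < (\<tau>::real)"
  by (auto simp: dist_real_def abs_if split: if_splits)

lemma cont_cball:
  assumes "0 < t"
  shows "continuous_on (cball t (t/2) \<times> {0..1}) (\<lambda>p. w (fst p) (snd p))"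
    "continuous_on (cball t (t/2) \<times> {0..1}) (\<lambda>p. w1 (fst p) (snd p))"
    "continuous_on (cball t (t/2) \<times> {0..1}) (\<lambda>p. w2 (fst p) (snd p))"
    "continuous_on (cball t (t/2) \<times> {0..1}) (\<lambda>p. w3 (fst p) (snd p))"
proof -
  have "cball t (t/2) \<times> {0..1} \<subseteq> {0<..} \<times> (UNIV :: real set)" using cball_pos[OF assms] by blast
  note * = continuous_on_subset[OF _ this]
  show "continuous_on (cball t (t/2) \<times> {0..1}) (\<lambda>p. w (fst p) (snd p))"
    "continuous_on (cball t (t/2) \<times> {0..1}) (\<lambda>p. w1 (fst p) (snd p))"
    "continuous_on (cball t (t/2) \<times> {0..1}) (\<lambda>p. w2 (fst p) (snd p))"
    "continuous_on (cball t (t/2) \<times> {0..1}) (\<lambda>p. w3 (fst p) (snd p))"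
    by (intro * cont)+
qed

text \<open>\<open>|v|\<close>, \<open>v = w\<^sub>x\<close>, is regularized to \<open>\<eta>(v) = sqrt (\<epsilon>\<^sup>2 + v\<^sup>2)\<close>; integrating by parts,
  \<open>d/dt \<integral> \<eta>(v) = - \<integral> \<eta>''(v) v\<^sub>x (\<nu> v\<^sub>x - w v)\<close>, and \<open>\<eta>''(v) v\<^sup>2 \<le> \<epsilon>\<close>.\<close>

lemma regularized_variation_derivative:
  assumes t: "0 < t" and e: "0 < \<epsilon>" and M: "\<And>x. \<bar>w t x\<bar> \<le> M"
  shows "\<exists>D. ((\<lambda>t. (LINT x|circ. sqrt (\<epsilon>\<^sup>2 + (w1 t x)\<^sup>2))) has_real_derivative D) (at t) \<and>
    D \<le> \<epsilon> * M\<^sup>2 / (4 * \<nu>)"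
proof -
  define r where "r \<tau> x = sqrt (\<epsilon>\<^sup>2 + (w1 \<tau> x)\<^sup>2)" for \<tau> x
  have pos: "0 < \<epsilon>\<^sup>2 + v\<^sup>2" for v :: real using e by (simp add: add_pos_nonneg)
  have r: "0 < r \<tau> x" "(r \<tau> x)\<^sup>2 = \<epsilon>\<^sup>2 + (w1 \<tau> x)\<^sup>2" for \<tau> x
    using pos[of "w1 \<tau> x"] by (simp_all add: r_def)
  have rc: "continuous_on {0..1} (r \<tau>)" if "0 < \<tau>" for \<tau>
    unfolding r_def by (intro continuous_intros cont_x that)
  define F where "F \<tau> x = w1 \<tau> x / r \<tau> x * (\<nu> * w3 \<tau> x - (w1 \<tau> x)\<^sup>2 - w \<tau> x * w2 \<tau> x)" for \<tau> x
  define H where "H x = \<epsilon>\<^sup>2 / (r t x) ^ 3 * w2 t x * (\<nu> * w2 t x - w t x * w1 t x)" for x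
  have deriv: "((\<lambda>t. integral\<^sup>L circ (r t)) has_real_derivative integral\<^sup>L circ (F t)) (at t)"
  proof (rule circ_integral_has_dt[of "t/2"])
    show "((\<lambda>t. r t x) has_real_derivative F \<tau> x) (at \<tau>)" if "\<tau> \<in> cball t (t/2)" for \<tau> x
      unfolding r_def[abs_def] F_def
      by (intro has_real_derivative_sqrt_sum dt cball_pos[OF t that] e)
    show "continuous_on (cball t (t/2) \<times> {0..1}) (\<lambda>p. F (fst p) (snd p))"
      unfolding F_def r_def using e by (intro continuous_intros cont_cball t ballI) (simp add: sum_power2_eq_zero_iff)
    show "continuous_on {0..1} (r \<tau>)" if "\<tau> \<in> cball t (t/2)" for \<tau>
      by (rule rc[OF cball_pos[OF t that]])
  qed (use t in simp)
  have Fc: "continuous_on {0..1} (F t)"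
    unfolding F_def using r(1) by (intro continuous_intros cont_x t rc ballI) (simp add: less_imp_neq[symmetric])
  have Hc: "continuous_on {0..1} H"
    unfolding H_def using r(1) by (intro continuous_intros cont_x t rc ballI) (simp add: less_imp_neq[symmetric])
  \<comment> \<open>F + H is the x-derivative of the flux \<eta>'(v) (\<nu> v_x - w v), where
    \<eta>'(v) = v / r and \<eta>''(v) = \<epsilon>^2 / r^3. By periodicity its integral
    vanishes.\<close>
  have "(LINT x|circ. F t x + H x) =
    w1 t 1 / r t 1 * (\<nu> * w2 t 1 - w t 1 * w1 t 1) - w1 t 0 / r t 0 * (\<nu> * w2 t 0 - w t 0 * w1 t 0)"
  proof (rule circ_integral_FTC)
    show "continuous_on {0..1} (\<lambda>x. F t x + H x)" by (intro continuous_intros Fc Hc)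
    fix x :: real
    have dr: "(r t has_real_derivative w1 t x * w2 t x / r t x) (at x)"
      using has_real_derivative_sqrt_sum[OF dx(2)[OF t, of x] e] unfolding r_def[abs_def] by simp
    have 1: "((\<lambda>x. w1 t x / r t x) has_real_derivative \<epsilon>\<^sup>2 / (r t x) ^ 3 * w2 t x) (at x)"
    proof -
      have "((\<lambda>x. w1 t x / r t x) has_real_derivative
         (w2 t x * r t x - w1 t x * (w1 t x * w2 t x / r t x)) / (r t x * r t x)) (at x)"
        using r(1)[of t x] by (intro DERIV_divide dr dx t) simp
      moreover have "(w2 t x * r t x - w1 t x * (w1 t x * w2 t x / r t x)) / (r t x * r t x) =
         ((r t x)\<^sup>2 - (w1 t x)\<^sup>2) / (r t x) ^ 3 * w2 t x"
        using r(1)[of t x] by (simp add: field_simps power2_eq_square power3_eq_cube)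
      ultimately show ?thesis by (simp add: r(2))
    qed
    show "((\<lambda>x. w1 t x / r t x * (\<nu> * w2 t x - w t x * w1 t x)) has_real_derivative F t x + H x) (at x)"
      unfolding F_def H_def
      by (rule derivative_eq_intros 1 dx t refl)+ (simp add: algebra_simps power2_eq_square)
  qed
  also have "\<dots> = 0" using end_eq[OF t] by (simp add: r_def)
  finally have "integral\<^sup>L circ (F t) = - integral\<^sup>L circ H"
    using circ_integrable_continuous[OF Fc] circ_integrable_continuous[OF Hc] by simp
  also have "\<dots> = (LINT x|circ. - H x)" by simp
  also have "\<dots> \<le> (LINT x|circ. \<epsilon> * M\<^sup>2 / (4 * \<nu>))"
  proof (rule circ_integral_mono)
    show "integrable circ (\<lambda>x. - H x)" using circ_integrable_continuous[OF Hc] by simp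
    fix x :: real
    define R where "R = r t x"
    define v where "v = w1 t x"
    have R: "0 < R" "R\<^sup>2 = \<epsilon>\<^sup>2 + v\<^sup>2" using r[of t x] by (auto simp: R_def v_def)
    have eR: "\<epsilon> \<le> R"
    proof (rule power2_le_imp_le)
      show "\<epsilon>\<^sup>2 \<le> R\<^sup>2" unfolding R(2) by simp
    qed (use R(1) in simp)
    have vR: "v\<^sup>2 \<le> R\<^sup>2" using R by simp
    have q: "\<epsilon>\<^sup>2 * v\<^sup>2 / R ^ 3 \<le> \<epsilon>"
    proof -
      have "\<epsilon> * (\<epsilon> * v\<^sup>2) \<le> \<epsilon> * (R * R\<^sup>2)" using e eR vR R(1) by (intro mult_left_mono mult_mono) auto
      then have "\<epsilon>\<^sup>2 * v\<^sup>2 \<le> \<epsilon> * R ^ 3" by (simp add: power2_eq_square power3_eq_cube mult_ac)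
      then show ?thesis using R(1) by (simp add: pos_divide_le_eq)
    qed
    \<comment> \<open>Completing the square in v_x: the viscous term absorbs the transport term up
      to w^2 v^2 / (4 \<nu>).\<close>
    have am: "- (w2 t x * (\<nu> * w2 t x - w t x * v)) \<le> (M\<^sup>2 * v\<^sup>2) / (4 * \<nu>)"
    proof -
      have "0 \<le> (2 * \<nu> * w2 t x - w t x * v)\<^sup>2" by simp
      then have "4 * \<nu> * (- (w2 t x * (\<nu> * w2 t x - w t x * v))) \<le> (w t x)\<^sup>2 * v\<^sup>2"
        by (simp add: power2_eq_square algebra_simps)
      also have "(w t x)\<^sup>2 \<le> M\<^sup>2" using M[of x] by (metis abs_ge_zero power2_abs power_mono)
      then have "(w t x)\<^sup>2 * v\<^sup>2 \<le> M\<^sup>2 * v\<^sup>2" by (rule mult_right_mono) simp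
      finally show ?thesis using nu by (simp add: pos_le_divide_eq mult.commute)
    qed
    have "- H x = \<epsilon>\<^sup>2 / R ^ 3 * (- (w2 t x * (\<nu> * w2 t x - w t x * v)))"
      by (simp add: H_def R_def v_def)
    also have "\<dots> \<le> \<epsilon>\<^sup>2 / R ^ 3 * ((M\<^sup>2 * v\<^sup>2) / (4 * \<nu>))"
      using R by (intro mult_left_mono am) simp
    also have "\<dots> = (\<epsilon>\<^sup>2 * v\<^sup>2 / R ^ 3) * (M\<^sup>2 / (4 * \<nu>))" by simp
    also have "\<dots> \<le> \<epsilon> * (M\<^sup>2 / (4 * \<nu>))" using nu by (intro mult_right_mono q) simp
    finally show "- H x \<le> \<epsilon> * M\<^sup>2 / (4 * \<nu>)" by simp
  qed simp
  finally show ?thesis using deriv unfolding r_def[abs_def] by auto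
qed

text \<open>The bound M appears only in the growth rate of the regularized variation, which is
  proportional to \<epsilon>, and therefore disappears from the result as \<epsilon> tends to
  0.\<close>

lemma variation_nonincreasing:
  assumes s: "0 < s" "s \<le> t" and M: "\<And>\<tau> x. s \<le> \<tau> \<Longrightarrow> \<tau> \<le> t \<Longrightarrow> \<bar>w \<tau> x\<bar> \<le> M"
  shows "(LINT x|circ. \<bar>w1 t x\<bar>) \<le> (LINT x|circ. \<bar>w1 s x\<bar>)"
proof -
  have t: "0 < t" using s by simp
  \<comment> \<open>Two errors proportional to \<epsilon>: the 1 comes from sqrt(\<epsilon>^2 + v^2)
    \<le> \<epsilon> + |v| at time s, the rest from the growth between s and t.\<close>
  define c where "c = 1 + M\<^sup>2 / (4 * \<nu>) * (t - s)"
  have c: "1 \<le> c" using s nu by (simp add: c_def)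
  have main: "(LINT x|circ. \<bar>w1 t x\<bar>) \<le> (LINT x|circ. \<bar>w1 s x\<bar>) + c * \<epsilon>" if e: "0 < \<epsilon>" for \<epsilon>
  proof -
    define J where "J \<tau> = (LINT x|circ. sqrt (\<epsilon>\<^sup>2 + (w1 \<tau> x)\<^sup>2))" for \<tau>
    define K where "K = \<epsilon> * M\<^sup>2 / (4 * \<nu>)"
    have ii: "integrable circ (\<lambda>x. sqrt (\<epsilon>\<^sup>2 + (w1 \<tau> x)\<^sup>2))" "integrable circ (\<lambda>x. \<bar>w1 \<tau> x\<bar>)" if "0 < \<tau>" for \<tau>
      by (intro circ_integrable_continuous continuous_intros cont_x that)+
    have "J t - K * t \<le> J s - K * s"
    proof (rule DERIV_nonpos_imp_nonincreasing[OF s(2), of "\<lambda>\<tau>. J \<tau> - K * \<tau>"])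
      fix \<tau> assume \<tau>: "s \<le> \<tau>" "\<tau> \<le> t"
      then obtain D where D: "(J has_real_derivative D) (at \<tau>)" "D \<le> K"
        using regularized_variation_derivative[of \<tau> \<epsilon> M] M e s unfolding J_def[abs_def] K_def by auto
      have "((\<lambda>\<tau>. J \<tau> - K * \<tau>) has_real_derivative D - K) (at \<tau>)"
        by (auto intro!: derivative_eq_intros D)
      then show "\<exists>y. ((\<lambda>\<tau>. J \<tau> - K * \<tau>) has_real_derivative y) (at \<tau>) \<and> y \<le> 0" using D by force
    qed
    moreover have "(LINT x|circ. \<bar>w1 t x\<bar>) \<le> J t"
      unfolding J_def by (intro circ_integral_mono ii t) (simp add: real_le_rsqrt)
    moreover have "J s \<le> (LINT x|circ. \<epsilon> + \<bar>w1 s x\<bar>)"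
      unfolding J_def using e s ii(2)[OF s(1)]
      by (intro circ_integral_mono ii) (auto intro!: real_le_lsqrt simp: power2_sum)
    moreover have "(LINT x|circ. \<epsilon> + \<bar>w1 s x\<bar>) = \<epsilon> + (LINT x|circ. \<bar>w1 s x\<bar>)"
      using ii(2)[OF s(1)] by simp
    moreover have "c * \<epsilon> = \<epsilon> + (K * t - K * s)" by (simp add: c_def K_def algebra_simps diff_divide_distrib)
    ultimately show ?thesis by linarith
  qed
  show ?thesis
  proof (rule field_le_epsilon)
    fix e :: real assume "0 < e"
    then show "(LINT x|circ. \<bar>w1 t x\<bar>) \<le> (LINT x|circ. \<bar>w1 s x\<bar>) + e"
      using main[of "e / c"] c by simp
  qed
qed

section \<open>The energy inequality\<close>

definition energy :: "real \<Rightarrow> real" where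
  "energy t = (LINT x|circ. (w1 t x)\<^sup>2)"

text \<open>The nonlinear terms combine to - (w v^2)_x - v^3 for v = w_x, so after integration only
  one third-order term remains; the viscous term is integrated by parts.\<close>

lemma energy_derivative:
  assumes t: "0 < t"
  shows "(energy has_real_derivative
    - 2 * \<nu> * (LINT x|circ. (w2 t x)\<^sup>2) - (LINT x|circ. (w1 t x) ^ 3)) (at t)"
proof -
  define F where "F \<tau> x = 2 * w1 \<tau> x * (\<nu> * w3 \<tau> x - (w1 \<tau> x)\<^sup>2 - w \<tau> x * w2 \<tau> x)" for \<tau> x
  have deriv: "(energy has_real_derivative integral\<^sup>L circ (F t)) (at t)"
    unfolding energy_def[abs_def]
  proof (rule circ_integral_has_dt[of "t/2"])
    show "((\<lambda>t. (w1 t x)\<^sup>2) has_real_derivative F \<tau> x) (at \<tau>)" if "\<tau> \<in> cball t (t/2)" for \<tau> x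
      using cball_pos[OF t that] unfolding F_def
      by (auto intro!: derivative_eq_intros dt)
    show "continuous_on (cball t (t/2) \<times> {0..1}) (\<lambda>p. F (fst p) (snd p))"
      unfolding F_def by (intro continuous_intros cont_cball t)
    show "continuous_on {0..1} (\<lambda>x. (w1 \<tau> x)\<^sup>2)" if "\<tau> \<in> cball t (t/2)" for \<tau>
      by (intro continuous_intros cont_x cball_pos[OF t that])
  qed (use t in simp)
  have "(LINT x|circ. F t x + 2 * \<nu> * (w2 t x)\<^sup>2 + (w1 t x) ^ 3) =
    (2 * \<nu> * w1 t 1 * w2 t 1 - w t 1 * (w1 t 1)\<^sup>2) - (2 * \<nu> * w1 t 0 * w2 t 0 - w t 0 * (w1 t 0)\<^sup>2)"
  proof (rule circ_integral_FTC)
    show "continuous_on {0..1} (\<lambda>x. F t x + 2 * \<nu> * (w2 t x)\<^sup>2 + (w1 t x) ^ 3)"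
      unfolding F_def by (intro continuous_intros cont_x t)
    show "((\<lambda>x. 2 * \<nu> * w1 t x * w2 t x - w t x * (w1 t x)\<^sup>2) has_real_derivative
      F t x + 2 * \<nu> * (w2 t x)\<^sup>2 + (w1 t x) ^ 3) (at x)" for x
      unfolding F_def
      by (rule derivative_eq_intros dx t refl)+ (simp add: algebra_simps power2_eq_square power3_eq_cube)
  qed
  also have "\<dots> = 0" using end_eq[OF t] by simp
  also have "(LINT x|circ. F t x + 2 * \<nu> * (w2 t x)\<^sup>2 + (w1 t x) ^ 3) =
    integral\<^sup>L circ (F t) + 2 * \<nu> * (LINT x|circ. (w2 t x)\<^sup>2) + (LINT x|circ. (w1 t x) ^ 3)"
  proof -
    have "integrable circ (F t)" "integrable circ (\<lambda>x. 2 * \<nu> * (w2 t x)\<^sup>2)" "integrable circ (\<lambda>x. (w1 t x) ^ 3)"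
      unfolding F_def by (intro circ_integrable_continuous continuous_intros cont_x t)+
    then show ?thesis by simp
  qed
  finally have "integral\<^sup>L circ (F t) = - 2 * \<nu> * (LINT x|circ. (w2 t x)\<^sup>2) - (LINT x|circ. (w1 t x) ^ 3)"
    by simp
  then show ?thesis using deriv by simp
qed

lemma gradient_sup_bound:
  assumes t: "0 < t" and x: "x \<in> {0..1}"
  shows "(w1 t x)\<^sup>2 \<le> 2 * (LINT x|circ. \<bar>w1 t x * w2 t x\<bar>)"
proof -
  \<comment> \<open>Rolle's theorem for the periodic function w yields the zero of w_x from which
    (w_x)^2 is integrated.\<close>
  have "\<exists>z. 0 < z \<and> z < 1 \<and> (*) (w1 t z) = (\<lambda>v. 0)"
    by (rule Rolle_deriv[of 0 1 "w t"])
       (use t end_eq[OF t] cont_x[OF t] dx(1)[OF t] in \<open>auto simp: has_field_derivative_def\<close>)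
  then obtain z where z: "0 < z" "z < 1" "w1 t z = 0" by (metis mult_1_right)
  define f where "f y = 2 * w1 t y * w2 t y" for y
  have fc: "continuous_on S f" for S unfolding f_def by (intro continuous_intros cont_x t)
  have fd: "((\<lambda>y. (w1 t y)\<^sup>2) has_real_derivative f y) (at y within S)" for y S
  proof (rule has_field_derivative_at_within)
    show "((\<lambda>y. (w1 t y)\<^sup>2) has_real_derivative f y) (at y)"
      unfolding f_def by (rule derivative_eq_intros dx t refl)+ simp
  qed
  have I: "\<bar>(w1 t b)\<^sup>2 - (w1 t a)\<^sup>2\<bar> \<le> (LINT y|circ. \<bar>f y\<bar>)" if ab: "0 \<le> a" "a \<le> b" "b \<le> 1" for a b
  proof -
    have "(f has_integral ((w1 t b)\<^sup>2 - (w1 t a)\<^sup>2)) {a..b}"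
      using ab by (intro fundamental_theorem_of_calculus) (auto simp: fd simp flip: has_real_derivative_iff_has_vector_derivative)
    then have "(w1 t b)\<^sup>2 - (w1 t a)\<^sup>2 = integral {a..b} f" by (simp add: integral_unique)
    also have "\<bar>\<dots>\<bar> \<le> integral {a..b} (\<lambda>y. \<bar>f y\<bar>)"
      using integral_norm_bound_integral[of f "{a..b}" "\<lambda>y. \<bar>f y\<bar>"]
      by (simp add: integrable_continuous_real fc continuous_on_rabs)
    also have "\<dots> \<le> integral {0..1} (\<lambda>y. \<bar>f y\<bar>)"
      using ab by (intro integral_subset_le integrable_continuous_real continuous_intros fc) auto
    also have "\<dots> = (LINT y|circ. \<bar>f y\<bar>)"
      by (intro circ_integral_HK[symmetric] circ_integrable_continuous continuous_intros fc)
    finally show ?thesis .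
  qed
  have "(w1 t x)\<^sup>2 \<le> (LINT y|circ. \<bar>f y\<bar>)"
    using I[of z x] I[of x z] x z by (cases "x \<le> z") auto
  also have "\<dots> = 2 * (LINT x|circ. \<bar>w1 t x * w2 t x\<bar>)"
    by (simp add: f_def abs_mult mult.assoc)
  finally show ?thesis .
qed

text \<open>The 54 is calibrated to the L^1 bound 3. With E^3 \<le> 324 D, the remaining inequality
  9 E / \<nu> \<le> \<nu> D holds as soon as (\<nu> E)^2 \<ge> 9 * 324 = 54^2.\<close>

lemma energy_derivative_nonpos:
  assumes t: "0 < t" and L1: "(LINT x|circ. \<bar>w1 t x\<bar>) \<le> 3" and E: "54 / \<nu> \<le> energy t"
  shows "- 2 * \<nu> * (LINT x|circ. (w2 t x)\<^sup>2) - (LINT x|circ. (w1 t x) ^ 3) \<le> 0"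
proof -
  define B where "B = 2 * (LINT x|circ. \<bar>w1 t x * w2 t x\<bar>)"
  define D where "D = (LINT x|circ. (w2 t x)\<^sup>2)"
  have Epos: "0 < energy t" using E nu by (smt (verit) divide_pos_pos)
  have vB: "(w1 t x)\<^sup>2 \<le> B" if "x \<in> {0..1}" for x using gradient_sup_bound[OF t that] by (simp add: B_def)
  have B0: "0 \<le> B" using vB[of 0] by (smt (verit) zero_le_power2 atLeastAtMost_iff)
  have i: "integrable circ (\<lambda>x. \<bar>w1 t x\<bar>)" "integrable circ (\<lambda>x. (w1 t x)\<^sup>2)" "integrable circ (\<lambda>x. (w2 t x)\<^sup>2)"
    "integrable circ (\<lambda>x. \<bar>w1 t x * w2 t x\<bar>)" "integrable circ (\<lambda>x. (w1 t x) ^ 3)"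
    by (intro circ_integrable_continuous continuous_intros cont_x t)+
  have BaD: "B \<le> a * energy t + D / a" if a: "0 < a" for a
  proof -
    have "B = (LINT x|circ. 2 * \<bar>w1 t x * w2 t x\<bar>)" by (simp add: B_def)
    also have "\<dots> \<le> (LINT x|circ. a * (w1 t x)\<^sup>2 + (w2 t x)\<^sup>2 / a)"
    proof (rule circ_integral_mono)
      fix x
      have "2 * (a * \<bar>w1 t x\<bar>) * \<bar>w2 t x\<bar> \<le> (a * \<bar>w1 t x\<bar>)\<^sup>2 + \<bar>w2 t x\<bar>\<^sup>2" by (rule sum_squares_bound)
      then have "a * (2 * \<bar>w1 t x * w2 t x\<bar>) \<le> a * (a * (w1 t x)\<^sup>2 + (w2 t x)\<^sup>2 / a)"
        using a by (simp add: abs_mult power_mult_distrib distrib_left mult_ac power2_eq_square[of a])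
      then show "2 * \<bar>w1 t x * w2 t x\<bar> \<le> a * (w1 t x)\<^sup>2 + (w2 t x)\<^sup>2 / a" using a by simp
    qed (use i in auto)
    also have "\<dots> = a * energy t + D / a" using i by (simp add: energy_def D_def)
    finally show ?thesis .
  qed
  text \<open>Nash's inequality \<open>E\<^sup>3 \<le> 324 D\<close> comes from \<open>E\<^sup>2 \<le> 9 B\<close> and \<open>B \<le> a E + D / a\<close> with \<open>a = E / 18\<close>;
    the cubic term is then absorbed by the dissipation through the choice \<open>a = 3 / \<nu>\<close>.\<close>
  have EB: "(energy t)\<^sup>2 \<le> 9 * B"
  proof -
    have "energy t \<le> (LINT x|circ. sqrt B * \<bar>w1 t x\<bar>)"
      unfolding energy_def
    proof (rule circ_integral_mono)
      fix x :: real assume "x \<in> {0..1}"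
      then have "\<bar>w1 t x\<bar> \<le> sqrt B" using real_sqrt_le_mono[OF vB] by simp
      then have "\<bar>w1 t x\<bar> * \<bar>w1 t x\<bar> \<le> sqrt B * \<bar>w1 t x\<bar>" by (rule mult_right_mono) simp
      then show "(w1 t x)\<^sup>2 \<le> sqrt B * \<bar>w1 t x\<bar>" by (simp add: power2_eq_square)
    qed (use i in auto)
    also have "\<dots> = sqrt B * (LINT x|circ. \<bar>w1 t x\<bar>)" by simp
    also have "\<dots> \<le> sqrt B * 3" using L1 B0 by (intro mult_left_mono) auto
    finally have "(energy t)\<^sup>2 \<le> (sqrt B * 3)\<^sup>2" using Epos by (intro power_mono) auto
    then show ?thesis using B0 by (simp add: power_mult_distrib)
  qed
  have DE: "(energy t) ^ 3 \<le> 324 * D"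
  proof -
    have "(energy t)\<^sup>2 \<le> 9 * (energy t / 18 * energy t + D / (energy t / 18))"
      using EB BaD[of "energy t / 18"] Epos by simp
    then have "(energy t)\<^sup>2 * energy t \<le> 9 * (energy t / 18 * energy t + D / (energy t / 18)) * energy t"
      using Epos by (intro mult_right_mono) auto
    also have "\<dots> = (energy t)\<^sup>2 * energy t / 2 + 162 * D"
      using Epos by (simp add: field_simps power2_eq_square)
    finally show ?thesis by (simp add: power3_eq_cube power2_eq_square)
  qed
  have "- ((LINT x|circ. (w1 t x) ^ 3)) = (LINT x|circ. - ((w1 t x) ^ 3))" by simp
  also have "\<dots> \<le> (LINT x|circ. B * \<bar>w1 t x\<bar>)"
  proof (rule circ_integral_mono)
    fix x :: real assume "x \<in> {0..1}"
    then have "(w1 t x)\<^sup>2 * \<bar>w1 t x\<bar> \<le> B * \<bar>w1 t x\<bar>" using vB by (intro mult_right_mono) auto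
    moreover have "- ((w1 t x) ^ 3) \<le> (w1 t x)\<^sup>2 * \<bar>w1 t x\<bar>"
    proof -
      have "- ((w1 t x) ^ 3) = (w1 t x)\<^sup>2 * (- w1 t x)" by (simp add: power2_eq_square power3_eq_cube)
      also have "\<dots> \<le> (w1 t x)\<^sup>2 * \<bar>w1 t x\<bar>" by (intro mult_left_mono) auto
      finally show ?thesis .
    qed
    ultimately show "- ((w1 t x) ^ 3) \<le> B * \<bar>w1 t x\<bar>" by linarith
  qed (use i in auto)
  also have "\<dots> \<le> B * 3" using L1 B0 by (simp add: mult_left_mono)
  also have "\<dots> \<le> 3 * (3 / \<nu> * energy t + D / (3 / \<nu>))" using BaD[of "3 / \<nu>"] nu by simp
  also have "\<dots> = 9 * energy t / \<nu> + \<nu> * D" using nu by (simp add: field_simps)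
  also have "9 * energy t / \<nu> \<le> \<nu> * D"
  proof -
    have "54 \<le> \<nu> * energy t" using E nu by (simp add: divide_le_eq mult.commute)
    then have "54\<^sup>2 \<le> (\<nu> * energy t)\<^sup>2" by (intro power_mono) auto
    then have "54\<^sup>2 * energy t \<le> (\<nu> * energy t)\<^sup>2 * energy t" using Epos by (intro mult_right_mono) auto
    also have "\<dots> = \<nu>\<^sup>2 * (energy t) ^ 3" by (simp add: power_mult_distrib power2_eq_square power3_eq_cube)
    also have "\<dots> \<le> \<nu>\<^sup>2 * (324 * D)" using DE by (intro mult_left_mono) auto
    finally have "9 * energy t \<le> \<nu> * D * \<nu>" by (simp add: power2_eq_square mult_ac)
    then show ?thesis using nu by (simp add: divide_le_eq)
  qed
  finally show ?thesis by (simp add: D_def)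
qed

text \<open>A barrier argument from the last time r at which the energy is at most M. After r the
  energy exceeds the threshold and cannot increase, so at time t it is still at most its value at
  r.\<close>

lemma energy_le:
  assumes s: "0 < s" "s \<le> t" and E: "energy s \<le> M" and M: "54 / \<nu> \<le> M"
    and L1: "\<And>\<tau>. s \<le> \<tau> \<Longrightarrow> \<tau> \<le> t \<Longrightarrow> (LINT x|circ. \<bar>w1 \<tau> x\<bar>) \<le> 3"
  shows "energy t \<le> M"
proof (rule ccontr)
  assume neg: "\<not> energy t \<le> M"
  have Ec: "continuous_on {a..b} energy" if "0 < a" for a b
    using DERIV_isCont[OF energy_derivative] that by (intro continuous_at_imp_continuous_on ballI) simp
  have "closed (energy -` {..M} \<inter> {s..t})"
    using continuous_on_closed_vimage[of "{s..t}" energy] Ec[OF s(1), of t] by blast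
  then have "compact ({s..t} \<inter> energy -` {..M})"
    by (metis Int_commute bounded_Int bounded_closed_interval compact_eq_bounded_closed)
  moreover have "s \<in> {s..t} \<inter> energy -` {..M}" using s E by simp
  ultimately obtain r where r: "r \<in> {s..t} \<inter> energy -` {..M}"
    "\<forall>\<tau>\<in>{s..t} \<inter> energy -` {..M}. \<tau> \<le> r"
    using compact_attains_sup by blast
  have "energy t \<le> energy r"
  proof (rule DERIV_nonpos_imp_decreasing_open[of r t energy])
    show "r \<le> t" using r by simp
    show "continuous_on {r..t} energy" by (rule Ec) (use r s in auto)
    fix \<tau> assume \<tau>: "r < \<tau>" "\<tau> < t"
    have "\<not> energy \<tau> \<le> M"
    proof
      assume "energy \<tau> \<le> M"
      then have "\<tau> \<in> {s..t} \<inter> energy -` {..M}" using \<tau> r(1) by simp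
      then show False using r(2) \<tau>(1) by (meson not_le)
    qed
    then have "54 / \<nu> \<le> energy \<tau>" using M by simp
    moreover have "0 < \<tau>" "(LINT x|circ. \<bar>w1 \<tau> x\<bar>) \<le> 3" using \<tau> r(1) s L1[of \<tau>] by auto
    ultimately show "\<exists>y. (energy has_real_derivative y) (at \<tau>) \<and> y \<le> 0"
      using energy_derivative energy_derivative_nonpos by blast
  qed
  then show False using neg r(1) by simp
qed

text \<open>Integrating |v| \<le> (1 + v^2)/2 turns the energy bound 5 at the starting time into the
  L^1 bound 3, which then persists. M is only required to exist.\<close>

lemma gradient_bound:
  assumes s: "0 < s" "s \<le> t" and E: "energy s \<le> 5" and M: "\<And>\<tau> x. s \<le> \<tau> \<Longrightarrow> \<tau> \<le> t \<Longrightarrow> \<bar>w \<tau> x\<bar> \<le> M"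
  shows "energy t \<le> 5 + 54 / \<nu>"
proof (rule energy_le[OF s])
  have "(LINT x|circ. \<bar>w1 s x\<bar>) \<le> (LINT x|circ. (1 + (w1 s x)\<^sup>2) / 2)"
  proof (rule circ_integral_mono)
    fix x
    have "2 * 1 * \<bar>w1 s x\<bar> \<le> 1\<^sup>2 + \<bar>w1 s x\<bar>\<^sup>2" by (rule sum_squares_bound)
    then show "\<bar>w1 s x\<bar> \<le> (1 + (w1 s x)\<^sup>2) / 2" by simp
  qed (auto intro!: circ_integrable_continuous continuous_intros cont_x s)
  also have "\<dots> = (1 + energy s) / 2"
    using circ_integrable_continuous[of "\<lambda>x. (w1 s x)\<^sup>2"] cont_x(2)[OF s(1)]
    by (simp add: energy_def continuous_on_power)
  also have "\<dots> \<le> 3" using E by simp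
  finally have 3: "(LINT x|circ. \<bar>w1 s x\<bar>) \<le> 3" .
  show "(LINT x|circ. \<bar>w1 \<tau> x\<bar>) \<le> 3" if "s \<le> \<tau>" "\<tau> \<le> t" for \<tau>
    by (rule order_trans[OF variation_nonincreasing[OF s(1) that(1), of M] 3]) (use M that in auto)
  show "energy s \<le> 5 + 54 / \<nu>" "54 / \<nu> \<le> 5 + 54 / \<nu>" using E nu by (simp_all add: add_increasing2)
qed

end

section \<open>Mild solutions\<close>

lemma set_integral_powr_endpoint:
  fixes t a :: real
  assumes t: "0 < t" and a: "-1 < a" "a < 0"
  shows "set_integrable lborel {0<..<t} (\<lambda>s. (t - s) powr a)"
    "(LINT s:{0<..<t}|lborel. (t - s) powr a) = t powr (a + 1) / (a + 1)"
proof -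
  let ?F = "\<lambda>s. - ((t - s) powr (a + 1) / (a + 1))"
  have d: "(?F has_real_derivative (t - s) powr a) (at s)" if "ereal 0 < ereal s" "ereal s < ereal t" for s
    using that a by (auto intro!: derivative_eq_intros)
  have c: "isCont (\<lambda>s. (t - s) powr a) s" if "ereal 0 < ereal s" "ereal s < ereal t" for s
    using that by (intro continuous_intros) auto
  have lim0: "((?F \<circ> real_of_ereal) \<longlongrightarrow> - (t powr (a + 1) / (a + 1))) (at_right (ereal 0))"
    unfolding ereal_tendsto_simps1
  proof (rule tendsto_mono[OF at_le])
    have "(?F \<longlongrightarrow> - ((t - 0) powr (a + 1) / (a + 1))) (at 0)"
      using t a by (intro tendsto_intros) auto
    then show "(?F \<longlongrightarrow> - (t powr (a + 1) / (a + 1))) (at 0)" by simp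
  qed simp
  have lim1: "((?F \<circ> real_of_ereal) \<longlongrightarrow> 0) (at_left (ereal t))"
    unfolding ereal_tendsto_simps1
  proof -
    have "((\<lambda>s. t - s) \<longlongrightarrow> t - t) (at_left t)" by (intro tendsto_intros)
    then have "((\<lambda>s. (t - s) powr (a + 1)) \<longlongrightarrow> 0 powr (a + 1)) (at_left t)"
      using a by (intro tendsto_powr2) (auto simp: eventually_at_left_field intro!: exI[of _ "t - 1"])
    then have "((\<lambda>s. (t - s) powr (a + 1)) \<longlongrightarrow> 0) (at_left t)" by simp
    from tendsto_minus[OF tendsto_divide[OF this tendsto_const, of "a + 1"]] a
    show "(?F \<longlongrightarrow> 0) (at_left t)" by simp
  qed
  have e: "einterval (ereal 0) (ereal t) = {0<..<t}" by (auto simp: einterval_def)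
  have 0: "ereal 0 < ereal t" using t by simp
  note * = interval_integral_FTC_nonneg[OF 0 d c _ lim0 lim1]
  show "set_integrable lborel {0<..<t} (\<lambda>s. (t - s) powr a)"
    using *(1) by (simp add: e)
  show "(LINT s:{0<..<t}|lborel. (t - s) powr a) = t powr (a + 1) / (a + 1)"
    using *(2) t by (simp add: e interval_lebesgue_integral_def)
qed

text \<open>Young's inequality for convolutions with a constant independent of time, point and
  function; its rate is integrable in time.\<close>

lemma heat_conv_1_bound:
  obtains C where "0 < C" "\<And>t f B x. 0 < t \<Longrightarrow> f \<in> borel_measurable circ \<Longrightarrow>
    (\<And>y. y \<in> {0..1} \<Longrightarrow> \<bar>f y\<bar> \<le> B) \<Longrightarrow> \<bar>heat_conv 1 t f x\<bar> \<le> C * t powr (- 7/8) * B"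
proof -
  obtain C where C: "0 < C" "\<And>t x. 0 < t \<Longrightarrow>
    (LINT y|circ. \<bar>heat_kernel_dx 1 t (x - y)\<bar>) \<le> C * t powr (- 7/8)"
    using heat_kernel_dx_1_L1 by blast
  have "\<bar>heat_conv 1 t f x\<bar> \<le> C * t powr (- 7/8) * B"
    if t: "0 < t" and f: "f \<in> borel_measurable circ" "\<And>y. y \<in> {0..1} \<Longrightarrow> \<bar>f y\<bar> \<le> B" for t f B x
  proof -
    have B: "0 \<le> B" using f(2)[of 0] by force
    have fi: "integrable circ f" by (rule circ_integrable_bounded[OF f])
    have ki: "integrable circ (\<lambda>y. \<bar>heat_kernel_dx 1 t (x - y)\<bar>)"
      using t by (auto intro!: circ_integrable_continuous continuous_intros)
    have "\<bar>heat_conv 1 t f x\<bar> \<le> (LINT y|circ. \<bar>heat_kernel_dx 1 t (x - y) * f y\<bar>)"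
      unfolding heat_conv_def
      using integral_norm_bound[of circ "\<lambda>y. heat_kernel_dx 1 t (x - y) * f y"] by simp
    also have "\<dots> \<le> (LINT y|circ. B * \<bar>heat_kernel_dx 1 t (x - y)\<bar>)"
    proof (rule circ_integral_mono)
      show "integrable circ (\<lambda>y. \<bar>heat_kernel_dx 1 t (x - y) * f y\<bar>)"
        by (rule integrable_abs[OF heat_kernel_integrable_mult[OF t fi]])
      show "integrable circ (\<lambda>y. B * \<bar>heat_kernel_dx 1 t (x - y)\<bar>)" using ki by simp
      show "\<bar>heat_kernel_dx 1 t (x - y) * f y\<bar> \<le> B * \<bar>heat_kernel_dx 1 t (x - y)\<bar>" if "y \<in> {0..1}" for y
        using mult_right_mono[OF f(2)[OF that], of "\<bar>heat_kernel_dx 1 t (x - y)\<bar>"] by (simp add: abs_mult mult.commute)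
    qed
    also have "\<dots> = B * (LINT y|circ. \<bar>heat_kernel_dx 1 t (x - y)\<bar>)" by simp
    also have "\<dots> \<le> B * (C * t powr (- 7/8))" using C(2)[OF t, of x] B by (intro mult_left_mono)
    finally show ?thesis by (simp add: mult_ac)
  qed
  with C(1) show ?thesis by (rule that)
qed

lemma space_time_section_measurable:
  assumes f: "set_borel_measurable borel ({0<..} \<times> UNIV) (\<lambda>(t, x). f t x :: real)" and s: "0 < (s::real)"
  shows "f s \<in> borel_measurable (borel :: real measure)"
proof -
  have "(\<lambda>y::real. (s, y)) \<in> borel_measurable borel"
    using borel_measurable_Pair[of "\<lambda>_. s" borel "\<lambda>y. y"] by simp
  from measurable_compose[OF this f[unfolded set_borel_measurable_def]]
  show ?thesis using s by (simp add: indicator_def)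
qed

lemma space_time_square_measurable:
  assumes "set_borel_measurable borel ({0<..} \<times> UNIV) (\<lambda>(t, x). f t x :: real)"
  shows "set_borel_measurable borel ({0<..} \<times> UNIV) (\<lambda>(t, x). 1/2 * (f t x)\<^sup>2)"
proof -
  have "(\<lambda>p. indicator ({0<..} \<times> UNIV) p *\<^sub>R (case p of (t, x) \<Rightarrow> 1/2 * (f t x)\<^sup>2)) =
    (\<lambda>p. 1/2 * (indicator ({0<..} \<times> UNIV) p *\<^sub>R (case p of (t, x) \<Rightarrow> f t x))\<^sup>2)"
    by (auto simp: indicator_def)
  then show ?thesis using assms unfolding set_borel_measurable_def by simp
qed

text \<open>Measurability in s holds for an integral of a jointly measurable function of (s, y);
  integrability follows from the rate of the kernel gradient.\<close>

lemma duhamel_integrable: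
  assumes f: "set_borel_measurable borel ({0<..} \<times> UNIV) (\<lambda>(t, x). f t x :: real)"
    and t: "0 < t" and nu: "0 < \<nu>" and B: "\<And>s y. 0 < s \<Longrightarrow> s < t \<Longrightarrow> \<bar>f s y\<bar> \<le> B"
  shows "set_integrable lborel {0<..<t} (\<lambda>s. heat_conv 1 (\<nu> * (t - s)) (f s) x)"
proof -
  obtain C where C: "0 < C" "\<And>t f B x. 0 < t \<Longrightarrow> f \<in> borel_measurable circ \<Longrightarrow>
    (\<And>y. y \<in> {0..1} \<Longrightarrow> \<bar>f y\<bar> \<le> B) \<Longrightarrow> \<bar>heat_conv 1 t f x\<bar> \<le> C * t powr (- 7/8) * B"
    using heat_conv_1_bound by blast
  \<comment> \<open>Joint measurability is given for positive times only. Extending by zero changes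
    nothing on the interval of integration.\<close>
  define g where "g p = indicator ({0<..} \<times> UNIV) p *\<^sub>R (case p of (t, x) \<Rightarrow> f t x)" for p
  have g: "g \<in> borel_measurable borel" using f unfolding set_borel_measurable_def g_def[abs_def] .
  have id: "(\<lambda>x. x) \<in> borel_measurable circ" by (rule measurable_circ) simp
  have fst': "fst \<in> borel_measurable ((borel :: real measure) \<Otimes>\<^sub>M circ)" by simp
  have snd': "snd \<in> borel_measurable ((borel :: real measure) \<Otimes>\<^sub>M circ)" by (rule measurable_compose[OF measurable_snd id])
  have "(\<lambda>p. (fst p, snd p)) \<in> borel_measurable ((borel :: real measure) \<Otimes>\<^sub>M circ)"
    by (intro borel_measurable_Pair fst' snd')
  from measurable_compose[OF this g] have g': "g \<in> borel_measurable (borel \<Otimes>\<^sub>M circ)" by simp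
  have "(\<lambda>p. heat_kernel_dx 1 (\<nu> * (t - fst p)) (x - snd p) * g p) \<in> borel_measurable (borel \<Otimes>\<^sub>M circ)"
    using fst' snd' g' by (intro borel_measurable_times measurable_heat_kernel_dx borel_measurable_diff) auto
  then have "(\<lambda>(s, y). heat_kernel_dx 1 (\<nu> * (t - s)) (x - y) * g (s, y)) \<in> borel_measurable (borel \<Otimes>\<^sub>M circ)"
    by (simp add: case_prod_beta')
  then have m: "(\<lambda>s. (LINT y|circ. heat_kernel_dx 1 (\<nu> * (t - s)) (x - y) * g (s, y))) \<in> borel_measurable borel"
    by (rule circ.borel_measurable_lebesgue_integral)
  have eq: "indicator {0<..<t} s *\<^sub>R heat_conv 1 (\<nu> * (t - s)) (f s) x =
    indicator {0<..<t} s *\<^sub>R (LINT y|circ. heat_kernel_dx 1 (\<nu> * (t - s)) (x - y) * g (s, y))" for s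
    by (auto simp: indicator_def heat_conv_def g_def)
  have m': "(\<lambda>s. indicator {0<..<t} s *\<^sub>R heat_conv 1 (\<nu> * (t - s)) (f s) x) \<in> borel_measurable lborel"
    unfolding eq using m by (intro borel_measurable_scaleR) auto
  show ?thesis
    unfolding set_integrable_def
  proof (rule Bochner_Integration.integrable_bound[OF _ m'])
    have "set_integrable lborel {0<..<t} (\<lambda>s. C * \<nu> powr (-7/8) * B * (t - s) powr (-7/8))"
      using set_integral_powr_endpoint(1)[OF t, of "-7/8"] by simp
    then show "integrable lborel (\<lambda>s. indicator {0<..<t} s *\<^sub>R (C * \<nu> powr (-7/8) * B * (t - s) powr (-7/8)))"
      by (simp add: set_integrable_def)
    show "AE s in lborel. norm (indicator {0<..<t} s *\<^sub>R heat_conv 1 (\<nu> * (t - s)) (f s) x) \<le>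
       norm (indicator {0<..<t} s *\<^sub>R (C * \<nu> powr (-7/8) * B * (t - s) powr (-7/8)))"
    proof (rule AE_I2)
      fix s
      show "norm (indicator {0<..<t} s *\<^sub>R heat_conv 1 (\<nu> * (t - s)) (f s) x) \<le>
         norm (indicator {0<..<t} s *\<^sub>R (C * \<nu> powr (-7/8) * B * (t - s) powr (-7/8)))"
      proof (cases "s \<in> {0<..<t}")
        case True
        then have s: "0 < s" "s < t" by auto
        have "\<bar>heat_conv 1 (\<nu> * (t - s)) (f s) x\<bar> \<le> C * (\<nu> * (t - s)) powr (-7/8) * B"
          using s nu B by (intro C measurable_circ space_time_section_measurable[OF f]) auto
        also have "\<dots> = C * \<nu> powr (-7/8) * B * (t - s) powr (-7/8)"
          using s nu by (simp add: powr_mult)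
        finally show ?thesis using True by simp
      qed simp
    qed
  qed
qed

text \<open>The exponent 1/16 is half of the margin 1 - 7/8. Adding it to the kernel singularity
  gives 15/16, which is still integrable, and it leaves a factor \<kappa>^(-1/16) that is small for
  large \<kappa>.\<close>

lemma exp_minus_le_powr:
  assumes "0 < (y::real)" shows "exp (- y) \<le> y powr (-1/16)"
proof -
  have "y powr (1/16) \<le> 1 + y"
  proof (cases "y \<le> 1")
    case True
    then have "y powr (1/16) \<le> 1 powr (1/16)" using assms by (intro powr_mono2) auto
    then show ?thesis using assms by simp
  next
    case False
    then have "y powr (1/16) \<le> y powr 1" by (intro powr_mono) auto
    then show ?thesis using False by simp
  qed
  also have "\<dots> \<le> exp y" by (rule exp_ge_add_one_self)
  finally have "1 / exp y \<le> 1 / y powr (1/16)" using assms by (intro divide_left_mono) auto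
  then show ?thesis by (simp add: exp_minus powr_minus_divide inverse_eq_divide)
qed

text \<open>In the norm weighted by \<open>exp(-\<kappa>t)\<close> the Duhamel map is a contraction for large \<open>\<kappa>\<close>.\<close>

lemma mild_solution_unique:
  assumes nu: "0 < \<nu>" and T: "0 < T"
    and f: "set_borel_measurable borel ({0<..} \<times> UNIV) (\<lambda>(t, x). f t x :: real)"
    and g: "set_borel_measurable borel ({0<..} \<times> UNIV) (\<lambda>(t, x). g t x :: real)"
    and fM: "\<And>t x. 0 < t \<Longrightarrow> t < T \<Longrightarrow> \<bar>f t x\<bar> \<le> M" and gM: "\<And>t x. 0 < t \<Longrightarrow> t < T \<Longrightarrow> \<bar>g t x\<bar> \<le> M"
    and f_mild: "\<And>t x. 0 < t \<Longrightarrow> t < T \<Longrightarrow> f t x = h t x -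
      (LINT s:{0<..<t}|lborel. heat_conv 1 (\<nu> * (t - s)) (\<lambda>y. 1/2 * (f s y)\<^sup>2) x)"
    and g_mild: "\<And>t x. 0 < t \<Longrightarrow> t < T \<Longrightarrow> g t x = h t x -
      (LINT s:{0<..<t}|lborel. heat_conv 1 (\<nu> * (t - s)) (\<lambda>y. 1/2 * (g s y)\<^sup>2) x)"
    and t: "0 < t" "t < T"
  shows "f t x = g t x"
proof -
  obtain C where C: "0 < C" "\<And>t f B x. 0 < t \<Longrightarrow> f \<in> borel_measurable circ \<Longrightarrow>
    (\<And>y. y \<in> {0..1} \<Longrightarrow> \<bar>f y\<bar> \<le> B) \<Longrightarrow> \<bar>heat_conv 1 t f x\<bar> \<le> C * t powr (- 7/8) * B"
    using heat_conv_1_bound by blast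
  have M: "0 \<le> M" using fM[of "T/2" 0] T by force
  have sq_bound: "\<bar>1/2 * z\<^sup>2\<bar> \<le> M\<^sup>2" if "\<bar>z\<bar> \<le> M" for z :: real
  proof -
    have "z\<^sup>2 \<le> M\<^sup>2" using that by (metis abs_ge_zero power2_abs power_mono)
    then have "1/2 * z\<^sup>2 \<le> M\<^sup>2" using zero_le_power2[of M] by linarith
    then show ?thesis by simp
  qed
  \<comment> \<open>Collects the contraction constant apart from the power of \<kappa>; 16 T^(1/16)
    bounds the integral of (t - s)^(-15/16).\<close>
  define K where "K = C * \<nu> powr (-7/8) * M * (16 * T powr (1/16))"
  have K: "0 \<le> K" using C M by (simp add: K_def)
  \<comment> \<open>Its power -1/16 is 1 / (2 K + 1), so the contraction factor is at most
    1/2.\<close>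
  define \<kappa> where "\<kappa> = (2 * K + 1) powr 16"
  have \<kappa>: "0 < \<kappa>" "K * \<kappa> powr (-1/16) \<le> 1/2"
  proof -
    show "0 < \<kappa>" using K by (simp add: \<kappa>_def)
    have "\<kappa> powr (-1/16) = inverse (2 * K + 1)"
    proof -
      have "\<kappa> powr (-1/16) = (2 * K + 1) powr (16 * (-1/16))" unfolding \<kappa>_def by (rule powr_powr)
      also have "16 * (-1/16) = - (1::real)" by simp
      finally show ?thesis using K by (simp only: powr_minus) simp
    qed
    moreover have "K * inverse (2 * K + 1) \<le> 1/2" using K by (simp add: field_simps)
    ultimately show "K * \<kappa> powr (-1/16) \<le> 1/2" by (simp only:)
  qed
  have step: "\<bar>f t x - g t x\<bar> \<le> (B / 2) * exp (\<kappa> * t)"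
    if IH: "\<And>s y. 0 < s \<Longrightarrow> s < T \<Longrightarrow> \<bar>f s y - g s y\<bar> \<le> B * exp (\<kappa> * s)" and t: "0 < t" "t < T" for B t x
  proof -
    have B: "0 \<le> B"
    proof -
      have "0 \<le> B * exp (\<kappa> * t)" using IH[OF t, of 0] by (rule order_trans[OF abs_ge_zero])
      then show ?thesis by (simp add: zero_le_mult_iff)
    qed
    let ?hf = "\<lambda>s. heat_conv 1 (\<nu> * (t - s)) (\<lambda>y. 1/2 * (f s y)\<^sup>2) x"
    let ?hg = "\<lambda>s. heat_conv 1 (\<nu> * (t - s)) (\<lambda>y. 1/2 * (g s y)\<^sup>2) x"
    have if': "set_integrable lborel {0<..<t} ?hf"
      using t by (intro duhamel_integrable[OF space_time_square_measurable[OF f] t(1) nu, of "M\<^sup>2"] sq_bound fM) auto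
    have ig: "set_integrable lborel {0<..<t} ?hg"
      using t by (intro duhamel_integrable[OF space_time_square_measurable[OF g] t(1) nu, of "M\<^sup>2"] sq_bound gM) auto
    define D where "D s = ?hf s - ?hg s" for s
    have D: "set_integrable lborel {0<..<t} D"
      using set_integral_diff(1)[OF if' ig] by (simp only: D_def[abs_def])
    have "f t x - g t x = - (LINT s:{0<..<t}|lborel. D s)"
      unfolding D_def using f_mild[OF t, of x] g_mild[OF t, of x] set_integral_diff(2)[OF if' ig] by simp
    then have "\<bar>f t x - g t x\<bar> = \<bar>LINT s:{0<..<t}|lborel. D s\<bar>" by (simp only: abs_minus_cancel)
    also have "\<dots> \<le> (LINT s:{0<..<t}|lborel. \<bar>D s\<bar>)"
      using set_integral_norm_bound[OF D] by (simp only: real_norm_def)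
    also have "\<dots> \<le> (LINT s:{0<..<t}|lborel. C * \<nu> powr (-7/8) * M * B * \<kappa> powr (-1/16) * exp (\<kappa> * t) * (t - s) powr (-15/16))"
    proof (rule set_integral_mono)
      show "set_integrable lborel {0<..<t} (\<lambda>s. \<bar>D s\<bar>)" by (rule set_integrable_abs[OF D])
      show "set_integrable lborel {0<..<t}
         (\<lambda>s. C * \<nu> powr (-7/8) * M * B * \<kappa> powr (-1/16) * exp (\<kappa> * t) * (t - s) powr (-15/16))"
        using set_integral_powr_endpoint(1)[OF t(1), of "-15/16"] by simp
      fix s assume "s \<in> {0<..<t}"
      then have s: "0 < s" "s < t" "s < T" using t by auto
      have fm: "f s \<in> borel_measurable circ" "g s \<in> borel_measurable circ"
        using space_time_section_measurable f g s by (auto intro: measurable_circ)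
      have fi: "integrable circ (\<lambda>y. 1/2 * (f s y)\<^sup>2)" "integrable circ (\<lambda>y. 1/2 * (g s y)\<^sup>2)"
      proof -
        have "(\<lambda>y. 1/2 * (f s y)\<^sup>2) \<in> borel_measurable circ" using fm by measurable
        then show "integrable circ (\<lambda>y. 1/2 * (f s y)\<^sup>2)"
          by (rule circ_integrable_bounded) (rule sq_bound[OF fM[OF s(1,3)]])
        have "(\<lambda>y. 1/2 * (g s y)\<^sup>2) \<in> borel_measurable circ" using fm by measurable
        then show "integrable circ (\<lambda>y. 1/2 * (g s y)\<^sup>2)"
          by (rule circ_integrable_bounded) (rule sq_bound[OF gM[OF s(1,3)]])
      qed
      have "D s = heat_conv 1 (\<nu> * (t - s)) (\<lambda>y. 1/2 * (f s y)\<^sup>2 - 1/2 * (g s y)\<^sup>2) x"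
        unfolding D_def using s nu by (intro heat_conv_diff[symmetric] fi) auto
      moreover have "\<bar>heat_conv 1 (\<nu> * (t - s)) (\<lambda>y. 1/2 * (f s y)\<^sup>2 - 1/2 * (g s y)\<^sup>2) x\<bar> \<le> C * (\<nu> * (t - s)) powr (-7/8) * (M * (B * exp (\<kappa> * s)))"
      proof (rule C(2))
        show "0 < \<nu> * (t - s)" using s nu by simp
        show "(\<lambda>y. 1/2 * (f s y)\<^sup>2 - 1/2 * (g s y)\<^sup>2) \<in> borel_measurable circ" using fm by measurable
        fix y
        \<comment> \<open>The square is Lipschitz on bounded sets: the mean of the two solutions, at
          most M in absolute value, multiplies their difference.\<close>
        have "1/2 * (f s y)\<^sup>2 - 1/2 * (g s y)\<^sup>2 = (f s y + g s y) / 2 * (f s y - g s y)"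
          by (simp add: power2_eq_square field_simps)
        also have "\<bar>\<dots>\<bar> \<le> M * (B * exp (\<kappa> * s))"
          unfolding abs_mult using fM[OF s(1,3), of y] gM[OF s(1,3), of y] IH[OF s(1,3), of y] M
          by (intro mult_mono) auto
        finally show "\<bar>1/2 * (f s y)\<^sup>2 - 1/2 * (g s y)\<^sup>2\<bar> \<le> M * (B * exp (\<kappa> * s))" .
      qed
      ultimately have "\<bar>D s\<bar> \<le> C * (\<nu> * (t - s)) powr (-7/8) * (M * (B * exp (\<kappa> * s)))" by simp
      also have "\<dots> = C * \<nu> powr (-7/8) * M * B * exp (\<kappa> * t) * ((t - s) powr (-7/8) * exp (- (\<kappa> * (t - s))))"
      proof -
        have "exp (\<kappa> * s) = exp (\<kappa> * t) * exp (- (\<kappa> * (t - s)))"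
          by (simp add: algebra_simps flip: exp_add)
        then show ?thesis using s nu by (simp add: powr_mult mult_ac)
      qed
      also have "\<dots> \<le> C * \<nu> powr (-7/8) * M * B * exp (\<kappa> * t) * ((t - s) powr (-7/8) * (\<kappa> * (t - s)) powr (-1/16))"
        using s \<kappa> C(1) M B by (intro mult_left_mono exp_minus_le_powr mult_nonneg_nonneg) auto
      also have "(t - s) powr (-7/8) * (\<kappa> * (t - s)) powr (-1/16) = \<kappa> powr (-1/16) * (t - s) powr (-15/16)"
        using s \<kappa> by (simp add: powr_mult mult_ac flip: powr_add)
      finally show "\<bar>D s\<bar> \<le> C * \<nu> powr (-7/8) * M * B * \<kappa> powr (-1/16) * exp (\<kappa> * t) * (t - s) powr (-15/16)"
        by (simp add: mult_ac)
    qed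
    also have "\<dots> = C * \<nu> powr (-7/8) * M * B * \<kappa> powr (-1/16) * exp (\<kappa> * t) * (16 * t powr (1/16))"
      using set_integral_powr_endpoint(2)[OF t(1), of "-15/16"] by simp
    also have "\<dots> \<le> C * \<nu> powr (-7/8) * M * B * \<kappa> powr (-1/16) * exp (\<kappa> * t) * (16 * T powr (1/16))"
      using t C(1) M B by (intro mult_left_mono powr_mono2 mult_nonneg_nonneg) auto
    also have "\<dots> = (K * \<kappa> powr (-1/16)) * (B * exp (\<kappa> * t))" by (simp add: K_def mult_ac)
    also have "\<dots> \<le> 1/2 * (B * exp (\<kappa> * t))" using \<kappa>(2) B by (intro mult_right_mono) auto
    finally show ?thesis by simp
  qed
  \<comment> \<open>Iterating the halving step from the trivial bound 2 M replaces a supremum over a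
    function space.\<close>
  have "\<bar>f t x - g t x\<bar> \<le> (2 * M / 2 ^ n) * exp (\<kappa> * t)" if "0 < t" "t < T" for n t x
    using that
  proof (induction n arbitrary: t x)
    case 0
    have "\<bar>f t x - g t x\<bar> \<le> 2 * M" using fM[OF 0, of x] gM[OF 0, of x] by linarith
    also have "\<dots> \<le> 2 * M * exp (\<kappa> * t)" using M 0 \<kappa>(1) mult_left_mono[of 1 "exp (\<kappa> * t)" "2 * M"] by simp
    finally show ?case by simp
  next
    case (Suc n)
    from step[OF Suc.IH Suc.prems, of x] show ?case by (simp add: mult_ac)
  qed
  note bound = this[OF t, of x]
  have "(\<lambda>n. (2 * M / 2 ^ n) * exp (\<kappa> * t)) \<longlonglongrightarrow> 0"
  proof -
    have "(\<lambda>n. 2 * M * exp (\<kappa> * t) * (1/2) ^ n) \<longlonglongrightarrow> 2 * M * exp (\<kappa> * t) * 0"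
      by (intro tendsto_intros LIMSEQ_power_zero) simp
    then show ?thesis by (simp add: power_divide)
  qed
  then have "\<bar>f t x - g t x\<bar> \<le> 0" by (rule LIMSEQ_le_const) (use bound in auto)
  then show ?thesis by simp
qed

lemma circ_integral_isCont:
  fixes F :: "real \<Rightarrow> real \<Rightarrow> real"
  assumes r: "0 < r" and c: "continuous_on (cball t0 r \<times> {0..1}) (\<lambda>p. F (fst p) (snd p))"
  shows "isCont (\<lambda>t. integral\<^sup>L circ (F t)) t0"
proof -
  have "bounded ((\<lambda>p. F (fst p) (snd p)) ` (cball t0 r \<times> {0..1}))"
    by (intro compact_imp_bounded compact_continuous_image c compact_Times) auto
  then obtain B where "\<forall>p\<in>cball t0 r \<times> {0..1}. \<bar>F (fst p) (snd p)\<bar> \<le> B" by (auto simp: bounded_iff)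
  then have B: "\<bar>F t x\<bar> \<le> B" if "t \<in> cball t0 r" "x \<in> {0..1}" for t x using that by force
  have sub: "t \<in> cball t0 r" if "t \<in> ball t0 r" for t using that by simp
  have Fx: "continuous_on {0..1} (F t)" if "t \<in> cball t0 r" for t
    using continuous_on_compose2[OF c, of "{0..1}" "\<lambda>x. (t, x)"] that
    by (simp add: continuous_on_Pair continuous_on_const continuous_on_id image_subset_iff)
  have Ft: "isCont (\<lambda>t. F t x) t0" if "x \<in> {0..1}" for x
  proof -
    have "continuous_on (cball t0 r) (\<lambda>t. F t x)"
      using continuous_on_compose2[OF c, of "cball t0 r" "\<lambda>t. (t, x)"] that
      by (simp add: continuous_on_Pair continuous_on_const continuous_on_id image_subset_iff)
    moreover have "t0 \<in> interior (cball t0 r)" using r by simp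
    ultimately show ?thesis by (rule continuous_on_interior)
  qed
  have "isCont (\<lambda>t. (LINT x|circ. F t x * 1)) t0"
  proof (rule circ_integral_continuous_param[OF _ r])
    show "F t \<in> borel_measurable circ" if "t \<in> ball t0 r" for t
      by (rule borel_measurable_cont_circ[OF Fx[OF sub[OF that]]])
    show "\<bar>F t x\<bar> \<le> B" if "t \<in> ball t0 r" "x \<in> {0..1}" for t x using B sub that by blast
  qed (use Ft in auto)
  then show ?thesis by simp
qed

section \<open>Duhamel's formula for classical solutions\<close>

context classical_burgers
begin

lemma w_measurable: "set_borel_measurable borel ({0<..} \<times> UNIV) (\<lambda>(t, x). w t x)"
proof -
  have "open ({0<..} \<times> (UNIV :: real set) :: (real \<times> real) set)" by (intro open_Times) auto
  then have "{0<..} \<times> (UNIV :: real set) \<in> sets (borel :: (real \<times> real) measure)" by (rule borel_open)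
  then show ?thesis
    unfolding set_borel_measurable_def using cont(1)
    by (intro borel_measurable_continuous_on_indicator) (simp_all add: case_prod_beta')
qed

text \<open>Applying the backward heat flow to w(s) cancels the viscous term, which leaves the flow
  of - w w_x = - (w^2/2)_x. The derivative is then moved onto the kernel.\<close>

lemma heat_conv_backward_derivative:
  assumes s: "0 < s" "s < t"
  shows "((\<lambda>s. heat_conv 0 (\<nu> * (t - s)) (w s) x) has_real_derivative
    - heat_conv 1 (\<nu> * (t - s)) (\<lambda>y. 1/2 * (w s y)\<^sup>2) x) (at s)"
proof -
  define r where "r = min s (t - s) / 2"
  have r: "0 < r" using s by (simp add: r_def)
  have ball: "0 < \<sigma>" "\<sigma> < t" if "\<sigma> \<in> cball s r" for \<sigma>
    using that s by (auto simp: r_def dist_real_def abs_if min_def split: if_splits)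
  have sub: "cball s r \<times> {0..1} \<subseteq> {0<..} \<times> (UNIV :: real set)" using ball by blast
  note wc = continuous_on_subset[OF cont(1) sub] continuous_on_subset[OF cont(2) sub] continuous_on_subset[OF cont(3) sub]
  define F where "F \<sigma> y = heat_kernel_dx 0 (\<nu> * (t - \<sigma>)) (x - y) * w \<sigma> y" for \<sigma> y
  define F' where "F' \<sigma> y = - \<nu> * heat_kernel_dx 2 (\<nu> * (t - \<sigma>)) (x - y) * w \<sigma> y +
    heat_kernel_dx 0 (\<nu> * (t - \<sigma>)) (x - y) * (\<nu> * w2 \<sigma> y - w \<sigma> y * w1 \<sigma> y)" for \<sigma> y
  have 1: "((\<lambda>s. integral\<^sup>L circ (F s)) has_real_derivative integral\<^sup>L circ (F' s)) (at s)"
  proof (rule circ_integral_has_dt[OF r])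
    fix \<sigma> y assume \<sigma>: "\<sigma> \<in> cball s r"
    have pos: "0 < \<nu> * (t - \<sigma>)" using ball[OF \<sigma>] nu by simp
    have "((\<lambda>\<sigma>. \<nu> * (t - \<sigma>)) has_real_derivative - \<nu>) (at \<sigma>)" by (auto intro!: derivative_eq_intros)
    from DERIV_chain2[OF heat_kernel_dx_has_dt[OF pos, of 0 "x - y"] this]
    have "((\<lambda>\<sigma>. heat_kernel_dx 0 (\<nu> * (t - \<sigma>)) (x - y)) has_real_derivative
       heat_kernel_dx 2 (\<nu> * (t - \<sigma>)) (x - y) * - \<nu>) (at \<sigma>)" by (simp add: numeral_2_eq_2)
    from DERIV_mult[OF this dt(1)[OF ball(1)[OF \<sigma>], of y]]
    show "((\<lambda>t. F t y) has_real_derivative F' \<sigma> y) (at \<sigma>)"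
      unfolding F_def F'_def by (simp add: mult_ac add.commute)
  next
    show "continuous_on (cball s r \<times> {0..1}) (\<lambda>p. F' (fst p) (snd p))"
      unfolding F'_def
      by (intro continuous_intros wc) (use ball nu in auto)
  next
    fix \<sigma> assume \<sigma>: "\<sigma> \<in> cball s r"
    show "continuous_on {0..1} (F \<sigma>)"
      unfolding F_def by (intro continuous_intros cont_x ball[OF \<sigma>]) (use ball[OF \<sigma>] nu in simp)
  qed
  define K where "K j y = heat_kernel_dx j (\<nu> * (t - s)) (x - y)" for j y
  have pos: "0 < \<nu> * (t - s)" using s nu by simp
  have Kc: "continuous_on S (K j)" for S j
    unfolding K_def by (intro continuous_intros pos)
  have Kd: "(K j has_real_derivative - K (Suc j) y) (at y)" for j y
    unfolding K_def[abs_def] by (rule heat_kernel_dx_reflected_deriv[OF pos])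
  have Kper: "K j 1 = K j 0" for j
    using heat_kernel_dx_periodic[of j "\<nu> * (t - s)" "x - 1"] by (simp add: K_def)
  have F's: "F' s y = - \<nu> * K 2 y * w s y + K 0 y * (\<nu> * w2 s y - w s y * w1 s y)" for y
    by (simp add: F'_def K_def)
  have F'c: "continuous_on {0..1} (F' s)" unfolding F's by (intro continuous_intros Kc cont_x s)
  have Gc: "continuous_on {0..1} (\<lambda>y. K 1 y * (1/2 * (w s y)\<^sup>2))" by (intro continuous_intros Kc cont_x s)
  \<comment> \<open>The boundary terms of Green's identity for the kernel and w, and of one
    integration by parts of the flux. The reflected argument x - y explains the signs.\<close>
  let ?H = "\<lambda>y. \<nu> * K 1 y * w s y + \<nu> * K 0 y * w1 s y - 1/2 * (K 0 y * (w s y)\<^sup>2)"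
  have "(LINT y|circ. F' s y + K 1 y * (1/2 * (w s y)\<^sup>2)) = ?H 1 - ?H 0"
  proof (rule circ_integral_FTC)
    show "continuous_on {0..1} (\<lambda>y. F' s y + K 1 y * (1/2 * (w s y)\<^sup>2))" by (intro continuous_intros F'c Gc)
    show "(?H has_real_derivative F' s y + K 1 y * (1/2 * (w s y)\<^sup>2)) (at y)" for y
      unfolding F's
      by (rule derivative_eq_intros Kd dx s refl)+ (simp add: algebra_simps power2_eq_square numeral_2_eq_2)
  qed
  also have "\<dots> = 0" using end_eq[OF s(1)] by (simp add: Kper)
  finally have "integral\<^sup>L circ (F' s) = - (LINT y|circ. K 1 y * (1/2 * (w s y)\<^sup>2))"
    using circ_integrable_continuous[OF F'c] circ_integrable_continuous[OF Gc] by simp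
  with 1 show ?thesis
    by (simp add: heat_conv_def F_def[abs_def] K_def)
qed

lemma uniform_time_continuity:
  assumes t: "0 < t" and e: "0 < e"
  shows "\<exists>d>0. \<forall>s x. \<bar>s - t\<bar> < d \<longrightarrow> x \<in> {0..1} \<longrightarrow> \<bar>w s x - w t x\<bar> < e"
proof -
  have "uniformly_continuous_on (cball t (t/2) \<times> {0..1}) (\<lambda>p. w (fst p) (snd p))"
    by (intro compact_uniformly_continuous cont_cball t compact_Times) auto
  then obtain d where d: "0 < d" "\<forall>p\<in>cball t (t/2) \<times> {0..1}. \<forall>q\<in>cball t (t/2) \<times> {0..1}.
      dist q p < d \<longrightarrow> dist (w (fst q) (snd q)) (w (fst p) (snd p)) < e"
    unfolding uniformly_continuous_on_def using e by blast
  have "\<bar>w s x - w t x\<bar> < e" if "\<bar>s - t\<bar> < min d (t/2)" "x \<in> {0..1}" for s x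
  proof -
    have "(s, x) \<in> cball t (t/2) \<times> {0..1}" "(t, x) \<in> cball t (t/2) \<times> {0..1}"
      using that t by (auto simp: dist_real_def abs_minus_commute)
    moreover have "dist (s, x) (t, x) < d" using that by (simp add: dist_Pair_Pair dist_real_def)
    ultimately show ?thesis using d(2) by (fastforce simp: dist_real_def)
  qed
  then show ?thesis using d(1) t by (intro exI[of _ "min d (t/2)"]) auto
qed

text \<open>The backward flow is differentiated only on the open interval, because the equation is
  not given at time 0 and the kernel degenerates at time t. At 0 the uniform limit \<open>v\<close>
  of w is used, at t the continuity of w in time and the initial behaviour of the heat flow; both
  errors are controlled by the sup-norm contraction.\<close>

lemma duhamel:
  assumes v: "continuous_on UNIV v" "circle_fun v"
    and lim: "\<And>e. 0 < e \<Longrightarrow> \<exists>d>0. \<forall>t x. 0 < t \<longrightarrow> t < d \<longrightarrow> \<bar>w t x - v x\<bar> < e"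
    and M: "\<And>t x. 0 < t \<Longrightarrow> \<bar>w t x\<bar> \<le> M" and t: "0 < t"
  shows "w t x = heat_conv 0 (\<nu> * t) v x -
    (LINT s:{0<..<t}|lborel. heat_conv 1 (\<nu> * (t - s)) (\<lambda>y. 1/2 * (w s y)\<^sup>2) x)"
proof -
  define F where "F s = heat_conv 0 (\<nu> * (t - s)) (w s) x" for s
  define G where "G s = heat_conv 1 (\<nu> * (t - s)) (\<lambda>y. 1/2 * (w s y)\<^sup>2) x" for s
  have vi: "integrable circ v" by (rule circ_integrable_continuous[OF continuous_on_subset[OF v(1)]]) simp
  have wi: "integrable circ (w s)" if "0 < s" for s
    by (rule circ_integrable_continuous[OF cont_x(1)[OF that]])
  have pos: "0 < \<nu> * (t - s)" if "s < t" for s using that nu by simp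
  have M0: "0 \<le> M" using M[OF t, of 0] by force
  have G_int: "set_integrable lborel {0<..<t} G"
    unfolding G_def
  proof (rule duhamel_integrable[OF space_time_square_measurable[OF w_measurable] t nu])
    fix s y :: real assume "0 < s"
    then have "(w s y)\<^sup>2 \<le> M\<^sup>2" using M[of s y] by (metis abs_ge_zero power2_abs power_mono)
    then show "\<bar>1/2 * (w s y)\<^sup>2\<bar> \<le> 1/2 * M\<^sup>2" by simp
  qed
  have G_cont: "isCont G s" if s: "0 < s" "s < t" for s
  proof -
    define r where "r = min s (t - s) / 2"
    have r: "0 < r" using s by (simp add: r_def)
    have ball: "0 < \<sigma>" "\<sigma> < t" if "\<sigma> \<in> cball s r" for \<sigma>
      using that s by (auto simp: r_def dist_real_def abs_if min_def split: if_splits)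
    have sub: "cball s r \<times> {0..1} \<subseteq> {0<..} \<times> (UNIV :: real set)" using ball by blast
    show ?thesis
      unfolding G_def[abs_def] heat_conv_def
      by (rule circ_integral_isCont[OF r], intro continuous_intros continuous_on_subset[OF cont(1) sub])
         (use ball nu in auto)
  qed
  have lim0: "(F \<longlongrightarrow> heat_conv 0 (\<nu> * t) v x) (at_right 0)"
  proof (rule tendstoI)
    fix e :: real assume e: "0 < e"
    obtain d where d: "0 < d" "\<forall>t x. 0 < t \<longrightarrow> t < d \<longrightarrow> \<bar>w t x - v x\<bar> < e/2" using lim[of "e/2"] e by auto
    have "isCont (\<lambda>s. \<nu> * (t - s)) (0::real)" by (intro continuous_intros)
    moreover have "isCont (\<lambda>\<tau>. heat_conv 0 \<tau> v x) (\<nu> * (t - 0))"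
      by (rule DERIV_isCont[OF heat_conv_has_dt[OF pos[OF t] vi]])
    ultimately have "isCont (\<lambda>s. heat_conv 0 (\<nu> * (t - s)) v x) (0::real)" by (rule isCont_o2)
    then have "((\<lambda>s. heat_conv 0 (\<nu> * (t - s)) v x) \<longlongrightarrow> heat_conv 0 (\<nu> * t) v x) (at 0)"
      by (simp add: isCont_def)
    then have "((\<lambda>s. heat_conv 0 (\<nu> * (t - s)) v x) \<longlongrightarrow> heat_conv 0 (\<nu> * t) v x) (at_right 0)"
      by (rule filterlim_mono[OF _ order_refl at_le]) simp
    then have "\<forall>\<^sub>F s in at_right 0. dist (heat_conv 0 (\<nu> * (t - s)) v x) (heat_conv 0 (\<nu> * t) v x) < e/2"
      by (rule tendstoD) (use e in simp)
    moreover have "\<forall>\<^sub>F s in at_right 0. 0 < s \<and> s < min d t"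
      using d(1) t by (auto simp: eventually_at_right_field intro!: exI[of _ "min d t"])
    ultimately show "\<forall>\<^sub>F s in at_right 0. dist (F s) (heat_conv 0 (\<nu> * t) v x) < e"
    proof eventually_elim
      case (elim s)
      have "\<bar>heat_conv 0 (\<nu> * (t - s)) (\<lambda>y. w s y - v y) x\<bar> \<le> e/2"
        using elim d by (intro heat_conv_abs_le pos Bochner_Integration.integrable_diff wi vi) (auto intro: less_imp_le)
      then have "\<bar>F s - heat_conv 0 (\<nu> * (t - s)) v x\<bar> \<le> e/2"
        using elim by (simp add: F_def heat_conv_diff pos wi vi)
      then show ?case using elim(1) unfolding dist_real_def by linarith
    qed
  qed
  have lim1: "(F \<longlongrightarrow> w t x) (at_left t)"
  proof (rule tendstoI)
    fix e :: real assume e: "0 < e"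
    obtain d1 where d1: "0 < d1" "\<forall>s x. \<bar>s - t\<bar> < d1 \<longrightarrow> x \<in> {0..1} \<longrightarrow> \<bar>w s x - w t x\<bar> < e/2"
      using uniform_time_continuity[OF t, of "e/2"] e by auto
    obtain d2 where d2: "0 < d2" "\<forall>\<tau> x. 0 < \<tau> \<longrightarrow> \<tau> < d2 \<longrightarrow> \<bar>heat_conv 0 \<tau> (w t) x - w t x\<bar> < e/2"
      using heat_conv_initial[OF cont_x(1)[OF t] per(1)[OF t], of "e/2"] e by auto
    define d where "d = min (min d1 (d2 / \<nu>)) t"
    have d: "0 < d" using d1 d2 nu t by (simp add: d_def)
    have "\<forall>\<^sub>F s in at_left t. t - d < s \<and> s < t"
      using d by (auto simp: eventually_at_left_field intro!: exI[of _ "t - d"])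
    then show "\<forall>\<^sub>F s in at_left t. dist (F s) (w t x) < e"
    proof eventually_elim
      case (elim s)
      have s: "0 < s" "s < t" "\<bar>s - t\<bar> < d1" "\<nu> * (t - s) < d2"
      proof -
        show "0 < s" "s < t" "\<bar>s - t\<bar> < d1" using elim by (auto simp: d_def)
        have "t - s < d2 / \<nu>" using elim by (auto simp: d_def)
        then show "\<nu> * (t - s) < d2" using nu by (simp add: pos_less_divide_eq mult.commute)
      qed
      have "\<bar>heat_conv 0 (\<nu> * (t - s)) (\<lambda>y. w s y - w t y) x\<bar> \<le> e/2"
        using s d1(2) by (intro heat_conv_abs_le pos Bochner_Integration.integrable_diff wi t) (auto intro: less_imp_le)
      then have "\<bar>F s - heat_conv 0 (\<nu> * (t - s)) (w t) x\<bar> \<le> e/2"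
        using s t by (simp add: F_def heat_conv_diff pos wi)
      moreover have "\<bar>heat_conv 0 (\<nu> * (t - s)) (w t) x - w t x\<bar> < e/2"
        using d2(2) pos[OF s(2)] s(4) by blast
      ultimately show ?case unfolding dist_real_def by linarith
    qed
  qed
  have e: "einterval (ereal 0) (ereal t) = {0<..<t}" by (auto simp: einterval_def)
  have "(LBINT s=ereal 0..ereal t. - G s) = w t x - heat_conv 0 (\<nu> * t) v x"
  proof (rule interval_integral_FTC_integrable[where F = F])
    show "ereal 0 < ereal t" using t by simp
    show "(F has_vector_derivative - G s) (at s)" if "ereal 0 < ereal s" "ereal s < ereal t" for s
      using heat_conv_backward_derivative[of s t x] that unfolding F_def[abs_def] G_def
      by (simp add: has_real_derivative_iff_has_vector_derivative)
    show "isCont (\<lambda>s. - G s) s" if "ereal 0 < ereal s" "ereal s < ereal t" for s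
      using G_cont[of s] that by (intro continuous_minus) simp
    show "set_integrable lborel (einterval (ereal 0) (ereal t)) (\<lambda>s. - G s)"
      using G_int by (simp add: e set_integrable_def)
    show "((F \<circ> real_of_ereal) \<longlongrightarrow> heat_conv 0 (\<nu> * t) v x) (at_right (ereal 0))"
      unfolding ereal_tendsto_simps1 by (rule lim0)
    show "((F \<circ> real_of_ereal) \<longlongrightarrow> w t x) (at_left (ereal t))"
      unfolding ereal_tendsto_simps1 by (rule lim1)
  qed
  then have "(LINT s:{0<..<t}|lborel. - G s) = w t x - heat_conv 0 (\<nu> * t) v x"
    using t by (simp add: interval_lebesgue_integral_def e)
  moreover have "(LINT s:{0<..<t}|lborel. - G s) = - (LINT s:{0<..<t}|lborel. G s)"
    by (simp add: set_lebesgue_integral_def)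
  ultimately show ?thesis by (simp add: G_def)
qed

end

section \<open>The Cole--Hopf solution\<close>

text \<open>The difference V(x + 1) - V(x) has derivative zero and equals the mean of v. The zero
  mean is therefore exactly what makes the Cole--Hopf datum periodic.\<close>

lemma circle_antiderivative:
  assumes v: "continuous_on UNIV v" "circle_fun v" and m: "integral\<^sup>L circ v = 0"
  obtains V where "circle_fun V" "\<And>x. (V has_real_derivative v x) (at x)"
proof -
  define V where "V x = (LBINT y=ereal 0..ereal x. v y)" for x
  have V: "(V has_real_derivative v x) (at x)" for x
  proof -
    define a b where "a = min 0 x - 1" and "b = max 0 x + 1"
    have ab: "a \<le> 0" "0 \<le> b" "a \<le> x" "x \<le> b" "x \<in> {a<..<b}" by (auto simp: a_def b_def)
    have "(V has_vector_derivative v x) (at x within {a..b})"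
      unfolding V_def[abs_def]
      using ab by (intro interval_integral_FTC2 continuous_on_subset[OF v(1)]) auto
    then have "(V has_vector_derivative v x) (at x within {a<..<b})"
      by (rule has_vector_derivative_within_subset) auto
    then show ?thesis
      using ab(5) by (simp add: has_real_derivative_iff_has_vector_derivative at_within_open[of x "{a<..<b}"])
  qed
  have "V (x + 1) - V x = V (0 + 1) - V 0" for x
  proof -
    have "((\<lambda>x. V (x + 1) - V x) has_real_derivative 0) (at x)" for x
    proof -
      have "((\<lambda>x. V (x + 1)) has_real_derivative v (x + 1)) (at x)"
        using V[of "x + 1"] DERIV_shift[of V "v (x + 1)" x 1] by simp
      from DERIV_diff[OF this V] show ?thesis using v(2) by (simp add: circle_fun_def)
    qed
    then show ?thesis by (rule DERIV_isconst_all[rule_format])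
  qed
  moreover have "V (0 + 1) - V 0 = 0"
    using circ_integral_FTC[of v V] V m continuous_on_subset[OF v(1)] by simp
  ultimately have "circle_fun V" by (simp add: circle_fun_def)
  from that[OF this V] show ?thesis .
qed

lemma circle_fun_bounded:
  assumes "continuous_on UNIV f" "circle_fun f"
  obtains B where "0 < B" "\<And>x. \<bar>f x\<bar> \<le> B"
proof -
  obtain B where B: "B \<ge> 0" "\<And>x. x \<in> {0..1} \<Longrightarrow> \<bar>f x\<bar> \<le> B"
    using continuous_on_bounded_01[OF continuous_on_subset[OF assms(1)]] by blast
  have "\<bar>f x\<bar> \<le> B + 1" for x
    using circle_fun_allI[where P = "\<lambda>a b. \<bar>a\<bar> \<le> B" and f = f and g = f, OF B(2) assms(2) assms(2), of x] by simp
  with B(1) show ?thesis by (intro that[of "B + 1"]) auto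
qed

text \<open>\<open>v\<close> is the continuous representative of the initial datum, \<open>g\<close> its weak derivative and \<open>V\<close> an
  antiderivative of \<open>v\<close>.\<close>

locale cole_hopf =
  fixes \<nu> :: real and v g V :: "real \<Rightarrow> real"
  assumes nu: "0 < \<nu>" and v_cont: "continuous_on UNIV v" and v_per: "circle_fun v"
    and g_int: "integrable circ g" and g2_int: "integrable circ (\<lambda>x. (g x)\<^sup>2)"
    and g_norm: "(LINT x|circ. (g x)\<^sup>2) \<le> 1"
    and V_per: "circle_fun V" and V_deriv: "\<And>x. (V has_real_derivative v x) (at x)"
    and parts: "\<And>\<psi> \<psi>'. continuous_on {0..1} \<psi>' \<Longrightarrow>
       (\<And>x. x \<in> {0..1} \<Longrightarrow> (\<psi> has_real_derivative \<psi>' x) (at x)) \<Longrightarrow> \<psi> 1 = \<psi> 0 \<Longrightarrow>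
       (LINT x|circ. v x * \<psi>' x) = - (LINT x|circ. g x * \<psi> x)"
begin

definition \<phi>0 :: "real \<Rightarrow> real" where "\<phi>0 x = exp (- V x / (2 * \<nu>))"
definition \<phi>1 :: "real \<Rightarrow> real" where "\<phi>1 x = - (v x / (2 * \<nu>)) * \<phi>0 x"
abbreviation flow :: "real \<Rightarrow> (real \<Rightarrow> real) \<Rightarrow> real \<Rightarrow> real" where
  "flow t \<equiv> heat_conv 0 (\<nu> * t)"

definition P :: "nat \<Rightarrow> real \<Rightarrow> real \<Rightarrow> real" where "P j t x = heat_conv j (\<nu> * t) \<phi>0 x"

lemma v_cont': "continuous_on S v" using v_cont by (rule continuous_on_subset) simp

lemma phi0_deriv: "(\<phi>0 has_real_derivative \<phi>1 x) (at x)"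
  unfolding \<phi>0_def[abs_def] \<phi>1_def using nu
  by (auto intro!: derivative_eq_intros V_deriv simp: \<phi>0_def)

lemma phi0_cont: "continuous_on S \<phi>0"
  using DERIV_isCont[OF phi0_deriv] by (intro continuous_at_imp_continuous_on) blast

lemma phi1_cont: "continuous_on S \<phi>1"
  unfolding \<phi>1_def using nu by (intro continuous_intros v_cont' phi0_cont) auto

lemma phi_per: "circle_fun \<phi>0" "circle_fun \<phi>1"
  using V_per v_per by (simp_all add: circle_fun_def \<phi>0_def \<phi>1_def)

lemma phi_int: "integrable circ \<phi>0" "integrable circ \<phi>1"
  by (intro circ_integrable_continuous phi0_cont phi1_cont)+

lemma phi0_pos: "0 < \<phi>0 x" by (simp add: \<phi>0_def)

lemma phi0_bounds:
  obtains m L where "0 < m" "\<And>x. m \<le> \<phi>0 x" "0 < L" "\<And>x. \<phi>0 x \<le> L" "\<And>x. \<bar>\<phi>1 x\<bar> \<le> L"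
    "\<And>x. \<bar>v x\<bar> \<le> L"
proof -
  have ic: "continuous_on UNIV (\<lambda>x. inverse (\<phi>0 x))" "circle_fun (\<lambda>x. inverse (\<phi>0 x))"
    using phi0_pos phi_per by (auto intro!: continuous_intros phi0_cont simp: less_imp_neq[symmetric] circle_fun_def)
  obtain B where B: "0 < B" "\<And>x. \<bar>inverse (\<phi>0 x)\<bar> \<le> B" using circle_fun_bounded[OF ic] by blast
  obtain B0 where B0: "0 < B0" "\<And>x. \<bar>\<phi>0 x\<bar> \<le> B0" using circle_fun_bounded[OF phi0_cont phi_per(1)] by blast
  obtain B1 where B1: "0 < B1" "\<And>x. \<bar>\<phi>1 x\<bar> \<le> B1" using circle_fun_bounded[OF phi1_cont phi_per(2)] by blast
  obtain B2 where B2: "0 < B2" "\<And>x. \<bar>v x\<bar> \<le> B2" using circle_fun_bounded[OF v_cont v_per] by blast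
  have "inverse B \<le> \<phi>0 x" for x
    using B(2)[of x] phi0_pos[of x] le_imp_inverse_le[of "inverse (\<phi>0 x)" B] by simp
  moreover have "\<phi>0 x \<le> B0 + B1 + B2" "\<bar>\<phi>1 x\<bar> \<le> B0 + B1 + B2" "\<bar>v x\<bar> \<le> B0 + B1 + B2" for x
    using B0(2)[of x] B1(2)[of x] B2(2)[of x] B0(1) B1(1) B2(1) by linarith+
  ultimately show ?thesis using B(1) B0(1) B1(1) B2(1) by (intro that[of "inverse B" "B0 + B1 + B2"]) auto
qed

lemma P_dx: "0 < t \<Longrightarrow> (P j t has_real_derivative P (Suc j) t x) (at x)"
  unfolding P_def[abs_def] using nu by (intro heat_conv_has_dx phi_int) simp

lemma P_dt: "0 < t \<Longrightarrow> ((\<lambda>t. P j t x) has_real_derivative \<nu> * P (Suc (Suc j)) t x) (at t)"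
proof -
  assume t: "0 < t"
  have "((\<lambda>t. \<nu> * t) has_real_derivative \<nu>) (at t)" by (auto intro!: derivative_eq_intros)
  from DERIV_chain2[OF heat_conv_has_dt[OF _ phi_int(1)] this, of j x] nu t
  show ?thesis by (simp add: P_def mult.commute)
qed

lemma P_cont: "continuous_on ({0<..} \<times> UNIV) (\<lambda>p. P j (fst p) (snd p))"
proof (rule continuous_at_imp_continuous_on, rule ballI)
  fix p :: "real \<times> real" assume "p \<in> {0<..} \<times> UNIV"
  then have p: "0 < \<nu> * fst p" using nu by auto
  have "isCont (\<lambda>p. (\<nu> * fst p, snd p)) p" by (intro continuous_intros)
  from isCont_o2[OF this heat_conv_isCont[OF p phi_int(1), where j = j and x = "snd p"]]
  show "isCont (\<lambda>p. P j (fst p) (snd p)) p" by (simp add: P_def)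
qed

lemma P_per: "circle_fun (P j t)"
  unfolding P_def[abs_def] by (rule heat_conv_periodic)

lemma P0_ge: "0 < t \<Longrightarrow> (\<And>x. m \<le> \<phi>0 x) \<Longrightarrow> m \<le> P 0 t x"
  unfolding P_def using nu by (intro heat_conv_ge phi_int) auto

lemma P0_pos: "0 < t \<Longrightarrow> 0 < P 0 t x"
  using phi0_bounds P0_ge by (metis less_le_trans)

text \<open>Integration by parts puts the derivative on the datum. In this form the first derivative
  stays bounded as t tends to 0.\<close>

lemma P1_eq: "0 < t \<Longrightarrow> P 1 t = flow t \<phi>1"
proof (rule ext)
  fix x assume t: "0 < t"
  define K where "K j y = heat_kernel_dx j (\<nu> * t) (x - y)" for j y
  have pos: "0 < \<nu> * t" using t nu by simp
  have Kc: "continuous_on S (K j)" for S j unfolding K_def by (intro continuous_intros pos)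
  have Kd: "(K j has_real_derivative - K (Suc j) y) (at y)" for j y
    unfolding K_def[abs_def] by (rule heat_kernel_dx_reflected_deriv[OF pos])
  have Kper: "K j 1 = K j 0" for j
    using heat_kernel_dx_periodic[of j "\<nu> * t" "x - 1"] by (simp add: K_def)
  have "(LINT y|circ. K 0 y * \<phi>1 y - K 1 y * \<phi>0 y) = K 0 1 * \<phi>0 1 - K 0 0 * \<phi>0 0"
  proof (rule circ_integral_FTC)
    show "continuous_on {0..1} (\<lambda>y. K 0 y * \<phi>1 y - K 1 y * \<phi>0 y)"
      by (intro continuous_intros Kc phi0_cont phi1_cont)
    show "((\<lambda>y. K 0 y * \<phi>0 y) has_real_derivative K 0 y * \<phi>1 y - K 1 y * \<phi>0 y) (at y)" for y
      by (rule derivative_eq_intros Kd phi0_deriv refl)+ simp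
  qed
  also have "\<dots> = 0" using phi_per(1) Kper unfolding circle_fun_def by (metis add_0 diff_self)
  finally have 0: "(LINT y|circ. K 0 y * \<phi>1 y - K 1 y * \<phi>0 y) = 0" .
  have "integrable circ (\<lambda>y. K 0 y * \<phi>1 y)" "integrable circ (\<lambda>y. K 1 y * \<phi>0 y)"
    by (intro circ_integrable_continuous continuous_intros Kc phi0_cont phi1_cont)+
  with 0 have "(LINT y|circ. K 0 y * \<phi>1 y) = (LINT y|circ. K 1 y * \<phi>0 y)" by simp
  then show "P 1 t x = flow t \<phi>1 x" by (simp add: P_def heat_conv_def K_def)
qed

text \<open>Formally -2 \<nu> \<phi>0'' = \<phi>0 g - v^2 \<phi>0 / (2 \<nu>), followed by the heat
  flow. As v is only weakly differentiable, the second derivative is left on the kernel and removed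
  through the weak formulation \<open>parts\<close>.\<close>

lemma P2_eq:
  assumes t: "0 < t"
  shows "- 2 * \<nu> * P 2 t x = flow t (\<lambda>y. \<phi>0 y * g y) x -
    flow t (\<lambda>y. (v y)\<^sup>2 * \<phi>0 y) x / (2 * \<nu>)"
proof -
  define K where "K j y = heat_kernel_dx j (\<nu> * t) (x - y)" for j y
  have pos: "0 < \<nu> * t" using t nu by simp
  have Kc: "continuous_on S (K j)" for S j unfolding K_def by (intro continuous_intros pos)
  have Kd: "(K j has_real_derivative - K (Suc j) y) (at y)" for j y
    unfolding K_def[abs_def] by (rule heat_kernel_dx_reflected_deriv[OF pos])
  have Kper: "K j 1 = K j 0" for j
    using heat_kernel_dx_periodic[of j "\<nu> * t" "x - 1"] by (simp add: K_def)
  have "(P 1 t has_real_derivative P 2 t x) (at x)"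
    using P_dx[OF t, of 1 x] by (simp only: Suc_1)
  moreover have "(P 1 t has_real_derivative heat_conv 1 (\<nu> * t) \<phi>1 x) (at x)"
    unfolding P1_eq[OF t] using heat_conv_has_dx[OF pos phi_int(2), of 0 x] by (simp only: One_nat_def)
  ultimately have "P 2 t x = heat_conv 1 (\<nu> * t) \<phi>1 x" by (rule DERIV_unique)
  also have "\<dots> = (LINT y|circ. K 1 y * \<phi>1 y)" by (simp add: heat_conv_def K_def)
  also have "\<dots> = (LINT y|circ. (- 1 / (2 * \<nu>)) * (v y * (\<phi>0 y * K 1 y)))"
    by (simp add: \<phi>1_def mult_ac)
  also have "\<dots> = (- 1 / (2 * \<nu>)) * (LINT y|circ. v y * (\<phi>0 y * K 1 y))"
    by (rule integral_mult_right_zero)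
  finally have 1: "- 2 * \<nu> * P 2 t x = (LINT y|circ. v y * (\<phi>0 y * K 1 y))"
    using nu by simp
  \<comment> \<open>The C^1 test function is \<phi>0 times the kernel; the term with v \<phi>1
    becomes the quadratic one.\<close>
  have "(LINT y|circ. v y * (\<phi>1 y * K 0 y - \<phi>0 y * K 1 y)) =
    - (LINT y|circ. g y * (\<phi>0 y * K 0 y))"
  proof (rule parts)
    show "continuous_on {0..1} (\<lambda>y. \<phi>1 y * K 0 y - \<phi>0 y * K 1 y)"
      by (intro continuous_intros Kc phi0_cont phi1_cont)
    show "((\<lambda>y. \<phi>0 y * K 0 y) has_real_derivative \<phi>1 y * K 0 y - \<phi>0 y * K 1 y) (at y)" for y
      by (rule derivative_eq_intros Kd phi0_deriv refl)+ simp
    show "\<phi>0 1 * K 0 1 = \<phi>0 0 * K 0 0"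
      using phi_per(1) Kper unfolding circle_fun_def by (metis add_0)
  qed
  moreover have "(LINT y|circ. v y * (\<phi>1 y * K 0 y - \<phi>0 y * K 1 y)) =
    (LINT y|circ. v y * (\<phi>1 y * K 0 y)) - (LINT y|circ. v y * (\<phi>0 y * K 1 y))"
    unfolding right_diff_distrib
    by (intro Bochner_Integration.integral_diff circ_integrable_continuous continuous_intros
        Kc phi0_cont phi1_cont v_cont')
  moreover have "(LINT y|circ. g y * (\<phi>0 y * K 0 y)) = flow t (\<lambda>y. \<phi>0 y * g y) x"
    by (simp add: heat_conv_def K_def mult_ac)
  moreover have "(LINT y|circ. v y * (\<phi>1 y * K 0 y)) = - (flow t (\<lambda>y. (v y)\<^sup>2 * \<phi>0 y) x / (2 * \<nu>))"
  proof -
    have "(\<lambda>y. v y * (\<phi>1 y * K 0 y)) = (\<lambda>y. (- 1 / (2 * \<nu>)) * (K 0 y * ((v y)\<^sup>2 * \<phi>0 y)))"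
      by (auto simp: \<phi>1_def power2_eq_square)
    then show ?thesis by (simp add: heat_conv_def K_def)
  qed
  ultimately show ?thesis unfolding 1 by simp
qed

text \<open>In these quotients w and all its derivatives are polynomials, and the Burgers equation
  becomes a polynomial identity.\<close>

definition r :: "nat \<Rightarrow> real \<Rightarrow> real \<Rightarrow> real" where "r j t x = P j t x / P 0 t x"

lemma r_dx:
  assumes t: "0 < t" shows "(r j t has_real_derivative r (Suc j) t x - r j t x * r 1 t x) (at x)"
proof -
  have "P 0 t x \<noteq> 0" using P0_pos[OF t, of x] by simp
  from DERIV_divide[OF P_dx[OF t] P_dx[OF t] this, of j]
  show ?thesis unfolding r_def[abs_def] using \<open>P 0 t x \<noteq> 0\<close> by (simp add: divide_simps)
qed

lemma r_dt:
  assumes t: "0 < t"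
  shows "((\<lambda>t. r j t x) has_real_derivative \<nu> * (r (Suc (Suc j)) t x - r j t x * r 2 t x)) (at t)"
proof -
  have nz: "P 0 t x \<noteq> 0" using P0_pos[OF t, of x] by simp
  from DERIV_divide[OF P_dt[OF t] P_dt[OF t] this, of j]
  have "((\<lambda>t. r j t x) has_real_derivative
    (\<nu> * P (Suc (Suc j)) t x * P 0 t x - P j t x * (\<nu> * P 2 t x)) / (P 0 t x * P 0 t x)) (at t)"
    by (simp add: r_def[abs_def] numeral_2_eq_2)
  moreover have "(\<nu> * P (Suc (Suc j)) t x * P 0 t x - P j t x * (\<nu> * P 2 t x)) / (P 0 t x * P 0 t x) =
     \<nu> * (r (Suc (Suc j)) t x - r j t x * r 2 t x)"
    using nz by (simp add: r_def field_simps)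
  ultimately show ?thesis by simp
qed

lemma r_cont: "continuous_on ({0<..} \<times> UNIV) (\<lambda>p. r j (fst p) (snd p))"
  unfolding r_def using P0_pos by (intro continuous_intros P_cont) (auto simp: less_imp_neq[symmetric])

lemma r_per: "circle_fun (r j t)"
  using P_per[of j t] P_per[of 0 t] by (simp add: circle_fun_def r_def)

text \<open>These are the logarithmic derivatives of \<open>P 0\<close> times -2 \<nu>. The
  coefficients are those that express the first four cumulants through the moments
  \<open>r j\<close>.\<close>

definition w :: "real \<Rightarrow> real \<Rightarrow> real" where "w t x = - 2 * \<nu> * r 1 t x"
definition w1 :: "real \<Rightarrow> real \<Rightarrow> real" where "w1 t x = - 2 * \<nu> * (r 2 t x - (r 1 t x)\<^sup>2)"
definition w2 :: "real \<Rightarrow> real \<Rightarrow> real" where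
  "w2 t x = - 2 * \<nu> * (r 3 t x - 3 * r 1 t x * r 2 t x + 2 * (r 1 t x) ^ 3)"
definition w3 :: "real \<Rightarrow> real \<Rightarrow> real" where
  "w3 t x = - 2 * \<nu> * (r 4 t x - 4 * r 1 t x * r 3 t x - 3 * (r 2 t x)\<^sup>2 + 12 * (r 1 t x)\<^sup>2 * r 2 t x - 6 * (r 1 t x) ^ 4)"

lemma r_dx':
  assumes "0 < t"
  shows "(r 1 t has_real_derivative r 2 t x - (r 1 t x)\<^sup>2) (at x)"
    "(r 2 t has_real_derivative r 3 t x - r 2 t x * r 1 t x) (at x)"
    "(r 3 t has_real_derivative r 4 t x - r 3 t x * r 1 t x) (at x)"
  using r_dx[OF assms, of 1 x] r_dx[OF assms, of 2 x] r_dx[OF assms, of 3 x]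
  by (simp_all add: eval_nat_numeral power2_eq_square)

lemma r_dt':
  assumes "0 < t"
  shows "((\<lambda>t. r 1 t x) has_real_derivative \<nu> * (r 3 t x - r 1 t x * r 2 t x)) (at t)"
    "((\<lambda>t. r 2 t x) has_real_derivative \<nu> * (r 4 t x - r 2 t x * r 2 t x)) (at t)"
  using r_dt[OF assms, of 1 x] r_dt[OF assms, of 2 x] by (simp_all add: eval_nat_numeral)

sublocale classical_burgers \<nu> w w1 w2 w3
proof
  show "0 < \<nu>" by (rule nu)
  show "circle_fun (w t)" "circle_fun (w1 t)" "circle_fun (w2 t)" for t
    using r_per[of 1 t] r_per[of 2 t] r_per[of 3 t] by (simp_all add: circle_fun_def w_def w1_def w2_def)
  show "(w t has_real_derivative w1 t x) (at x)" if "0 < t" for t x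
    unfolding w_def[abs_def] w1_def
    by (rule derivative_eq_intros r_dx'[OF that] refl)+ simp
  show "(w1 t has_real_derivative w2 t x) (at x)" if "0 < t" for t x
    unfolding w1_def[abs_def] w2_def
    by (rule derivative_eq_intros r_dx'[OF that] refl)+ (simp add: algebra_simps power2_eq_square power3_eq_cube)
  show "(w2 t has_real_derivative w3 t x) (at x)" if "0 < t" for t x
    unfolding w2_def[abs_def] w3_def
    by (rule derivative_eq_intros r_dx'[OF that] refl)+ (simp add: algebra_simps power2_eq_square power3_eq_cube power4_eq_xxxx)
  show "((\<lambda>t. w t x) has_real_derivative \<nu> * w2 t x - w t x * w1 t x) (at t)" if "0 < t" for t x
    unfolding w_def[abs_def] w1_def w2_def
    by (rule derivative_eq_intros r_dt'[OF that] refl)+ (simp add: algebra_simps power2_eq_square power3_eq_cube)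
  show "((\<lambda>t. w1 t x) has_real_derivative \<nu> * w3 t x - (w1 t x)\<^sup>2 - w t x * w2 t x) (at t)" if "0 < t" for t x
    unfolding w_def[abs_def] w1_def w2_def w3_def
    by (rule derivative_eq_intros r_dt'[OF that] refl)+ (simp add: algebra_simps power2_eq_square power3_eq_cube power4_eq_xxxx)
  show "continuous_on ({0<..} \<times> UNIV) (\<lambda>p. w (fst p) (snd p))"
    "continuous_on ({0<..} \<times> UNIV) (\<lambda>p. w1 (fst p) (snd p))"
    "continuous_on ({0<..} \<times> UNIV) (\<lambda>p. w2 (fst p) (snd p))"
    "continuous_on ({0<..} \<times> UNIV) (\<lambda>p. w3 (fst p) (snd p))"
    unfolding w_def w1_def w2_def w3_def by (intro continuous_intros r_cont)+
qed

lemma w_bounded: obtains M where "\<And>t x. 0 < t \<Longrightarrow> \<bar>w t x\<bar> \<le> M"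
proof -
  obtain m L where mL: "0 < m" "\<And>x. m \<le> \<phi>0 x" "0 < L" "\<And>x. \<bar>\<phi>1 x\<bar> \<le> L"
    using phi0_bounds by metis
  have "\<bar>w t x\<bar> \<le> 2 * \<nu> * (L / m)" if t: "0 < t" for t x
  proof -
    have "\<bar>P 1 t x\<bar> \<le> L" unfolding P1_eq[OF t] using nu t by (intro heat_conv_abs_le phi_int mL) auto
    moreover have "m \<le> P 0 t x" by (rule P0_ge[OF t mL(2)])
    ultimately have "\<bar>r 1 t x\<bar> \<le> L / m"
      unfolding r_def abs_divide using mL(1,3) by (intro frac_le) auto
    then have "2 * \<nu> * \<bar>r 1 t x\<bar> \<le> 2 * \<nu> * (L / m)" using nu by (intro mult_left_mono) auto
    then show ?thesis unfolding w_def abs_mult using nu by simp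
  qed
  then show ?thesis by (rule that)
qed

lemma heat_conv_initial_nu:
  assumes "continuous_on UNIV f" "circle_fun f" "0 < e"
  shows "\<exists>d>0. \<forall>t x. 0 < t \<longrightarrow> t < d \<longrightarrow> \<bar>flow t f x - f x\<bar> < e"
proof -
  obtain d where d: "0 < d" "\<forall>t x. 0 < t \<longrightarrow> t < d \<longrightarrow> \<bar>heat_conv 0 t f x - f x\<bar> < e"
    using heat_conv_initial[OF assms] by blast
  show ?thesis
  proof (intro exI[of _ "d / \<nu>"] conjI allI impI)
    show "0 < d / \<nu>" using d nu by simp
    fix t x assume "0 < t" "t < d / \<nu>"
    then have "0 < \<nu> * t" "\<nu> * t < d" using nu by (auto simp: field_simps)
    then show "\<bar>flow t f x - f x\<bar> < e" using d by blast
  qed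
qed

text \<open>Numerator and denominator converge uniformly, and the denominator stays above m. The
  lemma is applied to v, which gives the initial value of w, and to v^2, which gives that of the
  quadratic term in w_x.\<close>

lemma quotient_initial:
  assumes f: "continuous_on UNIV f" "circle_fun f" and e: "0 < e"
  shows "\<exists>d>0. \<forall>t x. 0 < t \<longrightarrow> t < d \<longrightarrow>
    \<bar>flow t (\<lambda>y. f y * \<phi>0 y) x / P 0 t x - f x\<bar> < e"
proof -
  obtain m L where m: "0 < m" "\<And>x. m \<le> \<phi>0 x" using phi0_bounds by metis
  obtain B where B: "0 < B" "\<And>x. \<bar>f x\<bar> \<le> B" using circle_fun_bounded[OF f] by blast
  have fp: "continuous_on UNIV (\<lambda>y. f y * \<phi>0 y)" "circle_fun (\<lambda>y. f y * \<phi>0 y)"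
    using f phi_per by (auto intro!: continuous_intros phi0_cont simp: circle_fun_def)
  \<comment> \<open>Chosen such that (B + 1) \<delta> = e m / 2, the error allowed before dividing
    by a quantity at least m.\<close>
  define \<delta> where "\<delta> = e * m / (2 * (B + 1))"
  have \<delta>: "0 < \<delta>" using e m B by (simp add: \<delta>_def)
  obtain d1 where d1: "0 < d1" "\<forall>t x. 0 < t \<longrightarrow> t < d1 \<longrightarrow>
      \<bar>flow t (\<lambda>y. f y * \<phi>0 y) x - f x * \<phi>0 x\<bar> < \<delta>"
    using heat_conv_initial_nu[OF fp \<delta>] by blast
  obtain d2 where d2: "0 < d2" "\<forall>t x. 0 < t \<longrightarrow> t < d2 \<longrightarrow> \<bar>flow t \<phi>0 x - \<phi>0 x\<bar> < \<delta>"
    using heat_conv_initial_nu[OF phi0_cont phi_per(1) \<delta>] by blast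
  have "\<bar>flow t (\<lambda>y. f y * \<phi>0 y) x / P 0 t x - f x\<bar> < e" if t: "0 < t" "t < min d1 d2" for t x
  proof -
    define S where "S = flow t (\<lambda>y. f y * \<phi>0 y) x"
    have S: "\<bar>S - f x * \<phi>0 x\<bar> < \<delta>" using d1(2) t by (simp add: S_def)
    have P: "\<bar>P 0 t x - \<phi>0 x\<bar> < \<delta>" using d2(2) t by (simp add: P_def)
    have Pm: "m \<le> P 0 t x" by (rule P0_ge[OF t(1) m(2)])
    then have Pp: "0 < P 0 t x" using m(1) by linarith
    have "\<bar>S - f x * P 0 t x\<bar> \<le> \<bar>S - f x * \<phi>0 x\<bar> + \<bar>f x * (P 0 t x - \<phi>0 x)\<bar>"
      by (simp add: right_diff_distrib)
    also have "\<bar>f x * (P 0 t x - \<phi>0 x)\<bar> \<le> B * \<delta>"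
      unfolding abs_mult using B P by (intro mult_mono) auto
    also have "\<bar>S - f x * \<phi>0 x\<bar> + B * \<delta> < \<delta> + B * \<delta>" using S by simp
    also have "\<delta> + B * \<delta> = e * m / 2" using B(1) by (simp add: \<delta>_def divide_simps) (simp add: algebra_simps)
    finally have "\<bar>S - f x * P 0 t x\<bar> < e * m / 2" by simp
    also have "e * m / 2 < e * P 0 t x" using e m(1) Pm mult_left_mono[OF Pm, of e] by (simp add: less_le_trans[rotated])
    finally have "\<bar>S - f x * P 0 t x\<bar> / P 0 t x < e" using Pp by (simp add: pos_divide_less_eq)
    moreover have "S / P 0 t x - f x = (S - f x * P 0 t x) / P 0 t x" using Pp by (simp add: field_simps)
    ultimately show ?thesis using Pp by (simp add: S_def)
  qed
  then show ?thesis using d1(1) d2(1) by (intro exI[of _ "min d1 d2"]) auto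
qed

text \<open>In this form w is the average of v with weight proportional to K(x - y)
  \<phi>0(y).\<close>

lemma w_eq_quotient:
  assumes t: "0 < t" shows "w t x = flow t (\<lambda>y. v y * \<phi>0 y) x / P 0 t x"
proof -
  have "\<phi>1 = (\<lambda>y. (- 1 / (2 * \<nu>)) * (v y * \<phi>0 y))" by (auto simp: \<phi>1_def)
  then have "P 1 t x = (- 1 / (2 * \<nu>)) * flow t (\<lambda>y. v y * \<phi>0 y) x"
    unfolding P1_eq[OF t] by (simp only: heat_conv_scale)
  then show ?thesis using nu by (simp add: w_def r_def)
qed

lemma w_initial:
  "0 < e \<Longrightarrow> \<exists>d>0. \<forall>t x. 0 < t \<longrightarrow> t < d \<longrightarrow> \<bar>w t x - v x\<bar> < e"
  using quotient_initial[OF v_cont v_per, of e] w_eq_quotient by (metis (no_types, lifting))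

end

section \<open>The energy near the initial time\<close>

context cole_hopf
begin

lemma phi0_g_int: "integrable circ (\<lambda>y. \<phi>0 y * g y)" "integrable circ (\<lambda>y. \<phi>0 y * (g y)\<^sup>2)"
  by (intro circ_integrable_mult_cont g_int g2_int phi0_cont)+

lemma heat_conv_continuous:
  assumes "0 < t" "integrable circ f" shows "continuous_on S (flow t f)"
  using DERIV_isCont[OF heat_conv_has_dx[OF _ assms(2)]] nu assms(1)
  by (intro continuous_at_imp_continuous_on ballI) simp

text \<open>Cauchy--Schwarz with respect to the weight \<open>K(x - y) \<phi>0(y)\<close>.\<close>

lemma quotient_square_le:
  assumes t: "0 < t"
  shows "(flow t (\<lambda>y. \<phi>0 y * g y) x / P 0 t x)\<^sup>2 \<le>
    flow t (\<lambda>y. \<phi>0 y * (g y)\<^sup>2) x / P 0 t x"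
proof -
  define S1 where "S1 = flow t (\<lambda>y. \<phi>0 y * g y) x"
  define S2 where "S2 = flow t (\<lambda>y. \<phi>0 y * (g y)\<^sup>2) x"
  define c where "c = S1 / P 0 t x"
  have pos: "0 < \<nu> * t" using nu t by simp
  have P: "0 < P 0 t x" by (rule P0_pos[OF t])
  \<comment> \<open>Equal to \<phi>0 (g - c)^2, where \<open>c\<close> is the weighted mean of g:
    the claim is the nonnegativity of the weighted variance.\<close>
  define f where "f y = \<phi>0 y * (g y)\<^sup>2 - (2 * c) * (\<phi>0 y * g y) + c\<^sup>2 * \<phi>0 y" for y
  have i: "integrable circ (\<lambda>y. (2 * c) * (\<phi>0 y * g y))" "integrable circ (\<lambda>y. c\<^sup>2 * \<phi>0 y)"
    using phi0_g_int(1) phi_int(1) by simp_all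
  have "f y = \<phi>0 y * (g y - c)\<^sup>2" for y by (simp add: f_def power2_diff algebra_simps)
  then have f0: "0 \<le> f y" for y using phi0_pos[of y] by simp
  have "integrable circ f" unfolding f_def using i phi0_g_int(2) by simp
  then have "0 \<le> flow t f x" by (rule heat_conv_ge[OF pos]) (rule f0)
  also have "flow t f x =
    flow t (\<lambda>y. \<phi>0 y * (g y)\<^sup>2 - (2 * c) * (\<phi>0 y * g y)) x + flow t (\<lambda>y. c\<^sup>2 * \<phi>0 y) x"
    unfolding f_def by (intro heat_conv_add pos i Bochner_Integration.integrable_diff phi0_g_int)
  also have "flow t (\<lambda>y. \<phi>0 y * (g y)\<^sup>2 - (2 * c) * (\<phi>0 y * g y)) x =
    S2 - flow t (\<lambda>y. (2 * c) * (\<phi>0 y * g y)) x"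
    unfolding S2_def by (intro heat_conv_diff pos i phi0_g_int)
  also have "flow t (\<lambda>y. (2 * c) * (\<phi>0 y * g y)) x = (2 * c) * S1"
    unfolding S1_def by (rule heat_conv_scale)
  also have "flow t (\<lambda>y. c\<^sup>2 * \<phi>0 y) x = c\<^sup>2 * P 0 t x"
    unfolding P_def by (rule heat_conv_scale)
  finally have "0 \<le> S2 - c * (c * P 0 t x)" using P by (simp add: c_def power2_eq_square)
  then have "c\<^sup>2 * P 0 t x \<le> S2" by (simp add: power2_eq_square)
  then show ?thesis using P by (simp add: pos_le_divide_eq c_def S1_def S2_def)
qed

text \<open>This is the weight that remains on g^2 once the heat flow has been moved to the other
  factor. It tends to 1 uniformly; the bound 2 is 4/3 from comparing \<open>P 0\<close> with
  \<open>\<phi>0\<close>, times 3/2 from the flow of 1 / \<phi>0.\<close>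

lemma heat_conv_inverse_P0:
  "\<exists>d>0. \<forall>t x. 0 < t \<longrightarrow> t < d \<longrightarrow> flow t (\<lambda>y. 1 / P 0 t y) x * \<phi>0 x \<le> 2"
proof -
  obtain m L where mL: "0 < m" "\<And>x. m \<le> \<phi>0 x" "0 < L" "\<And>x. \<phi>0 x \<le> L" using phi0_bounds by metis
  have inv: "continuous_on S (\<lambda>y. 1 / \<phi>0 y)" "circle_fun (\<lambda>y. 1 / \<phi>0 y)" for S
    using phi0_pos phi_per(1) by (auto intro!: continuous_intros phi0_cont simp: less_imp_neq[symmetric] circle_fun_def)
  obtain d1 where d1: "0 < d1" "\<forall>t x. 0 < t \<longrightarrow> t < d1 \<longrightarrow> \<bar>flow t \<phi>0 x - \<phi>0 x\<bar> < m / 4"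
    using heat_conv_initial_nu[OF phi0_cont phi_per(1), of "m / 4"] mL(1) by auto
  obtain d2 where d2: "0 < d2"
      "\<forall>t x. 0 < t \<longrightarrow> t < d2 \<longrightarrow> \<bar>flow t (\<lambda>y. 1 / \<phi>0 y) x - 1 / \<phi>0 x\<bar> < 1 / (2 * L)"
    using heat_conv_initial_nu[OF inv, of "1 / (2 * L)"] mL(3) by auto
  have "flow t (\<lambda>y. 1 / P 0 t y) x * \<phi>0 x \<le> 2" if t: "0 < t" "t < min d1 d2" for t x
  proof -
    have pos: "0 < \<nu> * t" using nu t by simp
    have "1 / P 0 t y \<le> 4/3 * (1 / \<phi>0 y)" for y
    proof -
      have "\<bar>P 0 t y - \<phi>0 y\<bar> < m / 4" using d1(2) t by (simp add: P_def)
      then have "3/4 * \<phi>0 y \<le> P 0 t y" using mL(2)[of y] by linarith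
      then have "1 / P 0 t y \<le> 1 / (3/4 * \<phi>0 y)"
        using phi0_pos[of y] P0_pos[OF t(1), of y] by (intro divide_left_mono) auto
      then show ?thesis by simp
    qed
    then have "flow t (\<lambda>y. 1 / P 0 t y) x \<le> flow t (\<lambda>y. 4/3 * (1 / \<phi>0 y)) x"
    proof (intro heat_conv_mono pos)
      have "continuous_on {0..1} (P 0 t)" unfolding P_def[abs_def] by (rule heat_conv_continuous[OF t(1) phi_int(1)])
      then show "integrable circ (\<lambda>y. 1 / P 0 t y)"
        using P0_pos[OF t(1)] by (intro circ_integrable_continuous continuous_intros) (auto simp: less_imp_neq[symmetric])
      show "integrable circ (\<lambda>y. 4/3 * (1 / \<phi>0 y))"
        by (intro circ_integrable_continuous continuous_on_mult continuous_on_const inv)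
    qed
    also have "\<dots> = 4/3 * flow t (\<lambda>y. 1 / \<phi>0 y) x" by (rule heat_conv_scale)
    also have "\<dots> \<le> 4/3 * (3/2 * (1 / \<phi>0 x))"
    proof (rule mult_left_mono)
      have "\<bar>flow t (\<lambda>y. 1 / \<phi>0 y) x - 1 / \<phi>0 x\<bar> < 1 / (2 * L)" using d2(2) t by simp
      moreover have "1 / (2 * L) \<le> 1 / (2 * \<phi>0 x)"
        using mL(3,4) phi0_pos[of x] by (intro divide_left_mono) auto
      moreover have "1 / (2 * \<phi>0 x) = 1/2 * (1 / \<phi>0 x)" by simp
      ultimately show "flow t (\<lambda>y. 1 / \<phi>0 y) x \<le> 3/2 * (1 / \<phi>0 x)" by linarith
    qed simp
    finally have "flow t (\<lambda>y. 1 / P 0 t y) x \<le> 2 / \<phi>0 x" by simp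
    then show ?thesis using phi0_pos[of x] by (simp add: pos_le_divide_eq)
  qed
  then show ?thesis using d1(1) d2(1) by (intro exI[of _ "min d1 d2"]) auto
qed

text \<open>After the weighted Cauchy--Schwarz inequality, self-adjointness frees g^2 from the heat
  flow, so the bound refers to g only through its L^2 norm.\<close>

lemma quotient_L2_le:
  assumes t: "0 < t" and h: "\<And>x. flow t (\<lambda>y. 1 / P 0 t y) x * \<phi>0 x \<le> 2"
  shows "(LINT x|circ. (flow t (\<lambda>y. \<phi>0 y * g y) x / P 0 t x)\<^sup>2) \<le> 2"
proof -
  have pos: "0 < \<nu> * t" using nu t by simp
  have Pc: "continuous_on {0..1} (P 0 t)" unfolding P_def[abs_def] by (rule heat_conv_continuous[OF t phi_int(1)])
  have Pn: "P 0 t x \<noteq> 0" for x using P0_pos[OF t, of x] by simp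
  have Pi: "continuous_on {0..1} (\<lambda>x. 1 / P 0 t x)" using Pn by (intro continuous_intros Pc) auto
  have "(LINT x|circ. (flow t (\<lambda>y. \<phi>0 y * g y) x / P 0 t x)\<^sup>2) \<le>
    (LINT x|circ. flow t (\<lambda>y. \<phi>0 y * (g y)\<^sup>2) x * (1 / P 0 t x))"
  proof (rule circ_integral_mono)
    show "integrable circ (\<lambda>x. (flow t (\<lambda>y. \<phi>0 y * g y) x / P 0 t x)\<^sup>2)"
      using Pn by (intro circ_integrable_continuous continuous_intros heat_conv_continuous t phi0_g_int Pc) auto
    show "integrable circ (\<lambda>x. flow t (\<lambda>y. \<phi>0 y * (g y)\<^sup>2) x * (1 / P 0 t x))"
      by (intro circ_integrable_continuous continuous_on_mult heat_conv_continuous t phi0_g_int Pi)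
  qed (use quotient_square_le[OF t] in simp)
  also have "\<dots> = (LINT y|circ. flow t (\<lambda>y. 1 / P 0 t y) y * (\<phi>0 y * (g y)\<^sup>2))"
    by (rule heat_conv_adjoint[OF pos phi0_g_int(2) Pi])
  also have "\<dots> \<le> (LINT y|circ. 2 * (g y)\<^sup>2)"
  proof (rule circ_integral_mono)
    show "integrable circ (\<lambda>y. flow t (\<lambda>y. 1 / P 0 t y) y * (\<phi>0 y * (g y)\<^sup>2))"
      by (intro circ_integrable_mult_cont phi0_g_int heat_conv_continuous t circ_integrable_continuous Pi)
    show "integrable circ (\<lambda>y. 2 * (g y)\<^sup>2)" using g2_int by simp
    show "flow t (\<lambda>y. 1 / P 0 t y) y * (\<phi>0 y * (g y)\<^sup>2) \<le> 2 * (g y)\<^sup>2" for y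
      using mult_right_mono[OF h[of y], of "(g y)\<^sup>2"] by (simp add: mult.assoc)
  qed
  also have "\<dots> \<le> 2" using g_norm by simp
  finally show ?thesis .
qed

text \<open>By the Cole--Hopf formula \<open>w\<^sub>x = A + (w\<^sup>2 - Q) / (2 \<nu>)\<close>, where \<open>w\<^sup>2\<close> and \<open>Q\<close> have the same uniform limit \<open>v\<^sup>2\<close>
  at time \<open>0\<close>.\<close>

lemma energy_initial: "\<exists>d>0. \<forall>t. 0 < t \<longrightarrow> t < d \<longrightarrow> energy t \<le> 5"
proof -
  obtain L where L: "0 < L" "\<And>x. \<bar>v x\<bar> \<le> L" using phi0_bounds by metis
  \<comment> \<open>As |w + v| \<le> 2 L + 1, this keeps w^2 within \<nu>/2 of v^2. Together with
    the error \<nu>/2 of Q, the remainder divided by 2 \<nu> is at most 1/2.\<close>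
  define \<delta> where "\<delta> = min 1 (\<nu> / (2 * (2 * L + 1)))"
  have \<delta>: "0 < \<delta>" "\<delta> \<le> 1" "\<delta> * (2 * L + 1) \<le> \<nu> / 2"
  proof -
    show "0 < \<delta>" "\<delta> \<le> 1" using nu L(1) by (simp_all add: \<delta>_def)
    have "\<delta> * (2 * L + 1) \<le> \<nu> / (2 * (2 * L + 1)) * (2 * L + 1)"
      using L(1) by (intro mult_right_mono) (auto simp: \<delta>_def)
    also have "\<dots> = \<nu> / 2" using L(1) by (simp add: divide_simps)
    finally show "\<delta> * (2 * L + 1) \<le> \<nu> / 2" .
  qed
  have v2: "continuous_on UNIV (\<lambda>x. (v x)\<^sup>2)" "circle_fun (\<lambda>x. (v x)\<^sup>2)"
    using v_per by (auto intro!: continuous_intros v_cont simp: circle_fun_def)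
  obtain d1 where d1: "0 < d1" "\<forall>t x. 0 < t \<longrightarrow> t < d1 \<longrightarrow>
      flow t (\<lambda>y. 1 / P 0 t y) x * \<phi>0 x \<le> 2" using heat_conv_inverse_P0 by blast
  obtain d2 where d2: "0 < d2" "\<forall>t x. 0 < t \<longrightarrow> t < d2 \<longrightarrow> \<bar>w t x - v x\<bar> < \<delta>"
    using w_initial[OF \<delta>(1)] by blast
  obtain d3 where d3: "0 < d3" "\<forall>t x. 0 < t \<longrightarrow> t < d3 \<longrightarrow>
      \<bar>flow t (\<lambda>y. (v y)\<^sup>2 * \<phi>0 y) x / P 0 t x - (v x)\<^sup>2\<bar> < \<nu> / 2"
    using quotient_initial[OF v2, of "\<nu> / 2"] nu by auto
  have "energy t \<le> 5" if t: "0 < t" "t < min d1 (min d2 d3)" for t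
  proof -
    define A where "A x = flow t (\<lambda>y. \<phi>0 y * g y) x / P 0 t x" for x
    define Q where "Q x = flow t (\<lambda>y. (v y)\<^sup>2 * \<phi>0 y) x / P 0 t x" for x
    have Pn: "P 0 t x \<noteq> 0" for x using P0_pos[OF t(1), of x] by simp
    have w1_eq: "w1 t x = A x + ((w t x)\<^sup>2 - Q x) / (2 * \<nu>)" for x
    proof -
      have "- 2 * \<nu> * r 2 t x = A x - Q x / (2 * \<nu>)"
        using P2_eq[OF t(1), of x] Pn[of x] by (simp add: r_def A_def Q_def field_simps)
      moreover have "(w t x)\<^sup>2 / (2 * \<nu>) = 2 * \<nu> * (r 1 t x)\<^sup>2"
        using nu by (simp add: w_def power2_eq_square)
      ultimately show ?thesis by (simp add: w1_def right_diff_distrib diff_divide_distrib)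
    qed
    have R: "\<bar>((w t x)\<^sup>2 - Q x) / (2 * \<nu>)\<bar> \<le> 1/2" for x
    proof -
      have wv: "\<bar>w t x - v x\<bar> < \<delta>" using d2(2) t by simp
      have "\<bar>(w t x)\<^sup>2 - (v x)\<^sup>2\<bar> = \<bar>w t x - v x\<bar> * \<bar>w t x + v x\<bar>"
        by (simp add: power2_eq_square algebra_simps flip: abs_mult)
      also have "\<dots> \<le> \<delta> * (2 * L + 1)"
        using wv L(2)[of x] \<delta>(2) by (intro mult_mono) linarith+
      finally have "\<bar>(w t x)\<^sup>2 - (v x)\<^sup>2\<bar> \<le> \<nu> / 2" using \<delta>(3) by linarith
      moreover have "\<bar>Q x - (v x)\<^sup>2\<bar> < \<nu> / 2" using d3(2) t by (simp add: Q_def)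
      ultimately have "\<bar>(w t x)\<^sup>2 - Q x\<bar> \<le> \<nu>" by linarith
      then show ?thesis using nu by (simp add: abs_mult divide_le_eq)
    qed
    have Ac: "continuous_on {0..1} A"
      unfolding A_def using Pn
      by (intro continuous_intros heat_conv_continuous t phi0_g_int) (auto simp: P_def[abs_def] intro!: heat_conv_continuous t phi_int)
    have A2i: "integrable circ (\<lambda>x. (A x)\<^sup>2)" by (intro circ_integrable_continuous continuous_intros Ac)
    have "energy t \<le> (LINT x|circ. 2 * (A x)\<^sup>2 + 1/2)"
      unfolding energy_def
    proof (rule circ_integral_mono)
      show "integrable circ (\<lambda>x. (w1 t x)\<^sup>2)" by (intro circ_integrable_continuous continuous_intros cont_x t)
      show "integrable circ (\<lambda>x. 2 * (A x)\<^sup>2 + 1/2)" using A2i by simp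
      fix x
      \<comment> \<open>(A + b)^2 \<le> 2 A^2 + 2 b^2 with |b| \<le> 1/2. As the integral of A^2 is
        at most 2, the energy is at most 9/2.\<close>
      define b where "b = ((w t x)\<^sup>2 - Q x) / (2 * \<nu>)"
      have "b\<^sup>2 \<le> (1/2)\<^sup>2" using R[of x] unfolding b_def by (metis abs_ge_zero power2_abs power_mono)
      moreover have "2 * A x * b \<le> (A x)\<^sup>2 + b\<^sup>2" by (rule sum_squares_bound)
      ultimately show "(w1 t x)\<^sup>2 \<le> 2 * (A x)\<^sup>2 + 1/2"
        unfolding w1_eq b_def[symmetric] power2_sum by (simp add: power2_eq_square)
    qed
    also have "\<dots> = 2 * (LINT x|circ. (A x)\<^sup>2) + 1/2" using A2i by simp
    also have "\<dots> \<le> 2 * 2 + 1/2"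
    proof -
      have "(LINT x|circ. (A x)\<^sup>2) \<le> 2"
        unfolding A_def using d1(2) t by (intro quotient_L2_le) auto
      then show ?thesis by simp
    qed
    finally show ?thesis by simp
  qed
  then show ?thesis using d1(1) d2(1) d3(1) by (intro exI[of _ "min d1 (min d2 d3)"]) auto
qed

lemma energy_bound:
  assumes t: "0 < t" shows "energy t \<le> 5 + 54 / \<nu>"
proof -
  obtain d where d: "0 < d" "\<forall>t. 0 < t \<longrightarrow> t < d \<longrightarrow> energy t \<le> 5" using energy_initial by blast
  obtain M where M: "\<And>t x. 0 < t \<Longrightarrow> \<bar>w t x\<bar> \<le> M" using w_bounded by blast
  define s where "s = min d t / 2"
  have s: "0 < s" "s \<le> t" "s < d" using d(1) t by (auto simp: s_def)
  show ?thesis by (rule gradient_bound[OF s(1,2), of M]) (use d(2) s M in auto)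
qed

end

text \<open>The given solution is identified with the Cole--Hopf function by uniqueness: both
  satisfy Duhamel's formula with the same free term, because passing from \<open>u0\<close> to its
  continuous representative changes it on a null set only, which the heat flow at positive times
  does not see.\<close>

lemma burgers_gradient_bound:
  assumes u0: "u0 \<in> circle_H1" and mean: "circle_integral u0 = 0" and norm: "circle_L2_norm (weak_dx u0) \<le> 1"
    and nu: "0 < \<nu>" and sol: "burgers_solution \<nu> u0 u" and t: "0 < t"
  shows "u t \<in> circle_H1 \<and> (circle_L2_norm (weak_dx (u t)))\<^sup>2 \<le> 5 + 54 / \<nu>"
proof -
  obtain g where g: "has_weak_dx u0 g" using u0 by (auto simp: circle_H1_def)
  have u0_L2: "u0 \<in> circle_L2" and g_L2: "g \<in> circle_L2" using g by (auto simp: has_weak_dx_def)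
  note u0' = circle_L2_D[OF u0_L2] and g' = circle_L2_D[OF g_L2]
  have u0_mean: "integral\<^sup>L circ u0 = 0" using mean by (simp add: circle_integral_eq)
  obtain v where v: "continuous_on UNIV v" "circle_fun v" "AE x in circ. u0 x = v x"
    "integral\<^sup>L circ v = 0"
    and parts: "\<And>\<psi> \<psi>'. continuous_on {0..1} \<psi>' \<Longrightarrow> (\<And>x. x \<in> {0..1} \<Longrightarrow> (\<psi> has_real_derivative \<psi>' x) (at x)) \<Longrightarrow>
       \<psi> 1 = \<psi> 0 \<Longrightarrow> (LINT x|circ. v x * \<psi>' x) = - (LINT x|circ. g x * \<psi> x)"
    using H1_continuous_representative[OF g u0_mean] by blast
  obtain V where V: "circle_fun V" "\<And>x. (V has_real_derivative v x) (at x)"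
    using circle_antiderivative[OF v(1,2,4)] by blast
  have g_norm: "(LINT x|circ. (g x)\<^sup>2) \<le> 1"
  proof -
    have "0 \<le> circle_L2_norm (weak_dx u0)"
      unfolding circle_L2_norm_def circle_integral_eq by (simp add: circ_integral_nonneg)
    then have "(circle_L2_norm (weak_dx u0))\<^sup>2 \<le> 1\<^sup>2" using norm by (intro power_mono)
    then show ?thesis by (simp add: circle_L2_norm_weak_dx[OF g])
  qed
  interpret cole_hopf \<nu> v g V
    by unfold_locales (use nu v V g' g_norm parts in auto)
  have u_meas: "set_borel_measurable borel ({0<..} \<times> UNIV) (\<lambda>(t, x). u t x)"
    and u_bd: "\<And>T. 0 < T \<Longrightarrow> \<exists>M. \<forall>t\<in>{0<..<T}. \<forall>x. \<bar>u t x\<bar> \<le> M"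
    and u_eq: "\<And>t x. 0 \<le> t \<Longrightarrow> u t x = heat_semigroup (\<nu> * t) u0 x
        - (LINT s:{0<..<t}|lborel. deriv (heat_semigroup (\<nu> * (t - s)) (\<lambda>y. (1/2) * (u s y)\<^sup>2)) x)"
    using sol by (auto simp: burgers_solution_def)
  \<comment> \<open>Uniqueness is formulated on an open time interval, which has to contain t, and
    the solution is bounded only on bounded intervals.\<close>
  define T where "T = t + 1"
  have T: "0 < T" "t < T" using t by (auto simp: T_def)
  obtain M1 where M1: "\<forall>t\<in>{0<..<T}. \<forall>x. \<bar>u t x\<bar> \<le> M1" using u_bd[OF T(1)] by blast
  obtain M2 where M2: "\<And>t x. 0 < t \<Longrightarrow> \<bar>w t x\<bar> \<le> M2" using w_bounded by blast
  have u_mild: "u t x = heat_conv 0 (\<nu> * t) v x -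
      (LINT s:{0<..<t}|lborel. heat_conv 1 (\<nu> * (t - s)) (\<lambda>y. 1/2 * (u s y)\<^sup>2) x)"
    if t: "0 < t" "t < T" for t x
  proof -
    have "heat_semigroup (\<nu> * t) u0 x = heat_conv 0 (\<nu> * t) u0 x"
      using nu t by (intro heat_semigroup_eq) simp
    also have "\<dots> = heat_conv 0 (\<nu> * t) v x"
      unfolding heat_conv_def
    proof (rule integral_cong_AE)
      show "(\<lambda>y. heat_kernel_dx 0 (\<nu> * t) (x - y) * u0 y) \<in> borel_measurable circ"
        using measurable_circ[OF u0'(2)] by measurable
      show "(\<lambda>y. heat_kernel_dx 0 (\<nu> * t) (x - y) * v y) \<in> borel_measurable circ"
        using borel_measurable_cont_circ[OF v_cont'] by measurable
      show "AE y in circ. heat_kernel_dx 0 (\<nu> * t) (x - y) * u0 y = heat_kernel_dx 0 (\<nu> * t) (x - y) * v y"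
        using v(3) by eventually_elim simp
    qed
    finally have 1: "heat_semigroup (\<nu> * t) u0 x = heat_conv 0 (\<nu> * t) v x" .
    have "(LINT s:{0<..<t}|lborel. deriv (heat_semigroup (\<nu> * (t - s)) (\<lambda>y. (1/2) * (u s y)\<^sup>2)) x) =
      (LINT s:{0<..<t}|lborel. heat_conv 1 (\<nu> * (t - s)) (\<lambda>y. 1/2 * (u s y)\<^sup>2) x)"
    proof (rule set_lebesgue_integral_cong)
      show "\<forall>s. s \<in> {0<..<t} \<longrightarrow> deriv (heat_semigroup (\<nu> * (t - s)) (\<lambda>y. (1/2) * (u s y)\<^sup>2)) x =
         heat_conv 1 (\<nu> * (t - s)) (\<lambda>y. 1/2 * (u s y)\<^sup>2) x"
      proof (intro allI impI)
        fix s assume "s \<in> {0<..<t}"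
        then have s: "0 < s" "s < t" "s < T" using t by auto
        have pos: "0 < \<nu> * (t - s)" using s nu by simp
        have um: "u s \<in> borel_measurable circ"
          by (rule measurable_circ[OF space_time_section_measurable[OF u_meas s(1)]])
        have "integrable circ (\<lambda>y. 1/2 * (u s y)\<^sup>2)"
        proof (rule circ_integrable_bounded)
          show "(\<lambda>y. 1/2 * (u s y)\<^sup>2) \<in> borel_measurable circ" using um by measurable
          fix y
          have "\<bar>u s y\<bar> \<le> M1" using M1 s by auto
          then have "(u s y)\<^sup>2 \<le> M1\<^sup>2" by (metis abs_ge_zero power2_abs power_mono)
          then show "\<bar>1/2 * (u s y)\<^sup>2\<bar> \<le> 1/2 * M1\<^sup>2" by simp
        qed
        note d = heat_conv_has_dx[OF pos this, of 0 x]
        have "heat_semigroup (\<nu> * (t - s)) (\<lambda>y. (1/2) * (u s y)\<^sup>2) = heat_conv 0 (\<nu> * (t - s)) (\<lambda>y. 1/2 * (u s y)\<^sup>2)"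
          using heat_semigroup_eq[OF pos] by blast
        then show "deriv (heat_semigroup (\<nu> * (t - s)) (\<lambda>y. (1/2) * (u s y)\<^sup>2)) x =
           heat_conv 1 (\<nu> * (t - s)) (\<lambda>y. 1/2 * (u s y)\<^sup>2) x"
          using DERIV_imp_deriv[OF d] by (simp only: One_nat_def)
      qed
    qed simp
    then show ?thesis using u_eq[of t x] t 1 by simp
  qed
  have "u t x = w t x" for x
  proof (rule mild_solution_unique[OF nu T(1) u_meas w_measurable, where M = "max M1 M2" and h = "\<lambda>t. heat_conv 0 (\<nu> * t) v"])
    show "\<bar>u t x\<bar> \<le> max M1 M2" if "0 < t" "t < T" for t x using M1 that by (auto simp: le_max_iff_disj)
    show "\<bar>w t x\<bar> \<le> max M1 M2" if "0 < t" for t x using M2[OF that, of x] by (auto simp: le_max_iff_disj)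
    show "w t x = heat_conv 0 (\<nu> * t) v x -
      (LINT s:{0<..<t}|lborel. heat_conv 1 (\<nu> * (t - s)) (\<lambda>y. 1/2 * (w s y)\<^sup>2) x)" if "0 < t" for t x
      by (rule duhamel[OF v(1,2) w_initial M2 that])
  qed (use u_mild t T in auto)
  then have uw: "u t = w t" by blast
  have "has_weak_dx (w t) (w1 t)"
    by (rule has_weak_dx_classical[OF per(1)[OF t] cont_x(2)[OF t] per(2)[OF t] dx(1)[OF t]])
  moreover from circle_L2_norm_weak_dx[OF this]
  have "(circle_L2_norm (weak_dx (w t)))\<^sup>2 \<le> 5 + 54 / \<nu>"
    using energy_bound[OF t] by (simp add: energy_def)
  ultimately show ?thesis unfolding uw by (auto simp: circle_H1_def)
qed

theorem theorem1p1:
  shows "\<exists>C0::real. C0 > 0 \<and>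
    (\<forall>(u0 :: real \<Rightarrow> real) (\<nu> :: real) (u :: real \<Rightarrow> real \<Rightarrow> real).
       u0 \<in> circle_H1 \<longrightarrow>
       circle_integral u0 = 0 \<longrightarrow>
       circle_L2_norm (weak_dx u0) \<le> 1 \<longrightarrow>
       \<nu> > 0 \<longrightarrow>
       burgers_solution \<nu> u0 u \<longrightarrow>
       (\<forall>t\<ge>0. u t \<in> circle_H1 \<and>
               (circle_L2_norm (weak_dx (u t)))\<^sup>2 \<le> C0 * (1 + inverse \<nu>)))"
proof (intro exI[of _ 54] conjI allI impI)
  show "(0::real) < 54" by simp
  fix u0 \<nu> u and t :: real
  assume *: "u0 \<in> circle_H1" "circle_integral u0 = 0" "circle_L2_norm (weak_dx u0) \<le> 1" "0 < \<nu>"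
    "burgers_solution \<nu> u0 u" and t: "0 \<le> t"
  have inv: "0 < inverse \<nu>" using *(4) by simp
  have "u t \<in> circle_H1 \<and> (circle_L2_norm (weak_dx (u t)))\<^sup>2 \<le> 5 + 54 / \<nu>"
  proof (cases "t = 0")
    case True
    \<comment> \<open>At time 0 the semigroup is the identity by definition and the time integral
      runs over the empty set, so the equality is pointwise and not only almost everywhere.\<close>
    have "u 0 x = u0 x" for x
      using *(5) by (simp add: burgers_solution_def heat_semigroup_def set_lebesgue_integral_def)
    then have "u t = u0" using True by blast
    moreover have "(circle_L2_norm (weak_dx u0))\<^sup>2 \<le> 5 + 54 / \<nu>"
    proof -
      have "(circle_L2_norm (weak_dx u0))\<^sup>2 \<le> 1\<^sup>2"
      using *(3) by (intro power_mono) (auto simp: circle_L2_norm_def circle_integral_eq circ_integral_nonneg)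
      moreover have "0 \<le> 54 / \<nu>" using *(4) by simp
      ultimately show ?thesis unfolding one_power2 by linarith
    qed
    ultimately show ?thesis using *(1) by auto
  next
    case False
    with t show ?thesis by (intro burgers_gradient_bound[OF *]) simp
  qed
  \<comment> \<open>The larger of the two constants, 54, serves for both terms.\<close>
  moreover have "5 + 54 / \<nu> \<le> 54 * (1 + inverse \<nu>)" by (simp add: divide_inverse)
  ultimately show "u t \<in> circle_H1" "(circle_L2_norm (weak_dx (u t)))\<^sup>2 \<le> 54 * (1 + inverse \<nu>)"
    by auto
qed

end
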